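(* Let $C\ell_{p,q,r}$, $p+q+r=n\ge1$, be a geometric algebra over $\mathbb{F}$. The Lie algebras (with respect to the commutator $[U,V]=UV-VU$) of the Lie groups defined in the context, as subspaces of $C\ell_{p,q,r}$, and their dimensions over $\mathbb{F}$, are as follows (conditions on $n$ are mod $4$; no condition on $r$ means any $0\le r\le n$). **Groups of type A.** (A1) The Lie algebra is $\Lambda^{\overline0}_r\oplus C\ell^{\overline{23}}_{p,q,r}$, of dimension $\dim_A$, for: $A^{\overline{01}}_{p,q,r}$ with $n\equiv0,2,3$; $A^{\overline{23}}_{p,q,r}$ with $n\equiv0$, or $n\equiv2$ and $r\le n-2$, or $n\equiv3$ and $r\le n-3$; $\check A^{\overline{12}}_{p,q,r}$ with $n\equiv0,3$, or $n\equiv1$ and $r\ne n$, or $n\equiv2$ and $r\le n-2$; $\check A^{\overline{03}}_{p,q,r}$ with $n\equiv2,3$, or $n\equiv0$ and ($r\le n-3$ or $r=n$), or $n\equiv1$ and ($r\le n-4$ or $r=n$). (A2) $\Lambda^{\overline0}_r\oplus C\ell^{\overline{23}}_{p,q,r}\oplus C\ell^n_{p,q,r}$, of dimension $\dim_A+1$, for: $A^{\overline{01}}_{p,q,r}$ and $A^{\overline{23}}_{p,q,r}$ with $n\equiv1$; $\check A^{\overline{12}}_{p,q,r}$ with $n\equiv1$, $r=n$; $\check A^{\overline{03}}_{p,q,r}$ with $n\equiv0$, $r\in\{n-2,n-1\}$. (A3) $\Lambda^{\overline0}_r\oplus C\ell^{\overline{23}}_{p,q,r}\oplus\Lambda^{n-1}_r$,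 of dimension $\dim_A+\frac{r!}{(n-1)!(r-n+1)!}$, for $A^{\overline{23}}_{p,q,r}$ and $\check A^{\overline{12}}_{p,q,r}$ with $n\equiv2$, $r\in\{n-1,n\}$. (A4) $\Lambda^{\overline0}_r\oplus C\ell^{\overline{23}}_{p,q,r}\oplus\Lambda^{n-2}_r$, of dimension $\dim_A+\frac{r!}{(n-2)!(r-n+2)!}$, for $A^{\overline{23}}_{p,q,r}$ with $n\equiv3$, $r\ge n-2$. (A5) For $\check A^{\overline{03}}_{p,q,r}$ with $n\equiv1$: if $r=n-1$, $\Lambda^{\overline0}_r\oplus C\ell^{\overline{23}}_{p,q,r}\oplus\{C\ell^1_{p,q,0}\Lambda^{n-2}_r\}$, of dimension $\dim_A+n-1$; if $r=n-3$, $\Lambda^{\overline0}_r\oplus C\ell^{\overline{23}}_{p,q,r}\oplus\{C\ell^2_{p,q,0}\Lambda^{n-3}_r\}$, of dimension $\dim_A+3$; if $r=n-2$, $\Lambda^{\overline0}_r\oplus C\ell^{\overline{23}}_{p,q,r}\oplus\{C\ell^1_{p,q,0}\Lambda^{n-2}_r\}\oplus\{C\ell^2_{p,q,0}\Lambda^{n-3}_r\}$, of dimension $\dim_A+n$. **Groups of type B.** (B1) $\Lambda^{\overline0}_r\oplus C\ell^{\overline{12}}_{p,q,r}$, of dimension $\dim_B$, for: $\check B^{\overline{01}}_{p,q,r}$ (any $n$); $B^{\overline{12}}_{p,q,r}$ with $n\equiv0,1,2$; $B^{\overline{03}}_{p,q,r}$ with $n\equiv0$ and $r\le n-3$, or $n\equiv1$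 and $r\le n-4$, or $n\equiv2$; $\check B^{\overline{23}}_{p,q,r}$ with $n\equiv1,2$, or $n\equiv0$ and $r\le n-3$, or $n\equiv3$ and $r\le n-2$. (B2) $\Lambda^{\overline0}_r\oplus C\ell^{\overline{12}}_{p,q,r}\oplus C\ell^n_{p,q,r}$, of dimension $\dim_B+1$, for: $B^{\overline{03}}_{p,q,r}$ and $B^{\overline{12}}_{p,q,r}$ with $n\equiv3$; $\check B^{\overline{23}}_{p,q,r}$ with $n\equiv3$, $r\in\{n-1,n\}$. (B3) For both $B^{\overline{03}}_{p,q,r}$ and $\check B^{\overline{23}}_{p,q,r}$ with $n\equiv0$: if $r=n$, $\Lambda^{\overline0}_r\oplus C\ell^{\overline{12}}_{p,q,r}\oplus\Lambda^{n-1}_r$, of dimension $\dim_B+n$; if $r=n-2$, $\Lambda^{\overline0}_r\oplus C\ell^{\overline{12}}_{p,q,r}\oplus\{C\ell^1_{p,q,0}\Lambda^{n-2}_r\}\oplus\{C\ell^2_{p,q,0}\Lambda^{n-2}_r\}$, of dimension $\dim_B+3$; if $r=n-1$, $\Lambda^{\overline0}_r\oplus C\ell^{\overline{12}}_{p,q,r}\oplus\Lambda^{n-1}_r\oplus\{C\ell^1_{p,q,0}\Lambda^{n-2}_r\}\oplus\{C\ell^1_{p,q,0}\Lambda^{n-1}_r\}$, of dimension $\dim_B+n+1$. (B4) For $B^{\overline{03}}_{p,q,r}$ with $n\equiv1$: if $r=n$, $\Lambda^{\overline0}_r\oplus C\ell^{\overline{12}}_{p,q,r}\oplus\Lambda^{n-2}_r$,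 of dimension $\dim_B+\frac{n(n-1)}2$; if $r=n-3$, $\Lambda^{\overline0}_r\oplus C\ell^{\overline{12}}_{p,q,r}\oplus\{C\ell^1_{p,q,0}\Lambda^{n-3}_r\}\oplus\{C\ell^2_{p,q,0}\Lambda^{n-3}_r\}$, of dimension $\dim_B+6$; if $r=n-1$, $\Lambda^{\overline0}_r\oplus C\ell^{\overline{12}}_{p,q,r}\oplus\Lambda^{n-2}_r\oplus\{C\ell^1_{p,q,0}\Lambda^{n-3}_r\}\oplus\{C\ell^1_{p,q,0}\Lambda^{n-2}_r\}$, of dimension $\dim_B+\frac{(n-1)(n+2)}2$; if $r=n-2$, $\Lambda^{\overline0}_r\oplus C\ell^{\overline{12}}_{p,q,r}\oplus\Lambda^{n-2}_r\oplus\{C\ell^1_{p,q,0}\Lambda^{n-3}_r\}\oplus\{C\ell^1_{p,q,0}\Lambda^{n-2}_r\}\oplus\{C\ell^2_{p,q,0}\Lambda^{n-3}_r\}$, of dimension $\dim_B+3n-3$. **Groups of type Q.** Write $L:=\Lambda^{\overline{013}}_r\oplus C\ell^{\overline2}_{p,q,r}$. (Q1) $L$, of dimension $\dim_Q$, for: $\tilde Q^{\overline{01}}_{p,q,r}$ with $n\equiv0$, or $n\equiv1$ and $r=n$, or $n\equiv2$ and ($r=n$ or $r\le n-4$), or $n\equiv3$ and ($r=n$ or $r\le n-5$); $\tilde Q^{\overline{23}}_{p,q,r}$ with $n\equiv0$ and ($r=n$ or $r\le n-4$), or $n\equiv1$ and $r=n$, or $n\equiv2$, or $n\equiv3$ and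 ($r=n$ or $r\le n-3$); $\tilde Q^{\overline{12}}_{p,q,r}$ with $n\equiv0,1,2$, or $n\equiv3$ and $r=n$; $\tilde Q^{\overline{03}}_{p,q,r}$ with $n\equiv0$ and ($r=n$ or $r\le n-4$), or $n\equiv1$ and ($r=n$ or $r\le n-5$), or $n\equiv2$ and ($r=n$ or $r\le n-4$), or $n\equiv3$ and $r=n$. (Q2) $L\oplus C\ell^n_{p,q,r}$, of dimension $\dim_Q+1$, for: $\tilde Q^{\overline{01}}_{p,q,r}$ and $\tilde Q^{\overline{23}}_{p,q,r}$ with $n\equiv1$, $r\ne n$; $\tilde Q^{\overline{23}}_{p,q,r}$ with $n\equiv3$, $r\in\{n-2,n-1\}$; $\tilde Q^{\overline{12}}_{p,q,r}$ and $\tilde Q^{\overline{03}}_{p,q,r}$ with $n\equiv3$, $r\neq n$. (Q3) For both $\tilde Q^{\overline{01}}_{p,q,r}$ and $\tilde Q^{\overline{03}}_{p,q,r}$ with $n\equiv2$: if $r=n-1$, $L\oplus\{C\ell^1_{p,q,0}\Lambda^{n-2}_r\}$, of dimension $\dim_Q+n-1$; if $r=n-3$, $L\oplus\{C\ell^2_{p,q,0}\Lambda^{n-3}_r\}$, of dimension $\dim_Q+3$; if $r=n-2$, $L\oplus\{C\ell^1_{p,q,0}\Lambda^{n-2}_r\}\oplus\{C\ell^2_{p,q,0}\Lambda^{n-3}_r\}$, of dimension $\dim_Q+n$. (Q4) With $n\equiv0$: for both $\tilde Q^{\overline{23}}_{p,q,r}$ and $\tilde Q^{\overline{03}}_{p,q,r}$,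 if $r=n-1$, $L\oplus\{C\ell^1_{p,q,0}\Lambda^{n-2}_r\}\oplus C\ell^n_{p,q,r}$, of dimension $\dim_Q+n$, and if $r=n-2$, $L\oplus\{C\ell^1_{p,q,0}\Lambda^{n-2}_r\}\oplus\{C\ell^2_{p,q,0}\Lambda^{n-3}_r\}\oplus C\ell^n_{p,q,r}$, of dimension $\dim_Q+n+1$; if $r=n-3$, for $\tilde Q^{\overline{03}}_{p,q,r}$, $L\oplus\{C\ell^2_{p,q,0}\Lambda^{n-3}_r\}$, of dimension $\dim_Q+3$, and for $\tilde Q^{\overline{23}}_{p,q,r}$, $L\oplus\{C\ell^2_{p,q,0}\Lambda^{n-3}_r\}\oplus C\ell^n_{p,q,r}$, of dimension $\dim_Q+4$. (Q5) For $\tilde Q^{\overline{01}}_{p,q,r}$ with $n\equiv3$: if $r=n-1$, $L\oplus\{C\ell^1_{p,q,0}\Lambda^{n-3}_r\}$, of dimension $\dim_Q+\frac{(n-1)(n-2)}2$ if $n\ge7$ and $\dim_Q+1$ if $n=3$; if $r=n-4$, $L\oplus\{C\ell^2_{p,q,0}\Lambda^{n-4}_r\}$, of dimension $\dim_Q+6$; if $r\in\{n-3,n-2\}$, $L\oplus\{C\ell^1_{p,q,0}\Lambda^{n-3}_r\}\oplus\{C\ell^2_{p,q,0}\Lambda^{n-4}_r\}$, of dimension $\dim_Q+\frac{(p+q)\,r!}{(r-n+3)!(n-3)!}+\frac{(p+q)(p+q-1)\,r!}{2(r-n+4)!(n-4)!}$ if $n\ge7$ and $\dim_Q+p+q$ if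 $n=3$. (Q6) For $\tilde Q^{\overline{03}}_{p,q,r}$ with $n\equiv1$: if $r=n-4$, $L\oplus\{C\ell^2_{p,q,0}\Lambda^{n-4}_r\}$, of dimension $\dim_Q+6$; if $r=n-3$, $L\oplus\{C\ell^1_{p,q,0}\Lambda^{n-3}_r\}\oplus\{C\ell^2_{p,q,0}\Lambda^{n-4}_r\}\oplus\{C\ell^2_{p,q,0}\Lambda^{n-3}_r\}$, of dimension $\dim_Q+3n-3$; if $r=n-1$, $L\oplus\{C\ell^1_{p,q,0}\Lambda^{n-2}_r\}\oplus\{C\ell^1_{p,q,0}\Lambda^{n-3}_r\}\oplus C\ell^n_{p,q,r}$, of dimension $\dim_Q+n+\frac{(n-1)(n-2)}2$; if $r=n-2$, $L\oplus\{C\ell^1_{p,q,0}\Lambda^{n-2}_r\}\oplus\{C\ell^1_{p,q,0}\Lambda^{n-3}_r\}\oplus\{C\ell^2_{p,q,0}\Lambda^{n-3}_r\}\oplus\{C\ell^2_{p,q,0}\Lambda^{n-4}_r\}\oplus C\ell^n_{p,q,r}$, of dimension $\dim_Q+\frac{n(n+1)}2$.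
   Context: $C\ell_{p,q,r}$, $p+q+r=n\ge1$, is the Clifford (geometric) algebra over the real space $\mathbb{R}^{p,q,r}$ or the complex space $\mathbb{C}^{p+q,0,r}$ (field $\mathbb{F}=\mathbb{R}$ or $\mathbb{C}$ respectively), with identity $e$ and generators $e_1,\dots,e_n$ satisfying $e_ae_b+e_be_a=2\eta_{ab}e$, where $\eta$ is diagonal with $p$ entries $+1$, then $q$ entries $-1$, then $r$ entries $0$ (in the complex case, $p+q$ entries $+1$ and $r$ entries $0$). $C\ell^k_{p,q,r}$ is the grade-$k$ subspace, spanned by $e_{a_1}\cdots e_{a_k}$, $a_1<\dots<a_k$ (it is $\{0\}$ for $k<0$ or $k>n$). $\Lambda_r=C\ell_{0,0,r}$ is the Grassmann subalgebra generated by the $r$ null generators $e_{p+q+1},\dots,e_n$ ($\Lambda_0=\mathbb{F}e$), $\Lambda^k_r$ its grade-$k$ part ($\{0\}$ for $k<0$ or $k>r$). $C\ell_{p,q,0}$ is regarded as the subalgebra generated by $e_1,\dots,e_{p+q}$, and $\{C\ell^k_{p,q,0}\Lambda^l_r\}$ is the span of the products $ab$, $a\in C\ell^k_{p,q,0}$, $b\in\Lambda^l_r$. $\widehat U$ is the grade involution (multiplication by $(-1)^k$ on grade $k$), $\widetilde U$ is the reversion (multiplication by $(-1)^{k(k-1)/2}$ on grade $k$, an anti-automorphism), $\widehat{\widetilde U}$ is the Clifford conjugation. $C\ell^{(0)}_{p,q,r}$ is the even subspace. For $k=0,1,2,3$, $C\ell^{\overline{k}}_{p,q,r}$ is the direct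 sum of the subspaces of grades congruent to $k$ mod $4$; $C\ell^{\overline{kl}}_{p,q,r}=C\ell^{\overline{k}}_{p,q,r}\oplus C\ell^{\overline{l}}_{p,q,r}$; $\Lambda^{\overline0}_r$ and $\Lambda^{\overline{013}}_r$ are the direct sums of the $\Lambda^k_r$ with $k\equiv0$, respectively $k\equiv0,1,3$, mod $4$. $H^\times$ denotes the set of invertible elements of a set $H$. $Z^m_{p,q,r}=\{X:\ XV=VX\ \forall V\in C\ell^m_{p,q,r}\}$ and $\check Z^m_{p,q,r}=\{X:\ \widehat XV=VX\ \forall V\in C\ell^m_{p,q,r}\}$ (both are all of $C\ell_{p,q,r}$ if $m>n$). Groups (all consisting of $T\in C\ell^\times_{p,q,r}$ with the stated conditions): $A^{\overline{01}}_{p,q,r}$: $\widetilde TT\in Z^{1\times}_{p,q,r}$; $A^{\overline{23}}_{p,q,r}$: $\widetilde TT\in(Z^2_{p,q,r}\cap Z^3_{p,q,r})^\times$; $\check A^{\overline{12}}_{p,q,r}$: $\widetilde TT\in(\check Z^1_{p,q,r}\cap\check Z^2_{p,q,r})^\times$; $\check A^{\overline{03}}_{p,q,r}$: $\widetilde TT\in(Z^3_{p,q,r}\cap C\ell^{(0)}_{p,q,r})^\times$; $B^{\overline{12}}_{p,q,r}$: $\widehat{\widetilde T}T\in Z^{1\times}_{p,q,r}$; $B^{\overline{03}}_{p,q,r}$: $\widehat{\widetilde T}T\in Z^{3\times}_{p,q,r}$; $\check B^{\overline{01}}_{p,q,r}$: $\widehat{\widetilde T}T\in(Z^1_{p,q,r}\cap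 C\ell^{(0)}_{p,q,r})^\times$; $\check B^{\overline{23}}_{p,q,r}$: $\widehat{\widetilde T}T\in(\check Z^2_{p,q,r}\cap\check Z^3_{p,q,r})^\times$; $\tilde Q^{\overline{01}}_{p,q,r}$: $\widetilde TT\in Z^{4\times}_{p,q,r}$ and $\widehat{\widetilde T}T\in\check Z^{1\times}_{p,q,r}$; $\tilde Q^{\overline{23}}_{p,q,r}$: $\widetilde TT\in Z^{2\times}_{p,q,r}$ and $\widehat{\widetilde T}T\in\check Z^{3\times}_{p,q,r}$; $\tilde Q^{\overline{12}}_{p,q,r}$: $\widetilde TT\in\check Z^{1\times}_{p,q,r}$ and $\widehat{\widetilde T}T\in Z^{2\times}_{p,q,r}$; $\tilde Q^{\overline{03}}_{p,q,r}$: $\widetilde TT\in\check Z^{3\times}_{p,q,r}$ and $\widehat{\widetilde T}T\in Z^{4\times}_{p,q,r}$. Dimension constants: let $\lambda_r=2^{r-2}+2^{\frac r2-1}\cos\frac{\pi r}4$ if $r\ge1$ and $\lambda_0=1$. Then $\dim_A=2^{n-1}-2^{\frac n2-1}\big(\cos\frac{\pi n}4+\sin\frac{\pi n}4\big)+\lambda_r$, $\dim_B=2^{n-1}+2^{\frac n2-1}\big(\sin\frac{\pi n}4-\cos\frac{\pi n}4\big)+\lambda_r$, $\dim_Q=2^{n-2}-2^{\frac n2-1}\cos\frac{\pi n}4+\mu_r$, where $\mu_r=3\cdot2^{r-2}+2^{\frac r2-1}\cos\frac{\pi r}4$ if $r\ge1$ and $\mu_0=1$.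
   Formalization: Two false entries corrected: A^{23} with n≡0, r∈{n−2,n−1} has the extra summand Cl^n (dimension dim_A+1), so it moves from (A1) to (A2); Q̃^{23} with n≡0, r=n−3 has no summand Cl^n, so it is L⊕{Cl^2 Λ^{n−3}} of dimension dim_Q+3. *)

theory Defs
  imports "HOL-Analysis.Analysis" "HOL-Library.Function_Algebras"
begin

text \<open>
  A multivector is its family of coordinates in the basis of ordered products of generators:
  the coordinate at a finite set \<open>A = {a\<^sub>1 < \<dots> < a\<^sub>k}\<close> of natural numbers belongs to the basis
  element \<open>e\<^bsub>a\<^sub>1\<^esub> \<dots> e\<^bsub>a\<^sub>k\<^esub>\<close>.  The generators are numbered \<open>1, \<dots>, n\<close> with \<open>n = p + q + r\<close>.
  The scalars range over \<open>{real_normed_field, banach}\<close>; by the Gelfand-Mazur theorem the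
  instances of this class are, up to isomorphism, the real and the complex numbers.
\<close>

type_synonym 'f mv = "nat set \<Rightarrow> 'f"

definition scale_mv :: "'f::field \<Rightarrow> 'f mv \<Rightarrow> 'f mv" where
  "scale_mv c x = (\<lambda>A. c * x A)"

global_interpretation mv: vector_space "scale_mv :: 'f::field \<Rightarrow> 'f mv \<Rightarrow> 'f mv"
  by standard (auto simp: scale_mv_def fun_eq_iff algebra_simps)


subsection \<open>The algebra\<close>

text \<open>
  The square of a generator.  The middle \<open>q\<close> generators square to \<open>-1\<close> over the reals and to \<open>1\<close>
  over the complex numbers, where the signature is \<open>(p + q, 0, r)\<close>; the two cases are told apart
  by the existence of a square root of \<open>-1\<close>.
\<close>

definition eta :: "nat \<Rightarrow> nat \<Rightarrow> nat \<Rightarrow> 'f::field" where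
  "eta p q a = (if a \<le> p then 1
                else if a \<le> p + q then (if \<exists>i::'f. i * i = -1 then 1 else -1)
                else 0)"

lemma eta_real: "(eta p q a :: real) = (if a \<le> p then 1 else if a \<le> p + q then -1 else 0)"
proof -
  have "i * i \<noteq> -1" for i :: real
    using zero_le_square[of i] by linarith
  then show ?thesis by (auto simp: eta_def)
qed

lemma eta_complex: "(eta p q a :: complex) = (if a \<le> p + q then 1 else 0)"
proof -
  have "\<exists>i::complex. i * i = -1" by (rule exI[of _ \<i>]) simp
  then show ?thesis by (auto simp: eta_def)
qed

text \<open>
  The sign and the scalar produced when \<open>(e\<^bsub>a\<^sub>1\<^esub> \<dots> e\<^bsub>a\<^sub>k\<^esub>) (e\<^bsub>b\<^sub>1\<^esub> \<dots> e\<^bsub>b\<^sub>l\<^esub>)\<close> is brought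
  into ordered form: one sign for every inversion, and one factor \<open>\<eta>\<^sub>c\<^sub>c\<close> for every common generator.
\<close>

definition blade_coeff :: "nat \<Rightarrow> nat \<Rightarrow> nat set \<Rightarrow> nat set \<Rightarrow> 'f::field" where
  "blade_coeff p q A B =
     (-1) ^ card {(a, b). a \<in> A \<and> b \<in> B \<and> b < a} * (\<Prod>c\<in>A \<inter> B. eta p q c)"

definition blade :: "nat set \<Rightarrow> 'f::field mv" where
  "blade A = (\<lambda>B. if B = A then 1 else 0)"

abbreviation unit_mv :: "'f::field mv" where
  "unit_mv \<equiv> blade {}"

definition cl :: "nat \<Rightarrow> nat \<Rightarrow> nat \<Rightarrow> 'f::field mv set" where
  "cl p q r = {x. \<forall>A. x A \<noteq> 0 \<longrightarrow> A \<subseteq> {1..p + q + r}}"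

definition mul :: "nat \<Rightarrow> nat \<Rightarrow> nat \<Rightarrow> 'f::field mv \<Rightarrow> 'f mv \<Rightarrow> 'f mv" where
  "mul p q r x y = (\<lambda>C. \<Sum>A\<in>Pow {1..p + q + r}. \<Sum>B\<in>Pow {1..p + q + r}.
     if sym_diff A B = C then blade_coeff p q A B * x A * y B else 0)"


text \<open>
  The following facts identify this algebra: it is associative and unital, the generators satisfy
  the defining relations, and the ordered products of distinct generators are the basis elements.
\<close>

lemma mul_closed: "mul p q r x y \<in> cl p q r"
proof -
  have "mul p q r x y C = 0" if "\<not> C \<subseteq> {1..p + q + r}" for C
    unfolding mul_def
  proof (intro sum.neutral ballI)
    fix A B assume "A \<in> Pow {1..p + q + r}" "B \<in> Pow {1..p + q + r}"
    then have "sym_diff A B \<noteq> C" using that by blast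
    then show "(if sym_diff A B = C then blade_coeff p q A B * x A * y B else 0) = 0" by simp
  qed
  then show ?thesis by (auto simp: cl_def)
qed

lemma mul_add_left: "mul p q r (x + x') y = mul p q r x y + mul p q r x' y"
  by (auto simp: mul_def fun_eq_iff sum.distrib[symmetric] algebra_simps intro!: sum.cong)

lemma mul_add_right: "mul p q r x (y + y') = mul p q r x y + mul p q r x y'"
  by (auto simp: mul_def fun_eq_iff sum.distrib[symmetric] algebra_simps intro!: sum.cong)

lemma mul_scale_left: "mul p q r (scale_mv c x) y = scale_mv c (mul p q r x y)"
  by (auto simp: mul_def scale_mv_def fun_eq_iff sum_distrib_left algebra_simps intro!: sum.cong)

lemma mul_scale_right: "mul p q r x (scale_mv c y) = scale_mv c (mul p q r x y)"
  by (auto simp: mul_def scale_mv_def fun_eq_iff sum_distrib_left algebra_simps intro!: sum.cong)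

lemma mul_blade:
  assumes "A \<subseteq> {1..p + q + r}" "B \<subseteq> {1..p + q + r}"
  shows "mul p q r (blade A) (blade B) =
         scale_mv (blade_coeff p q A B) (blade (sym_diff A B) :: 'f::field mv)"
proof
  fix C
  have "mul p q r (blade A) (blade B :: 'f mv) C =
      (\<Sum>A'\<in>Pow {1..p + q + r}. if A' = A then
         \<Sum>B'\<in>Pow {1..p + q + r}. if B' = B then
           if sym_diff A B = C then blade_coeff p q A B else 0 else 0 else 0)"
    unfolding mul_def
  proof (intro sum.cong refl)
    fix A'
    show "(\<Sum>B'\<in>Pow {1..p + q + r}. if sym_diff A' B' = C
          then blade_coeff p q A' B' * blade A A' * blade B B' else 0) =
        (if A' = A then \<Sum>B'\<in>Pow {1..p + q + r}. if B' = B then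
           if sym_diff A B = C then blade_coeff p q A B else 0 else 0 else (0 :: 'f))"
    proof (cases "A' = A")
      case True
      have "(if sym_diff A' B' = C then blade_coeff p q A' B' * blade A A' * blade B B' else 0) =
          (if B' = B then if sym_diff A B = C then blade_coeff p q A B else 0 else (0 :: 'f))" for B'
        by (cases "B' = B") (simp_all add: blade_def True)
      then show ?thesis using True by simp
    next
      case False
      then show ?thesis by (simp add: blade_def cong: if_cong)
    qed
  qed
  also have "\<dots> = (if sym_diff A B = C then blade_coeff p q A B else 0)"
    using assms by (simp add: sum.delta)
  finally show "mul p q r (blade A) (blade B) C =
      scale_mv (blade_coeff p q A B) (blade (sym_diff A B) :: 'f mv) C"
    by (auto simp: scale_mv_def blade_def)
qed

lemma blade_coeff_assoc:
  assumes "finite A" "finite B" "finite C"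
  shows "blade_coeff p q A B * blade_coeff p q (sym_diff A B) C =
         (blade_coeff p q B C * blade_coeff p q A (sym_diff B C) :: 'f::field)"
proof -
  define N where "N X Y = {(a, b). a \<in> X \<and> b \<in> Y \<and> b < a}" for X Y :: "nat set"
  have fin: "finite (N X Y)" if "finite X" "finite Y" for X Y
    by (rule finite_subset[of _ "X \<times> Y"]) (use that in \<open>auto simp: N_def\<close>)
  have sd: "card (sym_diff X Y) + 2 * card (X \<inter> Y) = card X + card Y"
    if "finite X" "finite Y" for X Y :: "(nat \<times> nat) set"
  proof -
    have "card (sym_diff X Y) = card (X - Y) + card (Y - X)"
      using that by (intro card_Un_disjoint) auto
    moreover have "card X = card (X - Y) + card (X \<inter> Y)"
      using that by (metis card_Int_Diff add.commute)
    moreover have "card Y = card (Y - X) + card (X \<inter> Y)"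
      using that by (metis card_Int_Diff add.commute Int_commute)
    ultimately show ?thesis by simp
  qed
  have sgn: "(-1 :: 'f) ^ card (sym_diff X Y) = (-1) ^ card X * (-1) ^ card Y"
    if "finite X" "finite Y" for X Y :: "(nat \<times> nat) set"
  proof -
    have "(-1 :: 'f) ^ (card (sym_diff X Y) + 2 * card (X \<inter> Y)) = (-1) ^ (card X + card Y)"
      using sd[OF that] by simp
    then show ?thesis by (simp add: power_add power_mult)
  qed
  have NL: "N (sym_diff A B) C = sym_diff (N A C) (N B C)" by (auto simp: N_def)
  have NR: "N A (sym_diff B C) = sym_diff (N A B) (N A C)" by (auto simp: N_def)
  have P: "(\<Prod>c\<in>X. eta p q c :: 'f) = (\<Prod>c\<in>A \<union> B \<union> C. if c \<in> X then eta p q c else 1)"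
    if "X \<subseteq> A \<union> B \<union> C" for X
    using that assms by (simp add: prod.If_cases Int_absorb1)
  have "(\<Prod>c\<in>A \<inter> B. eta p q c) * (\<Prod>c\<in>sym_diff A B \<inter> C. eta p q c) =
      (\<Prod>c\<in>B \<inter> C. eta p q c) * (\<Prod>c\<in>A \<inter> sym_diff B C. eta p q c :: 'f)"
    by (subst (1 2 3 4) P; (auto simp: prod.distrib[symmetric] intro!: prod.cong)?)
  then show ?thesis
    unfolding blade_coeff_def N_def[symmetric] NL NR
    using assms by (simp add: sgn fin mult.assoc mult.left_commute)
qed

lemma mul_assoc:
  fixes x y z :: "'f::field mv"
  shows "mul p q r (mul p q r x y) z = mul p q r x (mul p q r y z)"
proof
  fix D
  define P where "P = Pow {1..p + q + r}"
  have finP: "finite P" by (simp add: P_def)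
  have fin: "finite A" if "A \<in> P" for A
    using that by (auto simp: P_def intro: finite_subset)
  have closed: "sym_diff A B \<in> P" if "A \<in> P" "B \<in> P" for A B
    using that by (auto simp: P_def)
  have swap4: "(\<Sum>E\<in>P. \<Sum>C\<in>P. \<Sum>A\<in>P. \<Sum>B\<in>P. g E C A B) =
      (\<Sum>A\<in>P. \<Sum>B\<in>P. \<Sum>C\<in>P. \<Sum>E\<in>P. g E C A B)"
    for g :: "nat set \<Rightarrow> nat set \<Rightarrow> nat set \<Rightarrow> nat set \<Rightarrow> 'f"
  proof -
    have "(\<Sum>E\<in>P. \<Sum>C\<in>P. \<Sum>A\<in>P. \<Sum>B\<in>P. g E C A B) = (\<Sum>E\<in>P. \<Sum>A\<in>P. \<Sum>C\<in>P. \<Sum>B\<in>P. g E C A B)"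
      by (rule sum.cong[OF refl], rule sum.swap)
    also have "\<dots> = (\<Sum>A\<in>P. \<Sum>E\<in>P. \<Sum>C\<in>P. \<Sum>B\<in>P. g E C A B)"
      by (rule sum.swap)
    also have "\<dots> = (\<Sum>A\<in>P. \<Sum>E\<in>P. \<Sum>B\<in>P. \<Sum>C\<in>P. g E C A B)"
      by (rule sum.cong[OF refl], rule sum.cong[OF refl], rule sum.swap)
    also have "\<dots> = (\<Sum>A\<in>P. \<Sum>B\<in>P. \<Sum>E\<in>P. \<Sum>C\<in>P. g E C A B)"
      by (rule sum.cong[OF refl], rule sum.swap)
    also have "\<dots> = (\<Sum>A\<in>P. \<Sum>B\<in>P. \<Sum>C\<in>P. \<Sum>E\<in>P. g E C A B)"
      by (rule sum.cong[OF refl], rule sum.cong[OF refl], rule sum.swap)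
    finally show ?thesis .
  qed
  have swap3: "(\<Sum>B\<in>P. \<Sum>C\<in>P. \<Sum>E\<in>P. g B C E) = (\<Sum>E\<in>P. \<Sum>B\<in>P. \<Sum>C\<in>P. g B C E)"
    for g :: "nat set \<Rightarrow> nat set \<Rightarrow> nat set \<Rightarrow> 'f"
  proof -
    have "(\<Sum>B\<in>P. \<Sum>C\<in>P. \<Sum>E\<in>P. g B C E) = (\<Sum>B\<in>P. \<Sum>E\<in>P. \<Sum>C\<in>P. g B C E)"
      by (rule sum.cong[OF refl], rule sum.swap)
    also have "\<dots> = (\<Sum>E\<in>P. \<Sum>B\<in>P. \<Sum>C\<in>P. g B C E)"
      by (rule sum.swap)
    finally show ?thesis .
  qed
  have if_mult: "(if b then s else 0) * t = (if b then s * t else 0)"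
    "t * (if b then s else 0) = (if b then t * s else 0)"
    "(if c then (if b then s else 0) else 0) = (if b then if c then s else 0 else 0)"
    for b c and s t :: 'f by simp_all
  have if_sum: "(if b then sum g P else 0) = (\<Sum>A\<in>P. if b then g A else 0)"
    for b and g :: "nat set \<Rightarrow> 'f" by simp
  have "mul p q r (mul p q r x y) z D = (\<Sum>E\<in>P. \<Sum>C\<in>P. \<Sum>A\<in>P. \<Sum>B\<in>P.
      if sym_diff A B = E then if sym_diff E C = D then
        blade_coeff p q E C * (blade_coeff p q A B * x A * y B) * z C else 0 else 0)"
    unfolding mul_def P_def[symmetric] sum_distrib_left sum_distrib_right if_sum
    by (intro sum.cong refl) (simp only: if_mult mult.assoc split: if_split, simp?)
  also have "\<dots> = (\<Sum>A\<in>P. \<Sum>B\<in>P. \<Sum>C\<in>P. \<Sum>E\<in>P.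
      if sym_diff A B = E then if sym_diff E C = D then
        blade_coeff p q E C * (blade_coeff p q A B * x A * y B) * z C else 0 else 0)"
    by (rule swap4)
  also have "\<dots> = (\<Sum>A\<in>P. \<Sum>B\<in>P. \<Sum>C\<in>P. if sym_diff (sym_diff A B) C = D then
        blade_coeff p q (sym_diff A B) C * (blade_coeff p q A B * x A * y B) * z C else 0)"
    using finP closed by (intro sum.cong refl) (simp add: sum.delta')
  also have "\<dots> = (\<Sum>A\<in>P. \<Sum>B\<in>P. \<Sum>C\<in>P. if sym_diff A (sym_diff B C) = D then
        blade_coeff p q A (sym_diff B C) * x A * (blade_coeff p q B C * y B * z C) else 0)"
  proof (intro sum.cong refl)
    fix A B C assume "A \<in> P" "B \<in> P" "C \<in> P"
    then have "blade_coeff p q A B * blade_coeff p q (sym_diff A B) C =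
         (blade_coeff p q B C * blade_coeff p q A (sym_diff B C) :: 'f)"
      by (intro blade_coeff_assoc fin)
    then have "blade_coeff p q (sym_diff A B) C * (blade_coeff p q A B * x A * y B) * z C =
        blade_coeff p q A (sym_diff B C) * x A * (blade_coeff p q B C * y B * z C)"
      by algebra
    moreover have "sym_diff (sym_diff A B) C = sym_diff A (sym_diff B C)" by blast
    ultimately show "(if sym_diff (sym_diff A B) C = D then
        blade_coeff p q (sym_diff A B) C * (blade_coeff p q A B * x A * y B) * z C else 0) =
        (if sym_diff A (sym_diff B C) = D then
        blade_coeff p q A (sym_diff B C) * x A * (blade_coeff p q B C * y B * z C) else 0)"
      by simp
  qed
  also have "\<dots> = (\<Sum>A\<in>P. \<Sum>B\<in>P. \<Sum>C\<in>P. \<Sum>E\<in>P.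
      if sym_diff B C = E then if sym_diff A E = D then
        blade_coeff p q A E * x A * (blade_coeff p q B C * y B * z C) else 0 else 0)"
    using finP closed by (intro sum.cong refl) (simp add: sum.delta')
  also have "\<dots> = (\<Sum>A\<in>P. \<Sum>E\<in>P. \<Sum>B\<in>P. \<Sum>C\<in>P.
      if sym_diff B C = E then if sym_diff A E = D then
        blade_coeff p q A E * x A * (blade_coeff p q B C * y B * z C) else 0 else 0)"
    by (rule sum.cong[OF refl], rule swap3)
  also have "\<dots> = mul p q r x (mul p q r y z) D"
    unfolding mul_def P_def[symmetric] sum_distrib_left sum_distrib_right if_sum
    by (intro sum.cong refl) (simp only: if_mult mult.assoc split: if_split, simp?)
  finally show "mul p q r (mul p q r x y) z D = mul p q r x (mul p q r y z) D" .
qed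

lemma mul_unit_left:
  assumes "x \<in> cl p q r"
  shows "mul p q r unit_mv x = x"
proof
  fix C
  have "mul p q r unit_mv x C =
      (\<Sum>A\<in>Pow {1..p + q + r}. if A = {} then \<Sum>B\<in>Pow {1..p + q + r}. if B = C then x B else 0 else 0)"
    unfolding mul_def
  proof (intro sum.cong refl)
    fix A
    show "(\<Sum>B\<in>Pow {1..p + q + r}. if sym_diff A B = C
          then blade_coeff p q A B * unit_mv A * x B else 0) =
        (if A = {} then \<Sum>B\<in>Pow {1..p + q + r}. if B = C then x B else 0 else 0)"
    proof (cases "A = {}")
      case True
      have "(if sym_diff A B = C then blade_coeff p q A B * unit_mv A * x B else 0) =
          (if B = C then x B else 0)" for B
        by (simp add: blade_def blade_coeff_def True)
      then show ?thesis using True by simp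
    next
      case False
      then show ?thesis by (simp add: blade_def cong: if_cong)
    qed
  qed
  then show "mul p q r unit_mv x C = x C"
    using assms by (auto simp: cl_def)
qed

lemma mul_unit_right:
  assumes "x \<in> cl p q r"
  shows "mul p q r x unit_mv = x"
proof
  fix C
  have "mul p q r x unit_mv C =
      (\<Sum>A\<in>Pow {1..p + q + r}. \<Sum>B\<in>Pow {1..p + q + r}. if B = {} then if A = C then x A else 0 else 0)"
    unfolding mul_def
    by (intro sum.cong refl) (auto simp: blade_def blade_coeff_def)
  then show "mul p q r x unit_mv C = x C"
    using assms by (auto simp: cl_def)
qed

lemma generator_relations:
  assumes "a \<in> {1..p + q + r}" "b \<in> {1..p + q + r}"
  shows "mul p q r (blade {a}) (blade {b}) + mul p q r (blade {b}) (blade {a}) =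
         scale_mv (2 * (if a = b then eta p q a else 0)) (unit_mv :: 'f::field mv)"
proof -
  have inv: "{(x, y). x \<in> {u} \<and> y \<in> {v} \<and> y < x} = (if v < u then {(u, v)} else {})" for u v :: nat
    by auto
  have "mul p q r (blade {a}) (blade {b}) = scale_mv (blade_coeff p q {a} {b}) (blade (sym_diff {a} {b}) :: 'f mv)"
    "mul p q r (blade {b}) (blade {a}) = scale_mv (blade_coeff p q {b} {a}) (blade (sym_diff {a} {b}) :: 'f mv)"
    using assms by (simp_all add: mul_blade Un_commute)
  moreover have "blade_coeff p q {u} {v} = (if u = v then eta p q u else if v < u then -1 else 1 :: 'f)" for u v
    unfolding blade_coeff_def inv by simp
  ultimately show ?thesis
    by (cases "a = b"; cases "a < b") (simp_all add: scale_mv_def fun_eq_iff)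
qed

lemma blade_eq_product:
  assumes "A \<subseteq> {1..p + q + r}"
  shows "foldr (\<lambda>a x. mul p q r (blade {a}) x) (sorted_list_of_set A) unit_mv = (blade A :: 'f::field mv)"
proof -
  have "foldr (\<lambda>a x. mul p q r (blade {a}) x) as unit_mv = (blade (set as) :: 'f mv)"
    if "set as \<subseteq> {1..p + q + r}" "sorted as" "distinct as" for as
    using that
  proof (induction as)
    case (Cons a as)
    have "{(x, y). x \<in> {a} \<and> y \<in> set as \<and> y < x} = {}" using Cons.prems by force
    then have "blade_coeff p q {a} (set as) = (1 :: 'f)"
      using Cons.prems unfolding blade_coeff_def by (simp only:) simp
    moreover have "sym_diff {a} (set as) = insert a (set as)" using Cons.prems by auto
    ultimately show ?case
      using Cons by (simp add: mul_blade scale_mv_def)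
  qed simp
  from this[of "sorted_list_of_set A"] show ?thesis
    using assms finite_subset[OF assms] by simp
qed


subsection \<open>Distinguished subspaces and involutions\<close>

definition blade_span :: "nat set \<Rightarrow> int \<Rightarrow> 'f::field mv set" where
  "blade_span S k = mv.span (blade ` {A. A \<subseteq> S \<and> int (card A) = k})"

definition grade :: "nat \<Rightarrow> nat \<Rightarrow> nat \<Rightarrow> int \<Rightarrow> 'f::field mv set" where
  "grade p q r k = blade_span {1..p + q + r} k"

definition grassmann :: "nat \<Rightarrow> nat \<Rightarrow> nat \<Rightarrow> int \<Rightarrow> 'f::field mv set" where
  "grassmann p q r k = blade_span {p + q + 1..p + q + r} k"

definition nondegenerate :: "nat \<Rightarrow> nat \<Rightarrow> int \<Rightarrow> 'f::field mv set" where
  "nondegenerate p q k = blade_span {1..p + q} k"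

definition mixed :: "nat \<Rightarrow> nat \<Rightarrow> nat \<Rightarrow> int \<Rightarrow> int \<Rightarrow> 'f::field mv set" where
  "mixed p q r k l =
     mv.span {mul p q r a b |a b. a \<in> nondegenerate p q k \<and> b \<in> grassmann p q r l}"

definition grade_mod4 :: "nat \<Rightarrow> nat \<Rightarrow> nat \<Rightarrow> int set \<Rightarrow> 'f::field mv set" where
  "grade_mod4 p q r K = mv.span (\<Union>k\<in>{k. k mod 4 \<in> K}. grade p q r k)"

definition grassmann_mod4 :: "nat \<Rightarrow> nat \<Rightarrow> nat \<Rightarrow> int set \<Rightarrow> 'f::field mv set" where
  "grassmann_mod4 p q r K = mv.span (\<Union>k\<in>{k. k mod 4 \<in> K}. grassmann p q r k)"

definition even_part :: "nat \<Rightarrow> nat \<Rightarrow> nat \<Rightarrow> 'f::field mv set" where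
  "even_part p q r = mv.span (\<Union>k\<in>{k. even k}. grade p q r k)"

definition involution :: "'f::field mv \<Rightarrow> 'f mv" where
  "involution x = (\<lambda>A. (-1) ^ card A * x A)"

definition reversion :: "'f::field mv \<Rightarrow> 'f mv" where
  "reversion x = (\<lambda>A. (-1) ^ (card A * (card A - 1) div 2) * x A)"

definition conjugation :: "'f::field mv \<Rightarrow> 'f mv" where
  "conjugation x = involution (reversion x)"

definition inv_elems :: "nat \<Rightarrow> nat \<Rightarrow> nat \<Rightarrow> 'f::field mv set \<Rightarrow> 'f mv set" where
  "inv_elems p q r H =
     {x \<in> H. \<exists>y\<in>cl p q r. mul p q r x y = unit_mv \<and> mul p q r y x = unit_mv}"

definition Z :: "nat \<Rightarrow> nat \<Rightarrow> nat \<Rightarrow> int \<Rightarrow> 'f::field mv set" where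
  "Z p q r m = {X \<in> cl p q r. \<forall>V\<in>grade p q r m. mul p q r X V = mul p q r V X}"

definition Zc :: "nat \<Rightarrow> nat \<Rightarrow> nat \<Rightarrow> int \<Rightarrow> 'f::field mv set" where
  "Zc p q r m = {X \<in> cl p q r. \<forall>V\<in>grade p q r m. mul p q r (involution X) V = mul p q r V X}"


subsection \<open>The groups\<close>

text \<open>
  A trailing \<open>c\<close> (in \<open>Zc\<close>, \<open>A12c\<close>, \<dots>) stands for the check accent.

  A pitfall when \<open>n\<close> is divisible by 4: both norms of \<open>e + t e\<^sub>1 \<dots> e\<^sub>n\<close> are then \<open>e + 2 t e\<^sub>1 \<dots> e\<^sub>n\<close>
  up to a term of order \<open>t\<^sup>2\<close>.  The element \<open>e\<^sub>1 \<dots> e\<^sub>n\<close> commutes with grade 2, and for \<open>r \<ge> n - 2\<close> it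
  annihilates grade 3; it is therefore tangent to \<open>A23\<close> also when \<open>r\<close> is \<open>n - 2\<close> or \<open>n - 1\<close>.
  For \<open>r \<le> n - 3\<close> it anticommutes with a product of three non-null generators without
  annihilating it, hence is not in \<open>Zc p q r 3\<close> and not tangent to \<open>Q23\<close>, in particular when \<open>r = n - 3\<close>.
\<close>

abbreviation (input) rev_norm :: "nat \<Rightarrow> nat \<Rightarrow> nat \<Rightarrow> 'f::field mv \<Rightarrow> 'f mv" where
  "rev_norm p q r T \<equiv> mul p q r (reversion T) T"

abbreviation (input) conj_norm :: "nat \<Rightarrow> nat \<Rightarrow> nat \<Rightarrow> 'f::field mv \<Rightarrow> 'f mv" where
  "conj_norm p q r T \<equiv> mul p q r (conjugation T) T"

definition A01 :: "nat \<Rightarrow> nat \<Rightarrow> nat \<Rightarrow> 'f::field mv set" where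
  "A01 p q r = {T \<in> inv_elems p q r (cl p q r).
     rev_norm p q r T \<in> inv_elems p q r (Z p q r 1)}"

definition A23 :: "nat \<Rightarrow> nat \<Rightarrow> nat \<Rightarrow> 'f::field mv set" where
  "A23 p q r = {T \<in> inv_elems p q r (cl p q r).
     rev_norm p q r T \<in> inv_elems p q r (Z p q r 2 \<inter> Z p q r 3)}"

definition A12c :: "nat \<Rightarrow> nat \<Rightarrow> nat \<Rightarrow> 'f::field mv set" where
  "A12c p q r = {T \<in> inv_elems p q r (cl p q r).
     rev_norm p q r T \<in> inv_elems p q r (Zc p q r 1 \<inter> Zc p q r 2)}"

definition A03c :: "nat \<Rightarrow> nat \<Rightarrow> nat \<Rightarrow> 'f::field mv set" where
  "A03c p q r = {T \<in> inv_elems p q r (cl p q r).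
     rev_norm p q r T \<in> inv_elems p q r (Z p q r 3 \<inter> even_part p q r)}"

definition B12 :: "nat \<Rightarrow> nat \<Rightarrow> nat \<Rightarrow> 'f::field mv set" where
  "B12 p q r = {T \<in> inv_elems p q r (cl p q r).
     conj_norm p q r T \<in> inv_elems p q r (Z p q r 1)}"

definition B03 :: "nat \<Rightarrow> nat \<Rightarrow> nat \<Rightarrow> 'f::field mv set" where
  "B03 p q r = {T \<in> inv_elems p q r (cl p q r).
     conj_norm p q r T \<in> inv_elems p q r (Z p q r 3)}"

definition B01c :: "nat \<Rightarrow> nat \<Rightarrow> nat \<Rightarrow> 'f::field mv set" where
  "B01c p q r = {T \<in> inv_elems p q r (cl p q r).
     conj_norm p q r T \<in> inv_elems p q r (Z p q r 1 \<inter> even_part p q r)}"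

definition B23c :: "nat \<Rightarrow> nat \<Rightarrow> nat \<Rightarrow> 'f::field mv set" where
  "B23c p q r = {T \<in> inv_elems p q r (cl p q r).
     conj_norm p q r T \<in> inv_elems p q r (Zc p q r 2 \<inter> Zc p q r 3)}"

definition Q01 :: "nat \<Rightarrow> nat \<Rightarrow> nat \<Rightarrow> 'f::field mv set" where
  "Q01 p q r = {T \<in> inv_elems p q r (cl p q r).
     rev_norm p q r T \<in> inv_elems p q r (Z p q r 4) \<and>
     conj_norm p q r T \<in> inv_elems p q r (Zc p q r 1)}"

definition Q23 :: "nat \<Rightarrow> nat \<Rightarrow> nat \<Rightarrow> 'f::field mv set" where
  "Q23 p q r = {T \<in> inv_elems p q r (cl p q r).
     rev_norm p q r T \<in> inv_elems p q r (Z p q r 2) \<and>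
     conj_norm p q r T \<in> inv_elems p q r (Zc p q r 3)}"

definition Q12 :: "nat \<Rightarrow> nat \<Rightarrow> nat \<Rightarrow> 'f::field mv set" where
  "Q12 p q r = {T \<in> inv_elems p q r (cl p q r).
     rev_norm p q r T \<in> inv_elems p q r (Zc p q r 1) \<and>
     conj_norm p q r T \<in> inv_elems p q r (Z p q r 2)}"

definition Q03 :: "nat \<Rightarrow> nat \<Rightarrow> nat \<Rightarrow> 'f::field mv set" where
  "Q03 p q r = {T \<in> inv_elems p q r (cl p q r).
     rev_norm p q r T \<in> inv_elems p q r (Zc p q r 3) \<and>
     conj_norm p q r T \<in> inv_elems p q r (Z p q r 4)}"


subsection \<open>Lie algebras\<close>

text \<open>
  The Lie algebra of a Lie group \<open>G\<close> of invertible elements is its tangent space at the identity: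
  the velocities at time 0 of the continuously differentiable curves in \<open>G\<close> through the identity.
  Differentiability in the finite-dimensional space \<open>cl p q r\<close> is differentiability of all coordinates.
\<close>

definition lie_algebra :: "'f::{real_normed_field,banach} mv set \<Rightarrow> 'f mv set" where
  "lie_algebra G = {X. \<exists>\<gamma> \<gamma>' :: real \<Rightarrow> 'f mv.
     (\<forall>t. \<gamma> t \<in> G) \<and> \<gamma> 0 = unit_mv \<and> \<gamma>' 0 = X \<and>
     (\<forall>A t. ((\<lambda>s. \<gamma> s A) has_vector_derivative \<gamma>' t A) (at t)) \<and>
     (\<forall>A. continuous_on UNIV (\<lambda>t. \<gamma>' t A))}"

definition lie_subalgebra :: "nat \<Rightarrow> nat \<Rightarrow> nat \<Rightarrow> 'f::field mv set \<Rightarrow> bool" where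
  "lie_subalgebra p q r L \<longleftrightarrow>
     mv.subspace L \<and> L \<subseteq> cl p q r \<and> (\<forall>X\<in>L. \<forall>Y\<in>L. mul p q r X Y - mul p q r Y X \<in> L)"

definition is_direct_sum :: "'f::field mv set \<Rightarrow> 'f mv set list \<Rightarrow> bool" where
  "is_direct_sum L Us \<longleftrightarrow>
     L = {sum_list xs |xs. list_all2 (\<in>) xs Us} \<and>
     (\<forall>xs. list_all2 (\<in>) xs Us \<and> sum_list xs = 0 \<longrightarrow> (\<forall>x\<in>set xs. x = 0))"

definition lie_algebra_is ::
  "nat \<Rightarrow> nat \<Rightarrow> nat \<Rightarrow> 'f::{real_normed_field,banach} mv set \<Rightarrow> 'f mv set list \<Rightarrow> real \<Rightarrow> bool" where
  "lie_algebra_is p q r G Us d \<longleftrightarrow>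
     lie_subalgebra p q r (lie_algebra G) \<and> is_direct_sum (lie_algebra G) Us \<and>
     real (mv.dim (lie_algebra G)) = d"


subsection \<open>Dimension constants\<close>

definition lambda_const :: "nat \<Rightarrow> real" where
  "lambda_const r = (if r = 0 then 1
     else 2 powr (real r - 2) + 2 powr (real r / 2 - 1) * cos (pi * real r / 4))"

definition mu_const :: "nat \<Rightarrow> real" where
  "mu_const r = (if r = 0 then 1
     else 3 * 2 powr (real r - 2) + 2 powr (real r / 2 - 1) * cos (pi * real r / 4))"

definition dim_A :: "nat \<Rightarrow> nat \<Rightarrow> real" where
  "dim_A n r = 2 powr (real n - 1)
     - 2 powr (real n / 2 - 1) * (cos (pi * real n / 4) + sin (pi * real n / 4)) + lambda_const r"

definition dim_B :: "nat \<Rightarrow> nat \<Rightarrow> real" where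
  "dim_B n r = 2 powr (real n - 1)
     + 2 powr (real n / 2 - 1) * (sin (pi * real n / 4) - cos (pi * real n / 4)) + lambda_const r"

definition dim_Q :: "nat \<Rightarrow> nat \<Rightarrow> real" where
  "dim_Q n r = 2 powr (real n - 2) - 2 powr (real n / 2 - 1) * cos (pi * real n / 4) + mu_const r"

end

theory Submission
  imports Defs
begin

text \<open>
  In the basis of ordered products of generators all conditions that define the groups are
  diagonal.  Two basis elements commute up to the sign \<open>(-1)\<close> to the power \<open>|A| |B| + |A \<inter> B|\<close>, and
  their product vanishes exactly if they share a null generator.  So an element lies in a
  centralizer, twisted or not, iff every basis element occurring in it does.  Each centralizer is
  therefore the span of some basis elements; it is also a subalgebra with unit, stable under
  reversion and conjugation.  Hence every one of the twelve groups consists of the invertible \<open>T\<close>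
  whose norms \<open>T\<^sup>~ T\<close> (reversion) and \<open>T\<^sup>* T\<close> (conjugation) lie in two subalgebras \<open>W1\<close> and \<open>W2\<close>
  spanned by basis elements, where \<open>W1\<close> or \<open>W2\<close> may be the whole algebra (\<open>groups_as_norm_groups\<close>).

  \<^emph>\<open>The tangent space.\<close>  Differentiating the two norms along a curve through the identity shows that
  \<open>X\<^sup>~ + X\<close> lies in \<open>W1\<close> and \<open>X\<^sup>* + X\<close> in \<open>W2\<close>: a coordinate of \<open>X\<close> of grade 0 or 1 modulo 4 must
  belong to \<open>W1\<close>, one of grade 0 or 3 modulo 4 to \<open>W2\<close>, and the grades 2 modulo 4 are free.
  Conversely every such \<open>X\<close> is a velocity.  No exponential series is involved: velocities add when
  curves are multiplied (\<open>lie_algebra_mul\<close>), so it is enough to move along one basis element at a time,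
  with the curve \<open>e + f(t) e\<^sub>A\<close> for a small function \<open>f\<close> with \<open>f(0) = 0\<close>.  Its norm is a scalar if the
  involution negates \<open>e\<^sub>A\<close>, and otherwise it stays in the subalgebra that contains \<open>e\<^sub>A\<close>.  The factors
  only have to be multiplied in the right order (\<open>lie_algebra_norm_group_aux\<close>).

  \<^emph>\<open>The combinatorics.\<close>  Membership of \<open>e\<^sub>A\<close> in a centralizer depends only on the numbers \<open>a\<close> and \<open>b\<close>
  of non-null and null generators in \<open>A\<close>.  The explicit lists (\<open>commuting_types\<close>) show that an
  element with \<open>a > 0\<close> can occur only near the top: either \<open>a \<le> 2\<close> and at most two generators are missing,
  or none is missing.  So each Lie algebra consists of a part common to its family of groups and
  of a few bidegrees \<open>(a, b)\<close> of codegree \<open>e = n - (a + b) \<le> 2\<close>.  As \<open>a + b\<close> modulo 4 determines whether a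
  basis element is constrained, the residue of \<open>n\<close> modulo 4 leaves only one such codegree for each residue
  of the grade (\<open>gap_cases\<close>), which explains the case distinction of the theorem.  The same description near the top
  yields closure under the commutator (\<open>commutator_closed_A\<close>, \<open>commutator_closed_B\<close>, \<open>commutator_closed_Q\<close>).
  The dimensions are numbers of subsets of given size modulo 4, which can be read off from
  \<open>(1 + i)\<^sup>n\<close> in polar form (\<open>card_subsets_mod4\<close>), plus products of binomial coefficients.
\<close>

section \<open>Subspaces spanned by basis elements\<close>

definition coord :: "nat set set \<Rightarrow> 'f::field mv set" where
  "coord F = {x. \<forall>A. x A \<noteq> 0 \<longrightarrow> A \<in> F}"

lemma coord_mono: "F \<subseteq> G \<Longrightarrow> coord F \<subseteq> coord G"
  by (auto simp: coord_def)

lemma coord_Int: "coord (F \<inter> G) = coord F \<inter> coord G"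
  by (auto simp: coord_def)

lemma cl_eq_coord: "cl p q r = coord (Pow {1..p + q + r})"
  by (auto simp: cl_def coord_def)

lemma coord_subspace: "mv.subspace (coord F)"
  by (rule mv.subspaceI) (auto simp: coord_def scale_mv_def, metis add.right_neutral)

lemma blade_in_coord: "A \<in> F \<Longrightarrow> blade A \<in> coord F"
  by (simp add: coord_def blade_def)

lemma sum_mv_apply: "(\<Sum>i\<in>I. f i :: 'f::field mv) A = (\<Sum>i\<in>I. f i A)"
  by (induction I rule: infinite_finite_induct) auto

lemma coord_expand:
  assumes "finite F" "x \<in> coord F"
  shows "x = (\<Sum>A\<in>F. scale_mv (x A) (blade A))"
proof
  fix B
  have "(\<Sum>A\<in>F. scale_mv (x A) (blade A)) B = (\<Sum>A\<in>F. if A = B then x A else 0)"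
    unfolding sum_mv_apply by (intro sum.cong) (auto simp: scale_mv_def blade_def)
  then show "x B = (\<Sum>A\<in>F. scale_mv (x A) (blade A)) B"
    using assms by (auto simp: coord_def sum.delta)
qed

lemma coord_eq_span:
  assumes "finite F" shows "(coord F :: 'f::field mv set) = mv.span (blade ` F)"
proof
  show "coord F \<subseteq> (mv.span (blade ` F) :: 'f mv set)"
  proof (rule subsetI)
    fix x :: "'f mv" assume "x \<in> coord F"
    then show "x \<in> mv.span (blade ` F)"
      by (subst coord_expand[OF assms]) (auto intro: mv.span_sum mv.span_scale mv.span_base)
  qed
  show "mv.span (blade ` F) \<subseteq> coord F"
    by (intro mv.span_minimal coord_subspace) (auto intro: blade_in_coord)
qed

lemma blade_inj: "inj (blade :: nat set \<Rightarrow> 'f::field mv)"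
  by (rule injI) (metis blade_def zero_neq_one)

lemma blade_independent: "mv.independent (blade ` F :: 'f::field mv set)"
proof
  assume "mv.dependent (blade ` F :: 'f mv set)"
  then obtain A where "A \<in> F" and sp: "blade A \<in> mv.span (blade ` F - {blade A :: 'f mv})"
    by (auto simp: mv.dependent_def)
  have "blade ` F - {blade A :: 'f mv} \<subseteq> coord (F - {A})"
    by (auto intro: blade_in_coord)
  then have "mv.span (blade ` F - {blade A :: 'f mv}) \<subseteq> coord (F - {A})"
    by (rule mv.span_minimal[OF _ coord_subspace])
  with sp have "(blade A :: 'f mv) \<in> coord (F - {A})" by blast
  then have "blade A A = (0 :: 'f)" unfolding coord_def by blast
  then show False by (simp add: blade_def)
qed

lemma dim_coord:
  assumes "finite F" shows "mv.dim (coord F :: 'f::field mv set) = card F"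
proof -
  have "mv.dim (coord F :: 'f mv set) = card (blade ` F :: 'f mv set)"
    unfolding coord_eq_span[OF assms]
    by (simp add: mv.dim_eq_card_independent[OF blade_independent])
  also have "\<dots> = card F"
    by (rule card_image) (rule inj_on_subset[OF blade_inj], simp)
  finally show ?thesis .
qed

lemma span_Union_coord:
  assumes "\<And>k. k \<in> K \<Longrightarrow> U k = coord (F k)" "finite (\<Union>k\<in>K. F k)"
  shows "mv.span (\<Union>k\<in>K. U k) = coord (\<Union>k\<in>K. F k)"
proof
  show "mv.span (\<Union>k\<in>K. U k) \<subseteq> coord (\<Union>k\<in>K. F k)"
    by (intro mv.span_minimal coord_subspace) (auto simp: assms(1) coord_def)
  show "coord (\<Union>k\<in>K. F k) \<subseteq> mv.span (\<Union>k\<in>K. U k)"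
    unfolding coord_eq_span[OF assms(2)]
    by (intro mv.span_mono) (auto simp: assms(1) intro!: blade_in_coord)
qed

lemma sym_diff_Pow: "A \<in> Pow S \<Longrightarrow> B \<in> Pow S \<Longrightarrow> sym_diff A B \<in> Pow S"
  by auto

lemma sym_diff_eq_iff: "sym_diff A B = C \<longleftrightarrow> B = sym_diff A C"
  by blast

text \<open>
  For fixed \<open>C\<close>, the only basis element that multiplies \<open>e\<^sub>A\<close> into a multiple of \<open>e\<^sub>C\<close> is the one
  belonging to the symmetric difference, so the double sum collapses.
\<close>

lemma mul_apply:
  assumes "C \<in> Pow {1..p + q + r}"
  shows "mul p q r x y C =
    (\<Sum>A\<in>Pow {1..p + q + r}. blade_coeff p q A (sym_diff A C) * x A * y (sym_diff A C))"
  unfolding mul_def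
proof (rule sum.cong[OF refl])
  fix A assume "A \<in> Pow {1..p + q + r}"
  then have "sym_diff A C \<in> Pow {1..p + q + r}" using assms by (intro sym_diff_Pow)
  then show "(\<Sum>B\<in>Pow {1..p + q + r}. if sym_diff A B = C then blade_coeff p q A B * x A * y B else 0) =
      blade_coeff p q A (sym_diff A C) * x A * y (sym_diff A C)"
    by (simp only: sym_diff_eq_iff) (simp add: sum.delta)
qed

lemma mul_nonzeroD:
  assumes "mul p q r x y C \<noteq> 0"
  obtains A B where "A \<subseteq> {1..p + q + r}" "B \<subseteq> {1..p + q + r}" "x A \<noteq> 0" "y B \<noteq> 0"
    "C = sym_diff A B"
proof -
  have "C \<in> Pow {1..p + q + r}" using mul_closed[of p q r x y] assms by (auto simp: cl_def)
  then obtain A where A: "A \<in> Pow {1..p + q + r}"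
    "blade_coeff p q A (sym_diff A C) * x A * y (sym_diff A C) \<noteq> 0"
    using assms by (metis (no_types, lifting) mul_apply sum.neutral)
  show ?thesis
    using that[of A "sym_diff A C"] A \<open>C \<in> _\<close> by auto
qed

lemma mul_blade_right_apply:
  assumes "A \<in> Pow {1..p + q + r}" "B \<in> Pow {1..p + q + r}"
  shows "mul p q r x (blade B) (sym_diff A B) = blade_coeff p q A B * (x A :: 'f::field)"
proof -
  have "mul p q r x (blade B) (sym_diff A B) =
      (\<Sum>A'\<in>Pow {1..p + q + r}. if A' = A then blade_coeff p q A B * x A else 0)"
    unfolding mul_apply[OF sym_diff_Pow[OF assms]]
  proof (intro sum.cong refl)
    fix A'
    have "sym_diff A' (sym_diff A B) = B \<longleftrightarrow> A' = A" by blast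
    then show "blade_coeff p q A' (sym_diff A' (sym_diff A B)) * x A' * blade B (sym_diff A' (sym_diff A B)) =
        (if A' = A then blade_coeff p q A B * x A else 0)"
      by (cases "A' = A") (simp_all add: blade_def)
  qed
  then show ?thesis using assms by simp
qed

lemma mul_blade_left_apply:
  assumes "A \<in> Pow {1..p + q + r}" "B \<in> Pow {1..p + q + r}"
  shows "mul p q r (blade B) x (sym_diff A B) = blade_coeff p q B A * (x A :: 'f::field)"
proof -
  have eq: "sym_diff B (sym_diff A B) = A" by blast
  have "mul p q r (blade B) x (sym_diff A B) =
      (\<Sum>B'\<in>Pow {1..p + q + r}. if B' = B then blade_coeff p q B A * x A else 0)"
    unfolding mul_apply[OF sym_diff_Pow[OF assms]]
    by (intro sum.cong refl) (auto simp: blade_def eq)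
  then show ?thesis using assms by simp
qed

text \<open>
  Exchanging the factors turns inversions into non-inversions; the pairs on the diagonal are neither,
  whence the exponent \<open>|A| |B|\<close> corrected by \<open>|A \<inter> B|\<close>.
\<close>

lemma blade_coeff_swap:
  assumes "finite A" "finite B"
  shows "blade_coeff p q B A = (-1) ^ (card A * card B + card (A \<inter> B)) * (blade_coeff p q A B :: 'f::field)"
proof -
  define N where "N X Y = {(a, b). a \<in> X \<and> b \<in> Y \<and> b < a}" for X Y :: "nat set"
  have fin: "finite (N X Y)" if "finite X" "finite Y" for X Y
    by (rule finite_subset[of _ "X \<times> Y"]) (use that in \<open>auto simp: N_def\<close>)
  have "A \<times> B = (N A B \<union> prod.swap ` N B A) \<union> (\<lambda>a. (a, a)) ` (A \<inter> B)"
    by (auto simp: N_def image_iff)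
  also have "card \<dots> = card (N A B \<union> prod.swap ` N B A) + card ((\<lambda>a. (a, a)) ` (A \<inter> B))"
    using assms fin by (intro card_Un_disjoint) (auto simp: N_def)
  also have "card (N A B \<union> prod.swap ` N B A) = card (N A B) + card (prod.swap ` N B A)"
    using assms fin by (intro card_Un_disjoint) (auto simp: N_def)
  also have "card (prod.swap ` N B A) = card (N B A)"
    by (intro card_image) simp
  also have "card ((\<lambda>a. (a, a)) ` (A \<inter> B)) = card (A \<inter> B)"
    by (intro card_image) (auto simp: inj_on_def)
  finally have *: "card A * card B = card (N A B) + card (N B A) + card (A \<inter> B)"
    by (simp add: card_cartesian_product)
  have "card A * card B + card (A \<inter> B) + card (N A B) =
      card (N B A) + 2 * (card (N A B) + card (A \<inter> B))"
    using * by simp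
  then have "(-1 :: 'f) ^ (card A * card B + card (A \<inter> B)) * (-1) ^ card (N A B) = (-1) ^ card (N B A)"
    by (simp add: power_add[symmetric]) (simp add: power_add power_mult)
  then show ?thesis
    unfolding blade_coeff_def N_def[symmetric] by (simp add: Int_commute mult.assoc[symmetric])
qed

lemma blade_coeff_nonzero_iff:
  assumes "A \<subseteq> {1..p + q + r}"
  shows "(blade_coeff p q A B :: 'f::field) \<noteq> 0 \<longleftrightarrow> A \<inter> B \<subseteq> {1..p + q}"
proof -
  have "finite (A \<inter> B)" using assms finite_subset by blast
  then have "(blade_coeff p q A B :: 'f) \<noteq> 0 \<longleftrightarrow> (\<forall>c\<in>A \<inter> B. eta p q c \<noteq> (0 :: 'f))"
    by (simp add: blade_coeff_def)
  also have "\<dots> \<longleftrightarrow> A \<inter> B \<subseteq> {1..p + q}"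
    using assms by (auto simp: eta_def)
  finally show ?thesis .
qed

section \<open>Reversion and conjugation\<close>

lemma card_sym_diff:
  assumes "finite A" "finite B"
  shows "card (sym_diff A B) + 2 * card (A \<inter> B) = card A + card B"
proof -
  have "card (sym_diff A B) = card (A - B) + card (B - A)"
    using assms by (intro card_Un_disjoint) auto
  moreover have "card A = card (A - B) + card (A \<inter> B)"
    using assms by (metis card_Int_Diff add.commute)
  moreover have "card B = card (B - A) + card (A \<inter> B)"
    using assms by (metis card_Int_Diff add.commute Int_commute)
  ultimately show ?thesis by simp
qed

lemma reversion_sign:
  "(-1 :: 'f::field) ^ (k * (k - 1) div 2) = (if k mod 4 = 0 \<or> k mod 4 = 1 then 1 else -1)"
proof -
  define m where "m = k div 4"
  have k: "k = 4 * m + k mod 4" by (simp add: m_def)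
  have "k mod 4 < 4" by simp
  then consider "k = 4 * m" | "k = 4 * m + 1" | "k = 4 * m + 2" | "k = 4 * m + 3"
    using k by linarith
  then show ?thesis
  proof cases
    case 1
    then have "k * (k - 1) div 2 = 2 * (m * (k - 1))" by simp
    then show ?thesis using 1 by (simp only: power_mult) simp
  next
    case 2
    then have "k * (k - 1) div 2 = 2 * (m * k)" by simp
    then show ?thesis using 2 by (simp only: power_mult) (simp add: mod_Suc)
  next
    case 3
    then have "k * (k - 1) = 2 * (2 * (4 * m * m + 3 * m) + 1)" by (simp add: algebra_simps)
    then have "k * (k - 1) div 2 = 2 * (4 * m * m + 3 * m) + 1" by simp
    moreover have "k mod 4 = 2" using 3 by presburger
    ultimately show ?thesis by (simp add: power_add power_mult)
  next
    case 4
    then have "k * (k - 1) = 2 * (2 * (4 * m * m + 5 * m + 1) + 1)" by (simp add: algebra_simps)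
    then have "k * (k - 1) div 2 = 2 * (4 * m * m + 5 * m + 1) + 1" by simp
    moreover have "k mod 4 = 3" using 4 by presburger
    ultimately show ?thesis by (simp add: power_add power_mult)
  qed
qed

text \<open>
  The reversion reverses the product \<open>e\<^sub>A e\<^sub>B\<close>, so its sign on the symmetric difference is multiplicative up to
  the sign with which the two basis elements commute.
\<close>

lemma reversion_sign_sym_diff:
  assumes "c + 2 * i = a + b" "i \<le> a" "i \<le> b"
  shows "(-1 :: 'f::field) ^ (c * (c - 1) div 2) =
    (-1) ^ (a * (a - 1) div 2) * (-1) ^ (b * (b - 1) div 2) * (-1) ^ (a * b + i)"
proof -
  have par: "(-1 :: 'f) ^ (a * b + i) = (if (odd a \<and> odd b) = odd i then 1 else -1)"
    by (auto simp: minus_one_power_iff)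
  have "((c mod 4 = 0 \<or> c mod 4 = 1) = (((a mod 4 = 0 \<or> a mod 4 = 1) = (b mod 4 = 0 \<or> b mod 4 = 1)) = ((odd a \<and> odd b) = odd i)))"
  proof -
    have c: "c mod 4 = (a mod 4 + b mod 4 + 2 * (i mod 2)) mod 4"
    proof -
      have "c mod 4 = (c + 4 * i) mod 4" by simp
      also have "c + 4 * i = a + b + 2 * i" using assms(1) by simp
      also have "(a + b + 2 * i) mod 4 = (a mod 4 + b mod 4 + (2 * i) mod 4) mod 4"
        by (intro mod_add_cong) simp_all
      also have "(2 * i) mod 4 = 2 * (i mod 2)" using mult_mod_right[of 2 i 2] by simp
      finally show ?thesis .
    qed
    have odd: "odd a = odd (a mod 4)" "odd b = odd (b mod 4)" "odd i = (i mod 2 = 1)"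
      by presburger+
    have "a mod 4 < 4" "b mod 4 < 4" "i mod 2 < 2" by simp_all
    then have mem: "a mod 4 \<in> {0, 1, 2, 3}" "b mod 4 \<in> {0, 1, 2, 3}" "i mod 2 \<in> {0, 1}" by auto
    have key: "((x + y + 2 * z) mod 4 = 0 \<or> (x + y + 2 * z) mod 4 = 1) =
        (((x = 0 \<or> x = 1) = (y = 0 \<or> y = 1)) = ((odd x \<and> odd y) = (z = 1)))"
      if "x \<in> {0, 1, 2, 3}" "y \<in> {0, 1, 2, 3}" "z \<in> {0, 1}" for x y z :: nat
      using that by (elim insertE emptyE; simp)
    show ?thesis using key[OF mem] unfolding c[symmetric] odd[symmetric] .
  qed
  then show ?thesis unfolding reversion_sign par by auto
qed

text \<open>
  Reversion and conjugation both multiply coordinates by a sign with this cocycle property, and that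
  is all that makes them anti-automorphisms.
\<close>

lemma mul_anti:
  fixes x y :: "'f::field mv"
  assumes s: "\<And>A B. finite A \<Longrightarrow> finite B \<Longrightarrow>
    s (sym_diff A B) = s A * s B * (-1 :: 'f) ^ (card A * card B + card (A \<inter> B))"
  shows "(\<lambda>C. s C * mul p q r x y C) = mul p q r (\<lambda>C. s C * y C) (\<lambda>C. s C * x C)"
proof
  fix C
  let ?P = "Pow {1..p + q + r}"
  show "s C * mul p q r x y C = mul p q r (\<lambda>C. s C * y C) (\<lambda>C. s C * x C) C"
  proof (cases "C \<in> ?P")
    case False
    have "mul p q r u v C = 0" for u v :: "'f mv"
      using False mul_closed[of p q r u v] unfolding cl_def by blast
    then show ?thesis by simp
  next
    case True
    have "s C * mul p q r x y C = (\<Sum>A\<in>?P. s C * (blade_coeff p q A (sym_diff A C) * x A * y (sym_diff A C)))"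
      unfolding mul_apply[OF True] by (rule sum_distrib_left)
    also have "\<dots> = (\<Sum>B\<in>?P. blade_coeff p q B (sym_diff B C) * (s B * y B) * (s (sym_diff B C) * x (sym_diff B C)))"
    proof (rule sum.reindex_bij_witness[of _ "\<lambda>B. sym_diff B C" "\<lambda>B. sym_diff B C"])
      fix A assume A: "A \<in> ?P"
      then have fin: "finite A" "finite (sym_diff A C)"
        using True finite_subset[of _ "{1..p + q + r}"] by auto
      have [simp]: "sym_diff (sym_diff A C) C = A" by blast
      have "sym_diff A (sym_diff A C) = C" by blast
      with s[OF fin] have sC: "s C = s A * s (sym_diff A C) * (-1) ^ (card A * card (sym_diff A C) + card (A \<inter> sym_diff A C))"
        by simp
      show "blade_coeff p q (sym_diff A C) (sym_diff (sym_diff A C) C) * (s (sym_diff A C) * y (sym_diff A C)) *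
          (s (sym_diff (sym_diff A C) C) * x (sym_diff (sym_diff A C) C)) =
          s C * (blade_coeff p q A (sym_diff A C) * x A * y (sym_diff A C))"
        by (simp add: blade_coeff_swap[OF fin] sC)
    qed (use True in auto)
    finally show ?thesis unfolding mul_apply[OF True] .
  qed
qed

lemma reversion_mul: "reversion (mul p q r x y) = mul p q r (reversion y) (reversion (x :: 'f::field mv))"
  unfolding reversion_def
  by (rule mul_anti)
     (rule reversion_sign_sym_diff, auto simp: card_sym_diff intro!: card_mono)

lemma conjugation_mul: "conjugation (mul p q r x y) = mul p q r (conjugation y) (conjugation (x :: 'f::field mv))"
proof -
  have conj: "conjugation z = (\<lambda>C. (-1) ^ card C * (-1) ^ (card C * (card C - 1) div 2) * z C)" for z :: "'f mv"
    by (simp add: conjugation_def involution_def reversion_def mult.assoc)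
  show ?thesis unfolding conj
  proof (rule mul_anti)
    fix A B :: "nat set" assume f: "finite A" "finite B"
    then have r: "(-1 :: 'f) ^ (card (sym_diff A B) * (card (sym_diff A B) - 1) div 2) =
        (-1) ^ (card A * (card A - 1) div 2) * (-1) ^ (card B * (card B - 1) div 2) * (-1) ^ (card A * card B + card (A \<inter> B))"
      by (intro reversion_sign_sym_diff card_sym_diff card_mono) auto
    have "(-1 :: 'f) ^ (card (sym_diff A B) + 2 * card (A \<inter> B)) = (-1) ^ (card A + card B)"
      using card_sym_diff[OF f] by simp
    then have "(-1 :: 'f) ^ card (sym_diff A B) = (-1) ^ card A * (-1) ^ card B"
      by (simp add: power_add power_mult)
    with r show "(-1 :: 'f) ^ card (sym_diff A B) * (-1) ^ (card (sym_diff A B) * (card (sym_diff A B) - 1) div 2) =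
      (-1) ^ card A * (-1) ^ (card A * (card A - 1) div 2) * ((-1) ^ card B * (-1) ^ (card B * (card B - 1) div 2)) *
      (-1) ^ (card A * card B + card (A \<inter> B))"
      by simp
  qed
qed

text \<open>
  The grade involution is a composition of two anti-automorphisms.
\<close>

lemma involution_mul: "involution (mul p q r x y) = mul p q r (involution x) (involution (y :: 'f::field mv))"
proof -
  have "involution z = conjugation (reversion z)" for z :: "'f mv"
    by (simp add: conjugation_def reversion_def fun_eq_iff mult.assoc[symmetric] involution_def flip: power_add mult_2)
  then show ?thesis by (simp add: reversion_mul conjugation_mul)
qed

lemma reversion_apply:
  "reversion x A = (if card A mod 4 = 0 \<or> card A mod 4 = 1 then x A else - (x A :: 'f::field))"
  unfolding reversion_def reversion_sign by simp

lemma conjugation_apply: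
  "conjugation x A = (if card A mod 4 = 0 \<or> card A mod 4 = 3 then x A else - (x A :: 'f::field))"
proof -
  have *: "even k \<longleftrightarrow> k mod 4 = 0 \<or> k mod 4 = 2" for k :: nat by presburger
  show ?thesis
  by (auto simp: conjugation_def involution_def reversion_apply * minus_one_power_iff)
qed

lemma reversion_closed: "x \<in> coord F \<Longrightarrow> reversion x \<in> coord F"
  by (auto simp: coord_def reversion_apply)

lemma conjugation_closed: "x \<in> coord F \<Longrightarrow> conjugation x \<in> coord F"
  by (auto simp: coord_def conjugation_apply)

lemma reversion_unit [simp]: "reversion unit_mv = (unit_mv :: 'f::field mv)"
  by (auto simp: reversion_apply blade_def fun_eq_iff)

lemma conjugation_unit [simp]: "conjugation unit_mv = (unit_mv :: 'f::field mv)"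
  by (auto simp: conjugation_apply blade_def fun_eq_iff)

lemma unit_closed: "(unit_mv :: 'f::field mv) \<in> cl p q r"
  by (simp add: cl_eq_coord blade_in_coord)

lemma scale_closed: "x \<in> coord F \<Longrightarrow> scale_mv c x \<in> coord F"
  by (rule mv.subspace_scale[OF coord_subspace])

lemma add_closed: "x \<in> coord F \<Longrightarrow> y \<in> coord F \<Longrightarrow> x + y \<in> coord F"
  by (rule mv.subspace_add[OF coord_subspace])

abbreviation units :: "nat \<Rightarrow> nat \<Rightarrow> nat \<Rightarrow> 'f::field mv set" where
  "units p q r \<equiv> inv_elems p q r (cl p q r)"

lemma units_mul:
  assumes "x \<in> units p q r" "y \<in> units p q r"
  shows "mul p q r x y \<in> (units p q r :: 'f::field mv set)"
proof -
  obtain x' y' where x': "x' \<in> cl p q r" "mul p q r x x' = unit_mv" "mul p q r x' x = unit_mv"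
    and y': "y' \<in> cl p q r" "mul p q r y y' = unit_mv" "mul p q r y' y = unit_mv"
    and c: "x \<in> cl p q r" "y \<in> cl p q r"
    using assms unfolding inv_elems_def by blast
  have "mul p q r (mul p q r x y) (mul p q r y' x') = mul p q r x (mul p q r (mul p q r y y') x')"
    by (simp only: mul_assoc)
  then have 1: "mul p q r (mul p q r x y) (mul p q r y' x') = unit_mv"
    using x' y' by (simp add: mul_unit_left)
  have "mul p q r (mul p q r y' x') (mul p q r x y) = mul p q r y' (mul p q r (mul p q r x' x) y)"
    by (simp only: mul_assoc)
  then have 2: "mul p q r (mul p q r y' x') (mul p q r x y) = unit_mv"
    using x' y' c by (simp add: mul_unit_left)
  show ?thesis
    unfolding inv_elems_def using 1 2 mul_closed by blast
qed

lemma units_reversion: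
  assumes "x \<in> units p q r" shows "reversion x \<in> (units p q r :: 'f::field mv set)"
proof -
  obtain y where "y \<in> cl p q r" "mul p q r x y = unit_mv" "mul p q r y x = unit_mv" "x \<in> cl p q r"
    using assms unfolding inv_elems_def by blast
  note y = this
  then have "mul p q r (reversion y) (reversion x) = unit_mv" "mul p q r (reversion x) (reversion y) = unit_mv"
    by (simp_all flip: reversion_mul)
  moreover have "reversion y \<in> cl p q r" "reversion x \<in> cl p q r"
    using y by (simp_all add: cl_eq_coord reversion_closed)
  ultimately show ?thesis unfolding inv_elems_def by blast
qed

lemma units_conjugation:
  assumes "x \<in> units p q r" shows "conjugation x \<in> (units p q r :: 'f::field mv set)"
proof -
  obtain y where "y \<in> cl p q r" "mul p q r x y = unit_mv" "mul p q r y x = unit_mv" "x \<in> cl p q r"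
    using assms unfolding inv_elems_def by blast
  note y = this
  then have "mul p q r (conjugation y) (conjugation x) = unit_mv" "mul p q r (conjugation x) (conjugation y) = unit_mv"
    by (simp_all flip: conjugation_mul)
  moreover have "conjugation y \<in> cl p q r" "conjugation x \<in> cl p q r"
    using y by (simp_all add: cl_eq_coord conjugation_closed)
  ultimately show ?thesis unfolding inv_elems_def by blast
qed

section \<open>Curves and velocities\<close>

lemma lie_algebra_mono: "G \<subseteq> H \<Longrightarrow> lie_algebra G \<subseteq> lie_algebra H"
  unfolding lie_algebra_def by blast

lemma zero_in_lie_algebra:
  assumes "unit_mv \<in> G"
  shows "(0 :: 'f::{real_normed_field,banach} mv) \<in> lie_algebra G"
  unfolding lie_algebra_def
  by (intro CollectI exI[of _ "\<lambda>t. unit_mv"] exI[of _ "\<lambda>t. 0"]) (use assms in auto)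

lemma has_vector_derivative_mul:
  fixes x y :: "real \<Rightarrow> 'f::{real_normed_field,banach} mv"
  assumes "\<And>A. ((\<lambda>s. x s A) has_vector_derivative x' A) (at t)"
    and "\<And>A. ((\<lambda>s. y s A) has_vector_derivative y' A) (at t)"
  shows "((\<lambda>s. mul p q r (x s) (y s) C) has_vector_derivative
    (mul p q r x' (y t) + mul p q r (x t) y') C) (at t)"
proof (cases "C \<in> Pow {1..p + q + r}")
  case False
  have "mul p q r u v C = 0" for u v :: "'f mv"
    using False mul_closed[of p q r u v] unfolding cl_def by blast
  then show ?thesis by simp
next
  case True
  have "((\<lambda>s. \<Sum>A\<in>Pow {1..p + q + r}. blade_coeff p q A (sym_diff A C) * x s A * y s (sym_diff A C))
    has_vector_derivative
    (\<Sum>A\<in>Pow {1..p + q + r}. blade_coeff p q A (sym_diff A C) * x t A * y' (sym_diff A C) +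
       (blade_coeff p q A (sym_diff A C) * x' A) * y t (sym_diff A C))) (at t)"
    by (intro has_vector_derivative_sum has_vector_derivative_mult has_vector_derivative_mult_right assms)
  also have "(\<Sum>A\<in>Pow {1..p + q + r}. blade_coeff p q A (sym_diff A C) * x t A * y' (sym_diff A C) +
       (blade_coeff p q A (sym_diff A C) * x' A) * y t (sym_diff A C)) =
     (mul p q r x' (y t) + mul p q r (x t) y') C"
    by (simp add: mul_apply[OF True] sum.distrib add.commute)
  finally show ?thesis unfolding mul_apply[OF True] .
qed

lemma continuous_on_mul:
  fixes x y :: "real \<Rightarrow> 'f::{real_normed_field,banach} mv"
  assumes "\<And>A. continuous_on UNIV (\<lambda>t. x t A)" "\<And>A. continuous_on UNIV (\<lambda>t. y t A)"
  shows "continuous_on UNIV (\<lambda>t. mul p q r (x t) (y t) C)"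
proof -
  have "continuous_on UNIV (\<lambda>t. if P then c * x t A * y t B else 0)" for P c A B
    by (cases P) (auto intro!: continuous_intros assms)
  then show ?thesis unfolding mul_def by (intro continuous_on_sum)
qed

text \<open>
  At time 0 both curves pass through the unit, so the product rule adds their velocities.
\<close>

lemma lie_algebra_mul:
  fixes X Y :: "'f::{real_normed_field,banach} mv"
  assumes X: "X \<in> lie_algebra H" "X \<in> cl p q r" and Y: "Y \<in> lie_algebra K" "Y \<in> cl p q r"
    and M: "\<And>T S. T \<in> H \<Longrightarrow> S \<in> K \<Longrightarrow> mul p q r T S \<in> M"
  shows "X + Y \<in> lie_algebra M"
proof -
  obtain x x' where x: "\<And>t. x t \<in> H" "x 0 = unit_mv" "x' 0 = X"
    "\<And>A t. ((\<lambda>s. x s A) has_vector_derivative x' t A) (at t)" "\<And>A. continuous_on UNIV (\<lambda>t. x' t A)"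
    using X(1) unfolding lie_algebra_def by blast
  obtain y y' where y: "\<And>t. y t \<in> K" "y 0 = unit_mv" "y' 0 = Y"
    "\<And>A t. ((\<lambda>s. y s A) has_vector_derivative y' t A) (at t)" "\<And>A. continuous_on UNIV (\<lambda>t. y' t A)"
    using Y(1) unfolding lie_algebra_def by blast
  have cont: "continuous_on UNIV (\<lambda>t. x t A)" "continuous_on UNIV (\<lambda>t. y t A)" for A
    by (intro continuous_at_imp_continuous_on ballI has_vector_derivative_continuous[OF x(4)]
        has_vector_derivative_continuous[OF y(4)])+
  show ?thesis
    unfolding lie_algebra_def
  proof (rule CollectI, rule exI[of _ "\<lambda>t. mul p q r (x t) (y t)"],
      rule exI[of _ "\<lambda>t. mul p q r (x' t) (y t) + mul p q r (x t) (y' t)"], intro conjI allI)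
    show "mul p q r (x t) (y t) \<in> M" for t by (rule M[OF x(1) y(1)])
    show "mul p q r (x 0) (y 0) = unit_mv"
      by (simp add: x y mul_unit_left unit_closed)
    show "mul p q r (x' 0) (y 0) + mul p q r (x 0) (y' 0) = X + Y"
      by (simp add: x y mul_unit_left mul_unit_right X Y)
    show "((\<lambda>s. mul p q r (x s) (y s) A) has_vector_derivative
        (mul p q r (x' t) (y t) + mul p q r (x t) (y' t)) A) (at t)" for A t
      by (rule has_vector_derivative_mul[OF x(4) y(4)])
    show "continuous_on UNIV (\<lambda>t. (mul p q r (x' t) (y t) + mul p q r (x t) (y' t)) A)" for A
      unfolding plus_fun_apply
      by (intro continuous_on_add continuous_on_mul x y cont)
  qed
qed

abbreviation small_factor :: "nat set \<Rightarrow> 'f::real_normed_field \<Rightarrow> 'f mv" where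
  "small_factor A d \<equiv> unit_mv + scale_mv d (blade A)"

text \<open>
  A curve must stay in its set for all times, hence the bounded parametrization by a sine.
\<close>

lemma blade_in_lie_algebra:
  fixes c :: "'f::{real_normed_field,banach}"
  shows "scale_mv c (blade A) \<in> lie_algebra {small_factor A d |d. norm d < 1}"
proof -
  \<comment> \<open>the frequency only has to exceed \<open>norm c\<close>, so that \<open>sin (k t) / k\<close> times \<open>c\<close> has norm below 1\<close>
  define k where "k = norm c + 1"
  have k: "k > 0" by (simp add: k_def add_nonneg_pos)
  define f where "f t = sin (k * t) / k" for t
  have bound: "norm (of_real (f t) * c) < 1" for t
  proof -
    have "norm (of_real (f t) * c) = \<bar>sin (k * t)\<bar> * (norm c / k)"
      using k by (simp add: f_def norm_mult norm_divide)
    also have "\<dots> \<le> 1 * (norm c / k)"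
      using k by (intro mult_right_mono) auto
    also have "\<dots> < 1" using k by (simp add: k_def)
    finally show ?thesis .
  qed
  have f': "(f has_vector_derivative cos (k * t)) (at t)" for t
    unfolding f_def has_real_derivative_iff_has_vector_derivative[symmetric]
    using k by (auto intro!: derivative_eq_intros)
  show ?thesis
    unfolding lie_algebra_def
  proof (rule CollectI, rule exI[of _ "\<lambda>t. small_factor A (of_real (f t) * c)"],
      rule exI[of _ "\<lambda>t. scale_mv (of_real (cos (k * t)) * c) (blade A)"], intro conjI allI)
    show "small_factor A (of_real (f t) * c) \<in> {small_factor A d |d. norm d < 1}" for t
      using bound by blast
    show "small_factor A (of_real (f 0) * c) = unit_mv"
      by (simp add: f_def)
    show "scale_mv (of_real (cos (k * 0)) * c) (blade A) = scale_mv c (blade A)"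
      by simp
    show "((\<lambda>s. small_factor A (of_real (f s) * c) B) has_vector_derivative
        scale_mv (of_real (cos (k * t)) * c) (blade A) B) (at t)" for B t
    proof -
      have "((\<lambda>s. of_real (f s) :: 'f) has_vector_derivative of_real (cos (k * t))) (at t)"
        by (rule bounded_linear.has_vector_derivative[OF bounded_linear_of_real f'])
      then have "((\<lambda>s. unit_mv B + of_real (f s) * (c * blade A B)) has_vector_derivative
          0 + of_real (cos (k * t)) * (c * blade A B)) (at t)"
        by (intro has_vector_derivative_add has_vector_derivative_const has_vector_derivative_mult_left)
      then show ?thesis by (simp add: scale_mv_def mult.assoc)
    qed
    show "continuous_on UNIV (\<lambda>t. scale_mv (of_real (cos (k * t)) * c) (blade A) B)" for B
      unfolding scale_mv_def by (intro continuous_intros)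
  qed
qed

text \<open>
  If a set is stable under multiplication by the factors in the directions \<open>F\<close>, then its velocities are
  stable under addition of the span of \<open>F\<close>: the directions are added one after the other.
\<close>

lemma lie_algebra_add_coord:
  fixes X Y :: "'f::{real_normed_field,banach} mv"
  assumes "finite F" "F \<subseteq> Pow {1..p + q + r}"
    and "\<And>A d T. A \<in> F \<Longrightarrow> norm d < 1 \<Longrightarrow> T \<in> H \<Longrightarrow> mul p q r (small_factor A d) T \<in> H"
    and "X \<in> coord F" and Y: "Y \<in> lie_algebra H" "Y \<in> cl p q r"
  shows "X + Y \<in> lie_algebra H"
proof -
  have "(\<Sum>A\<in>F'. scale_mv (X A) (blade A)) + Y \<in> lie_algebra H \<inter> cl p q r" if "finite F'" "F' \<subseteq> F" for F'
    using that
  proof (induction F' rule: finite_induct)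
    case empty
    then show ?case using Y by (simp only: sum.empty add_0_left IntI)
  next
    case (insert A F')
    have A: "A \<in> F" using insert by simp
    have cl: "scale_mv (X A) (blade A) \<in> cl p q r"
      using A assms(2) by (auto simp: cl_eq_coord intro!: scale_closed blade_in_coord)
    let ?Z = "(\<Sum>A\<in>F'. scale_mv (X A) (blade A)) + Y"
    have Z: "?Z \<in> lie_algebra H" "?Z \<in> cl p q r" using insert by blast+
    have "scale_mv (X A) (blade A) + ?Z \<in> lie_algebra H"
      by (rule lie_algebra_mul[OF blade_in_lie_algebra cl Z]) (use assms(3) A in blast)
    moreover have "scale_mv (X A) (blade A) + ?Z \<in> cl p q r"
      using cl Z(2) unfolding cl_eq_coord by (rule add_closed)
    ultimately show ?case unfolding sum.insert[OF insert.hyps(1,2)] add.assoc by blast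
  qed
  from this[OF assms(1)] show ?thesis
    unfolding coord_expand[OF assms(1,4), symmetric] by blast
qed

section \<open>Groups defined by norm conditions\<close>

lemma small_factor_mul:
  fixes d d' :: "'f::real_normed_field"
  assumes "A \<in> Pow {1..p + q + r}"
  shows "mul p q r (small_factor A d) (small_factor A d') =
    scale_mv (1 + d * d' * blade_coeff p q A A) unit_mv + scale_mv (d + d') (blade A)"
proof -
  have "mul p q r (blade A) (blade A) = scale_mv (blade_coeff p q A A) (unit_mv :: 'f mv)"
    using assms by (simp add: mul_blade)
  moreover have "(blade A :: 'f mv) \<in> cl p q r" using assms by (auto simp: cl_eq_coord intro: blade_in_coord)
  ultimately have "mul p q r (small_factor A d) (small_factor A d') =
      unit_mv + scale_mv d (blade A) + scale_mv d' (blade A + scale_mv d (scale_mv (blade_coeff p q A A) unit_mv))"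
    by (simp only: mul_add_left mul_add_right mul_scale_left mul_scale_right mul_unit_left
        mul_unit_right unit_closed)
  also have "\<dots> = scale_mv (1 + d * d' * blade_coeff p q A A) unit_mv + scale_mv (d + d') (blade A)"
    by (simp add: scale_mv_def fun_eq_iff algebra_simps)
  finally show ?thesis .
qed

lemma norm_blade_coeff_le: "norm (blade_coeff p q A B :: 'f::real_normed_field) \<le> 1"
proof -
  have "norm (\<Prod>c\<in>A \<inter> B. eta p q c :: 'f) \<le> 1"
    unfolding prod_norm[symmetric] by (intro prod_le_1) (auto simp: eta_def)
  then show ?thesis by (simp add: blade_coeff_def norm_mult norm_power)
qed

text \<open>
  The conjugate factor is an inverse up to the scalar \<open>1 - d\<^sup>2 e\<^sub>A\<^sup>2\<close>, which does not vanish because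
  \<open>d\<close> has norm below 1 and \<open>e\<^sub>A\<^sup>2\<close> is \<open>0\<close> or \<open>\<plusminus> 1\<close>.
\<close>

lemma small_factor_unit:
  fixes d :: "'f::real_normed_field"
  assumes "A \<in> Pow {1..p + q + r}" "norm d < 1"
  shows "small_factor A d \<in> units p q r"
proof -
  define \<nu> where "\<nu> = 1 + d * (- d) * blade_coeff p q A A"
  have "norm (d * (- d) * blade_coeff p q A A) \<le> norm d * norm d * 1"
    unfolding norm_mult norm_minus_cancel by (intro mult_left_mono norm_blade_coeff_le) simp
  also have "\<dots> < 1" using assms(2) mult_strict_mono[of "norm d" 1 "norm d" 1] by simp
  finally have "norm (d * (- d) * blade_coeff p q A A) < 1" .
  then have nz: "\<nu> \<noteq> 0"
    unfolding \<nu>_def by (metis add_eq_0_iff norm_minus_cancel norm_one order_less_irrefl)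
  let ?y = "scale_mv (inverse \<nu>) (small_factor A (- d))"
  have cl: "small_factor A x \<in> cl p q r" for x :: 'f
    using assms(1) unfolding cl_eq_coord
    by (intro add_closed scale_closed blade_in_coord) auto
  have eq: "mul p q r (small_factor A d) (small_factor A (- d)) = scale_mv \<nu> unit_mv"
    "mul p q r (small_factor A (- d)) (small_factor A d) = scale_mv \<nu> unit_mv"
    unfolding small_factor_mul[OF assms(1)] \<nu>_def
    by (simp_all add: scale_mv_def fun_eq_iff)
  have "scale_mv (inverse \<nu>) (scale_mv \<nu> unit_mv) = (unit_mv :: 'f mv)"
    using nz by (simp add: scale_mv_def mult.assoc[symmetric])
  then have "mul p q r (small_factor A d) ?y = unit_mv" "mul p q r ?y (small_factor A d) = unit_mv"
    unfolding mul_scale_left mul_scale_right eq by simp_all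
  moreover have "?y \<in> cl p q r"
    using cl unfolding cl_eq_coord by (rule scale_closed)
  ultimately show ?thesis
    unfolding inv_elems_def using cl by blast
qed

text \<open>
  Reversion and conjugation enter the tangent space computation symmetrically; \<open>S\<close> collects the basis
  elements that are fixed, all others being negated.
\<close>

definition anti_involution :: "nat \<Rightarrow> nat \<Rightarrow> nat \<Rightarrow> ('f::field mv \<Rightarrow> 'f mv) \<Rightarrow> nat set set \<Rightarrow> bool" where
  "anti_involution p q r \<alpha> S \<longleftrightarrow>
     (\<forall>x y. \<alpha> (mul p q r x y) = mul p q r (\<alpha> y) (\<alpha> x)) \<and>
     (\<forall>x A. \<alpha> x A = (if A \<in> S then x A else - x A)) \<and> {} \<in> S"

lemma anti_involution_reversion:
  "anti_involution p q r (reversion :: 'f::field mv \<Rightarrow> 'f mv) {A. card A mod 4 = 0 \<or> card A mod 4 = 1}"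
  by (simp add: anti_involution_def reversion_mul reversion_apply)

lemma anti_involution_conjugation:
  "anti_involution p q r (conjugation :: 'f::field mv \<Rightarrow> 'f mv) {A. card A mod 4 = 0 \<or> card A mod 4 = 3}"
  by (simp add: anti_involution_def conjugation_mul conjugation_apply)

lemma anti_involution_closed: "anti_involution p q r \<alpha> S \<Longrightarrow> x \<in> coord F \<Longrightarrow> \<alpha> x \<in> coord F"
  by (auto simp: anti_involution_def coord_def)

lemma anti_involution_unit: "anti_involution p q r \<alpha> S \<Longrightarrow> \<alpha> unit_mv = unit_mv"
  by (auto simp: anti_involution_def blade_def fun_eq_iff)

lemma anti_involution_small_factor:
  assumes "anti_involution p q r \<alpha> S" "A \<notin> S"
  shows "\<alpha> (small_factor A d) = small_factor A (- d)"
  using assms by (auto simp: anti_involution_def blade_def scale_mv_def fun_eq_iff)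

definition coord_subalgebra :: "nat \<Rightarrow> nat \<Rightarrow> nat \<Rightarrow> 'f::field mv set \<Rightarrow> nat set set \<Rightarrow> bool" where
  "coord_subalgebra p q r W F \<longleftrightarrow>
     W = coord F \<and> F \<subseteq> Pow {1..p + q + r} \<and> {} \<in> F \<and> (\<forall>x\<in>W. \<forall>y\<in>W. mul p q r x y \<in> W)"

text \<open>
  A factor in a negated direction has a scalar norm, and as the innermost part of the norm of the product
  this scalar can be pulled out.
\<close>

lemma norm_skew_factor:
  fixes d :: "'f::real_normed_field"
  assumes \<alpha>: "anti_involution p q r \<alpha> S" and A: "A \<in> Pow {1..p + q + r}" "A \<notin> S" and T: "T \<in> cl p q r"
    and W: "mul p q r (\<alpha> T) T \<in> coord F"
  shows "mul p q r (\<alpha> (mul p q r (small_factor A d) T)) (mul p q r (small_factor A d) T) \<in> coord F"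
proof -
  let ?f = "small_factor A d"
  have anti: "\<alpha> (mul p q r ?f T) = mul p q r (\<alpha> T) (\<alpha> ?f)"
    using \<alpha> by (simp add: anti_involution_def)
  have f: "mul p q r (\<alpha> ?f) ?f = scale_mv (1 + (- d) * d * blade_coeff p q A A) unit_mv"
    unfolding anti_involution_small_factor[OF \<alpha> A(2)] small_factor_mul[OF A(1)]
    by (simp add: scale_mv_def fun_eq_iff)
  have "mul p q r (\<alpha> (mul p q r ?f T)) (mul p q r ?f T) = mul p q r (\<alpha> T) (mul p q r (mul p q r (\<alpha> ?f) ?f) T)"
    unfolding anti by (simp only: mul_assoc)
  also have "\<dots> = scale_mv (1 + (- d) * d * blade_coeff p q A A) (mul p q r (\<alpha> T) T)"
    unfolding f mul_scale_left mul_scale_right mul_unit_left[OF T] ..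
  finally show ?thesis using scale_closed[OF W] by simp
qed

text \<open>
  The derivative at the unit of the norm \<open>\<alpha>(T) T\<close> in the direction \<open>X\<close> is \<open>\<alpha>(X) + X\<close>, which doubles the
  fixed coordinates of \<open>X\<close>.
\<close>

lemma lie_algebra_subset:
  fixes \<alpha> :: "'f::{real_normed_field,banach} mv \<Rightarrow> 'f mv"
  assumes \<alpha>: "anti_involution p q r \<alpha> S"
    and G: "G \<subseteq> {T \<in> cl p q r. mul p q r (\<alpha> T) T \<in> coord F}"
    and X: "X \<in> lie_algebra G"
  shows "X \<in> cl p q r" and "A \<in> S \<Longrightarrow> X A \<noteq> 0 \<Longrightarrow> A \<in> F"
proof -
  obtain g g' where g: "\<And>t. g t \<in> G" "g 0 = unit_mv" "g' 0 = X"
    and der: "\<And>A t. ((\<lambda>s. g s A) has_vector_derivative g' t A) (at t)"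
    using X unfolding lie_algebra_def by blast
  have zero: "D = 0" if "(h has_vector_derivative D) (at 0)" "\<And>t. h t = 0" for h :: "real \<Rightarrow> 'f" and D
    using that vector_derivative_unique_at[of h D 0 0]
    by (metis has_vector_derivative_const has_vector_derivative_transform_within_open open_UNIV UNIV_I)
  show cl: "X \<in> cl p q r"
    unfolding cl_def
  proof (intro CollectI allI impI)
    fix A assume "X A \<noteq> 0"
    show "A \<subseteq> {1..p + q + r}"
    proof (rule ccontr)
      assume "\<not> A \<subseteq> {1..p + q + r}"
      then have "g t A = 0" for t using g(1)[of t] G by (auto simp: cl_def)
      then have "g' 0 A = 0" using zero[OF der[of A 0]] by blast
      with \<open>X A \<noteq> 0\<close> g(3) show False by simp
    qed
  qed
  show "A \<in> F" if "A \<in> S" "X A \<noteq> 0"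
  proof (rule ccontr)
    assume "A \<notin> F"
    have ap: "\<alpha> x B = (if B \<in> S then x B else - x B)" for x B
      using \<alpha> by (simp add: anti_involution_def)
    have "((\<lambda>s. \<alpha> (g s) B) has_vector_derivative \<alpha> X B) (at 0)" for B
      using der[of B 0] unfolding ap g(3) by (cases "B \<in> S") (auto intro: has_vector_derivative_minus)
    then have "((\<lambda>s. mul p q r (\<alpha> (g s)) (g s) A) has_vector_derivative
        (mul p q r (\<alpha> X) (g 0) + mul p q r (\<alpha> (g 0)) X) A) (at 0)"
      by (intro has_vector_derivative_mul) (use der[of _ 0] g(3) in simp_all)
    moreover have "mul p q r (\<alpha> (g t)) (g t) A = 0" for t
      using g(1)[of t] G \<open>A \<notin> F\<close> by (auto simp: coord_def)
    ultimately have "(mul p q r (\<alpha> X) (g 0) + mul p q r (\<alpha> (g 0)) X) A = 0"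
      by (rule zero)
    moreover have "\<alpha> X \<in> cl p q r" using anti_involution_closed[OF \<alpha>] cl unfolding cl_eq_coord by blast
    ultimately have "\<alpha> X A + X A = 0"
      by (simp add: g(2) anti_involution_unit[OF \<alpha>] mul_unit_left mul_unit_right cl)
    with that show False by (simp add: ap mult_2[symmetric])
  qed
qed

text \<open>
  To realize a vector as a velocity, its coordinates are split into those lying in both subalgebras,
  the remaining ones in \<open>W2\<close>, and the remaining ones negated by both involutions.  Factors of the last
  two kinds are put to the left of those of the previous kinds: their own norm is a scalar for \<open>\<alpha>\<close>, so that
  multiplying by them never leaves the sets \<open>Ha\<close>, \<open>Hb\<close> and the group.  The hypothesis \<open>ord\<close> says that
  no coordinate escapes this splitting.
\<close>

lemma lie_algebra_norm_group_aux:
  fixes \<alpha> \<beta> :: "'f::{real_normed_field,banach} mv \<Rightarrow> 'f mv"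
  assumes \<alpha>: "anti_involution p q r \<alpha> S1" and \<beta>: "anti_involution p q r \<beta> S2"
    and W1: "coord_subalgebra p q r W1 F1" and W2: "coord_subalgebra p q r W2 F2"
    and ord: "\<And>A. A \<in> F1 \<Longrightarrow> A \<in> S1 \<Longrightarrow> A \<notin> S2 \<Longrightarrow> A \<in> F2"
  shows "lie_algebra {T \<in> units p q r. mul p q r (\<alpha> T) T \<in> W1 \<and> mul p q r (\<beta> T) T \<in> W2} =
    coord {A \<in> Pow {1..p + q + r}. (A \<in> S1 \<longrightarrow> A \<in> F1) \<and> (A \<in> S2 \<longrightarrow> A \<in> F2)}"
    (is "lie_algebra ?G = coord ?F")
proof
  have W: "W1 = coord F1" "W2 = coord F2" "F1 \<subseteq> Pow {1..p + q + r}" "F2 \<subseteq> Pow {1..p + q + r}" "{} \<in> F1" "{} \<in> F2"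
    and closed: "\<And>x y. x \<in> W1 \<Longrightarrow> y \<in> W1 \<Longrightarrow> mul p q r x y \<in> W1"
      "\<And>x y. x \<in> W2 \<Longrightarrow> y \<in> W2 \<Longrightarrow> mul p q r x y \<in> W2"
    using W1 W2 unfolding coord_subalgebra_def by blast+
  have ucl: "units p q r \<subseteq> (cl p q r :: 'f mv set)" by (auto simp: inv_elems_def)
  show "lie_algebra ?G \<subseteq> coord ?F"
  proof
    fix X assume X: "X \<in> lie_algebra ?G"
    have 1: "?G \<subseteq> {T \<in> cl p q r. mul p q r (\<alpha> T) T \<in> coord F1}"
      and 2: "?G \<subseteq> {T \<in> cl p q r. mul p q r (\<beta> T) T \<in> coord F2}"
      using ucl W by auto
    show "X \<in> coord ?F"
      using lie_algebra_subset[OF \<alpha> 1 X] lie_algebra_subset(2)[OF \<beta> 2 X]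
      unfolding cl_eq_coord coord_def by blast
  qed
  show "coord ?F \<subseteq> lie_algebra ?G"
  proof
    fix X :: "'f mv" assume X: "X \<in> coord ?F"
    define Ha where "Ha = {T \<in> units p q r. T \<in> W1 \<and> T \<in> W2}"
    define Hb where "Hb = {T \<in> units p q r. mul p q r (\<alpha> T) T \<in> W1 \<and> T \<in> W2}"
    define Fa where "Fa = F1 \<inter> F2"
    define Fb where "Fb = {A \<in> F2. A \<notin> S1}"
    define Fc where "Fc = {A \<in> Pow {1..p + q + r}. A \<notin> S1 \<and> A \<notin> S2}"
    define Xa where "Xa = (\<lambda>A. if A \<in> Fa then X A else 0)"
    define Xb where "Xb = (\<lambda>A. if A \<in> Fb - Fa then X A else 0)"
    define Xc where "Xc = (\<lambda>A. if A \<in> Fc - Fa - Fb then X A else 0)"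
    have sub: "Fa \<subseteq> Pow {1..p + q + r}" "Fb \<subseteq> Pow {1..p + q + r}" "Fc \<subseteq> Pow {1..p + q + r}"
      using W by (auto simp: Fa_def Fb_def Fc_def)
    then have fin: "finite Fa" "finite Fb" "finite Fc"
      by (meson finite_Pow_iff finite_atLeastAtMost finite_subset)+
    have "?F \<subseteq> Fa \<union> Fb \<union> Fc"
      using ord W by (auto simp: Fa_def Fb_def Fc_def)
    then have supp: "X A \<noteq> 0 \<longrightarrow> A \<in> Fa \<or> A \<in> Fb \<or> A \<in> Fc" for A
      using X unfolding coord_def by blast
    have split: "X = Xc + (Xb + (Xa + 0))"
    proof
      fix A
      show "X A = (Xc + (Xb + (Xa + 0))) A"
        using supp[of A] by (auto simp: Xa_def Xb_def Xc_def)
    qed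
    have in_coord: "Xa \<in> coord Fa" "Xb \<in> coord Fb" "Xc \<in> coord Fc"
      by (auto simp: coord_def Xa_def Xb_def Xc_def)
    then have cl: "Xa \<in> cl p q r" "Xb \<in> cl p q r" "Xc \<in> cl p q r"
      using coord_mono[OF sub(1)] coord_mono[OF sub(2)] coord_mono[OF sub(3)] unfolding cl_eq_coord by blast+
    have factor: "small_factor A d \<in> coord F" if "A \<in> F" "{} \<in> F" for A and d :: 'f and F
      using that by (intro add_closed scale_closed blade_in_coord)
    have unit: "unit_mv \<in> Ha"
      unfolding Ha_def inv_elems_def W using W(5,6) unit_closed[of p q r]
      by (auto intro!: blade_in_coord bexI[of _ unit_mv] simp: mul_unit_left)
    have zero: "(0 :: 'f mv) \<in> cl p q r" unfolding cl_eq_coord by (rule mv.subspace_0[OF coord_subspace])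
    have "Xa + 0 \<in> lie_algebra Ha"
    proof (rule lie_algebra_add_coord[OF fin(1) sub(1) _ in_coord(1) zero_in_lie_algebra[OF unit] zero])
      fix A d T assume A: "A \<in> Fa" and d: "norm (d :: 'f) < 1" and T: "T \<in> Ha"
      then have "A \<in> F1" "A \<in> F2" "A \<in> Pow {1..p + q + r}"
        using sub unfolding Fa_def by blast+
      then have "small_factor A d \<in> W1" "small_factor A d \<in> W2" "small_factor A d \<in> units p q r"
        unfolding W(1,2) using W(5,6) d by - (rule factor small_factor_unit; assumption)+
      then show "mul p q r (small_factor A d) T \<in> Ha"
        using T closed by (auto simp: Ha_def intro: units_mul)
    qed
    moreover have "Ha \<subseteq> Hb"
      using closed anti_involution_closed[OF \<alpha>, of _ F1] by (auto simp: Ha_def Hb_def W)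
    ultimately have a: "Xa + 0 \<in> lie_algebra Hb" using lie_algebra_mono by blast
    have cla: "Xa + 0 \<in> cl p q r" using cl by simp
    have "Xb + (Xa + 0) \<in> lie_algebra Hb"
    proof (rule lie_algebra_add_coord[OF fin(2) sub(2) _ in_coord(2) a cla])
      fix A d T assume A: "A \<in> Fb" and d: "norm (d :: 'f) < 1" and T: "T \<in> Hb"
      then have "A \<in> F2" "A \<in> Pow {1..p + q + r}"
        using sub unfolding Fb_def by blast+
      then have "small_factor A d \<in> W2" "small_factor A d \<in> units p q r"
        unfolding W(2) using W(6) d by - (rule factor small_factor_unit; assumption)+
      moreover have "mul p q r (\<alpha> (mul p q r (small_factor A d) T)) (mul p q r (small_factor A d) T) \<in> coord F1"
        using A T sub ucl by (intro norm_skew_factor[OF \<alpha>]) (auto simp: Fb_def Hb_def W)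
      ultimately show "mul p q r (small_factor A d) T \<in> Hb"
        using T closed by (auto simp: Hb_def W intro: units_mul)
    qed
    moreover have "Hb \<subseteq> ?G"
      using closed anti_involution_closed[OF \<beta>, of _ F2] by (auto simp: Hb_def W)
    ultimately have b: "Xb + (Xa + 0) \<in> lie_algebra ?G" using lie_algebra_mono by blast
    have clb: "Xb + (Xa + 0) \<in> cl p q r" using cl(2) cla unfolding cl_eq_coord by (rule add_closed)
    have "Xc + (Xb + (Xa + 0)) \<in> lie_algebra ?G"
    proof (rule lie_algebra_add_coord[OF fin(3) sub(3) _ in_coord(3) b clb])
      fix A d T assume A: "A \<in> Fc" and d: "norm (d :: 'f) < 1" and T: "T \<in> ?G"
      then have "small_factor A d \<in> units p q r"
        using sub by (intro small_factor_unit) blast+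
      moreover have "mul p q r (\<alpha> (mul p q r (small_factor A d) T)) (mul p q r (small_factor A d) T) \<in> coord F1"
        using A T sub ucl by (intro norm_skew_factor[OF \<alpha>]) (auto simp: Fc_def W)
      moreover have "mul p q r (\<beta> (mul p q r (small_factor A d) T)) (mul p q r (small_factor A d) T) \<in> coord F2"
        using A T sub ucl by (intro norm_skew_factor[OF \<beta>]) (auto simp: Fc_def W)
      ultimately show "mul p q r (small_factor A d) T \<in> ?G"
        using T by (auto simp: W intro: units_mul)
    qed
    then show "X \<in> lie_algebra ?G" using split by simp
  qed
qed

text \<open>
  The two involutions may be exchanged, so the order condition is required for one of them only.
\<close>

lemma lie_algebra_norm_group:
  fixes W1 W2 :: "'f::{real_normed_field,banach} mv set"
  assumes W1: "coord_subalgebra p q r W1 F1" and W2: "coord_subalgebra p q r W2 F2"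
    and ord: "(\<forall>A\<in>F1. card A mod 4 = 1 \<longrightarrow> A \<in> F2) \<or> (\<forall>A\<in>F2. card A mod 4 = 3 \<longrightarrow> A \<in> F1)"
  shows "lie_algebra {T \<in> units p q r. rev_norm p q r T \<in> W1 \<and> conj_norm p q r T \<in> W2} =
    coord {A \<in> Pow {1..p + q + r}. (card A mod 4 = 0 \<or> card A mod 4 = 1 \<longrightarrow> A \<in> F1) \<and>
      (card A mod 4 = 0 \<or> card A mod 4 = 3 \<longrightarrow> A \<in> F2)}"
  using ord
proof
  assume "\<forall>A\<in>F1. card A mod 4 = 1 \<longrightarrow> A \<in> F2"
  then show ?thesis
    using lie_algebra_norm_group_aux[OF anti_involution_reversion anti_involution_conjugation W1 W2]
    by simp
next
  assume "\<forall>A\<in>F2. card A mod 4 = 3 \<longrightarrow> A \<in> F1"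
  then show ?thesis
    using lie_algebra_norm_group_aux[OF anti_involution_conjugation anti_involution_reversion W2 W1]
    by (simp add: conj_commute)
qed

section \<open>Centralizers and the types of basis elements\<close>

lemma blade_coeff_commute_iff:
  assumes "A \<in> Pow {1..p + q + r}" "B \<in> Pow {1..p + q + r}"
  shows "(-1) ^ k * blade_coeff p q A B = (blade_coeff p q B A :: 'f::real_normed_field) \<longleftrightarrow>
    (A \<inter> B \<subseteq> {1..p + q} \<longrightarrow> even (card A * card B + card (A \<inter> B) + k))"
proof -
  let ?c = "blade_coeff p q A B :: 'f"
  have fin: "finite A" "finite B" using assms by (auto intro: finite_subset)
  have "blade_coeff p q B A = (-1) ^ (card A * card B + card (A \<inter> B)) * ?c"
    by (rule blade_coeff_swap[OF fin])
  moreover have "?c \<noteq> 0 \<longleftrightarrow> A \<inter> B \<subseteq> {1..p + q}"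
    using assms by (intro blade_coeff_nonzero_iff) simp
  moreover have "(-1 :: 'f) \<noteq> 1" by simp
  ultimately show ?thesis
    by (cases "?c = 0") (auto simp: minus_one_power_iff)
qed

text \<open>
  Multiplication by \<open>e\<^sub>B\<close> maps different basis elements to multiples of different basis elements.
  Therefore no cancellation is possible and commuting with \<open>e\<^sub>B\<close> is a condition on each
  coordinate separately.
\<close>

lemma twisted_centralizer_eq:
  fixes s :: "nat set \<Rightarrow> 'f::field"
  shows "{X \<in> cl p q r. \<forall>V\<in>grade p q r m. mul p q r (\<lambda>A. s A * X A) V = mul p q r V X} =
    coord {A \<in> Pow {1..p + q + r}. \<forall>B\<in>Pow {1..p + q + r}. int (card B) = m \<longrightarrow>
      s A * blade_coeff p q A B = blade_coeff p q B A}" (is "?L = coord ?F")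
proof (rule set_eqI)
  fix X :: "'f mv"
  have eq: "(\<forall>V\<in>grade p q r m. mul p q r (\<lambda>A. s A * X A) V = mul p q r V X) \<longleftrightarrow>
      (\<forall>B\<in>Pow {1..p + q + r}. int (card B) = m \<longrightarrow>
        mul p q r (\<lambda>A. s A * X A) (blade B) = mul p q r (blade B) X)" (is "?P \<longleftrightarrow> ?Q")
  proof
    show "?P \<Longrightarrow> ?Q"
      unfolding grade_def blade_span_def by (auto intro!: mv.span_base)
    assume Q: ?Q
    have sub: "mv.subspace {V. mul p q r (\<lambda>A. s A * X A) V = mul p q r V X}"
    proof (rule mv.subspaceI)
      have "mul p q r x (0 :: 'f mv) = 0" "mul p q r 0 x = (0 :: 'f mv)" for x
        by (simp_all add: mul_def fun_eq_iff cong: if_cong)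
      then show "0 \<in> {V. mul p q r (\<lambda>A. s A * X A) V = mul p q r V X}" by simp
    qed (simp_all only: mem_Collect_eq mul_add_left mul_add_right mul_scale_left mul_scale_right)
    have "grade p q r m \<subseteq> {V. mul p q r (\<lambda>A. s A * X A) V = mul p q r V X}"
      unfolding grade_def blade_span_def
      by (rule mv.span_minimal[OF _ sub]) (use Q in auto)
    then show ?P by auto
  qed
  have inner: "(mul p q r (\<lambda>A. s A * X A) (blade B) = mul p q r (blade B) X) \<longleftrightarrow>
      (\<forall>A\<in>Pow {1..p + q + r}. X A \<noteq> 0 \<longrightarrow> s A * blade_coeff p q A B = blade_coeff p q B A)"
    (is "?l = ?r \<longleftrightarrow> ?c") if B: "B \<in> Pow {1..p + q + r}" for B
  proof -
    have *: "?l (sym_diff A B) = ?r (sym_diff A B) \<longleftrightarrow> (X A \<noteq> 0 \<longrightarrow> s A * blade_coeff p q A B = blade_coeff p q B A)"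
      if "A \<in> Pow {1..p + q + r}" for A
      unfolding mul_blade_right_apply[OF that B] mul_blade_left_apply[OF that B]
      by (cases "X A = 0") (simp_all add: mult.commute[of "s A"] mult.assoc[symmetric])
    show ?thesis
    proof
      assume "?l = ?r" then show ?c using * by metis
    next
      assume c: ?c
      show "?l = ?r"
      proof
        fix C
        show "?l C = ?r C"
        proof (cases "C \<in> Pow {1..p + q + r}")
          case True
          define A where "A = sym_diff C B"
          have "A \<in> Pow {1..p + q + r}" unfolding A_def by (rule sym_diff_Pow[OF True B])
          moreover have "C = sym_diff A B" by (auto simp: A_def)
          ultimately show ?thesis using * c by blast
        next
          case False
          have "mul p q r u v C = 0" for u v :: "'f mv"
            using False mul_closed[of p q r u v] unfolding cl_def by blast
          then show ?thesis by simp
        qed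
      qed
    qed
  qed
  have "?P \<longleftrightarrow> (\<forall>B\<in>Pow {1..p + q + r}. int (card B) = m \<longrightarrow>
      (\<forall>A\<in>Pow {1..p + q + r}. X A \<noteq> 0 \<longrightarrow> s A * blade_coeff p q A B = blade_coeff p q B A))"
    unfolding eq by (intro ball_cong refl imp_cong inner)
  then show "X \<in> ?L \<longleftrightarrow> X \<in> coord ?F"
    unfolding cl_def coord_def by blast
qed

text \<open>
  The type of a basis element is the pair of its numbers of non-null and null generators.
\<close>

definition type_sets :: "nat \<Rightarrow> nat \<Rightarrow> nat \<Rightarrow> (nat \<Rightarrow> nat \<Rightarrow> bool) \<Rightarrow> nat set set" where
  "type_sets p q r P =
     {A \<in> Pow {1..p + q + r}. P (card (A \<inter> {1..p + q})) (card (A - {1..p + q}))}"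

text \<open>
  The index \<open>i\<close> is the number of common generators of a basis element of type \<open>(a, b)\<close> and one of
  grade \<open>m\<close> with which it has a nonzero product: these \<open>i\<close> generators are non-null, and the other
  \<open>m - i\<close> ones have to be found among the generators outside.
\<close>

definition commuting_type :: "nat \<Rightarrow> nat \<Rightarrow> bool \<Rightarrow> nat \<Rightarrow> nat \<Rightarrow> bool" where
  "commuting_type n m twisted a b \<longleftrightarrow> (\<forall>i\<le>m. i \<le> a \<and> m - i + (a + b) \<le> n \<longrightarrow>
     even ((a + b) * m + i + (if twisted then a + b else 0)))"

lemma card_split:
  fixes A :: "nat set"
  assumes "A \<in> Pow {1..p + q + r}"
  shows "card A = card (A \<inter> {1..p + q}) + card (A - {1..p + q})"
  using assms by (intro card_Int_Diff) (auto intro: finite_subset)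

lemma commuting_type_iff:
  assumes A: "A \<in> Pow {1..p + q + r}"
  shows "(\<forall>B\<in>Pow {1..p + q + r}. int (card B) = int m \<longrightarrow> A \<inter> B \<subseteq> {1..p + q} \<longrightarrow>
      even (card A * card B + card (A \<inter> B) + (if twisted then card A else 0))) \<longleftrightarrow>
    commuting_type (p + q + r) m twisted (card (A \<inter> {1..p + q})) (card (A - {1..p + q}))"
    (is "?L \<longleftrightarrow> ?R")
proof
  let ?n = "p + q + r" and ?I = "{1..p + q + r}"
  have fin: "finite A" using A by (auto intro: finite_subset)
  note cA = card_split[OF A]
  have compl: "card (?I - A) + card A = ?n"
    using A fin by (simp add: card_Diff_subset card_mono[of ?I A, simplified])
  show ?R if L: ?L
    unfolding commuting_type_def cA[symmetric]
  proof (intro allI impI)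
    fix i assume i: "i \<le> m" "i \<le> card (A \<inter> {1..p + q}) \<and> m - i + card A \<le> ?n"
    obtain B1 where B1: "B1 \<subseteq> A \<inter> {1..p + q}" "card B1 = i" "finite B1"
      using i obtain_subset_with_card_n by metis
    have "m - i \<le> card (?I - A)" using i(2) compl by linarith
    then obtain B2 where B2: "B2 \<subseteq> ?I - A" "card B2 = m - i" "finite B2"
      using obtain_subset_with_card_n by metis
    have "card (B1 \<union> B2) = card B1 + card B2" using B1 B2 by (intro card_Un_disjoint) auto
    then have c: "card (B1 \<union> B2) = m" using B1 B2 i by simp
    have int: "A \<inter> (B1 \<union> B2) = B1" using B1 B2 by auto
    have "B1 \<union> B2 \<in> Pow ?I" using B1 B2 A by auto
    with L c have "A \<inter> (B1 \<union> B2) \<subseteq> {1..p + q} \<longrightarrow>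
      even (card A * m + card (A \<inter> (B1 \<union> B2)) + (if twisted then card A else 0))"
      by auto
    then show "even (card A * m + i + (if twisted then card A else 0))"
      unfolding int using B1 by auto
  qed
  show ?L if R: ?R
  proof (intro ballI impI)
    fix B assume B: "B \<in> Pow ?I" "int (card B) = int m" "A \<inter> B \<subseteq> {1..p + q}"
    have finB: "finite B" using B by (auto intro: finite_subset)
    let ?i = "card (A \<inter> B)"
    have "?i \<le> card B" using finB by (intro card_mono) auto
    moreover have "?i \<le> card (A \<inter> {1..p + q})" using fin B by (intro card_mono) auto
    moreover have "card (B - A) \<le> card (?I - A)" using B by (intro card_mono) auto
    moreover have "card B = ?i + card (B - A)" using finB by (metis card_Int_Diff Int_commute)
    moreover have "card B = m" using B by simp
    ultimately have "?i \<le> m" "?i \<le> card (A \<inter> {1..p + q}) \<and> m - ?i + card A \<le> ?n"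
      using compl by simp_all
    with R have "even (card A * m + card (A \<inter> B) + (if twisted then card A else 0))"
      unfolding commuting_type_def cA[symmetric] by blast
    then show "even (card A * card B + card (A \<inter> B) + (if twisted then card A else 0))"
      using \<open>card B = m\<close> by (simp only:)
  qed
qed

lemma Z_eq: "Z p q r (int m) =
  (coord (type_sets p q r (commuting_type (p + q + r) m False)) :: 'f::real_normed_field mv set)"
proof -
  have "Z p q r (int m) = {X \<in> cl p q r. \<forall>V\<in>grade p q r (int m). mul p q r (\<lambda>A. (-1) ^ 0 * X A) V = mul p q r V (X :: 'f mv)}"
    unfolding Z_def by simp
  also have "\<dots> = coord {A \<in> Pow {1..p + q + r}. \<forall>B\<in>Pow {1..p + q + r}. int (card B) = int m \<longrightarrow>
      (-1) ^ 0 * blade_coeff p q A B = (blade_coeff p q B A :: 'f)}"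
    by (rule twisted_centralizer_eq)
  also have "{A \<in> Pow {1..p + q + r}. \<forall>B\<in>Pow {1..p + q + r}. int (card B) = int m \<longrightarrow>
      (-1) ^ 0 * blade_coeff p q A B = (blade_coeff p q B A :: 'f)} =
      type_sets p q r (commuting_type (p + q + r) m False)"
    unfolding type_sets_def
    by (intro Collect_cong)
       (simp only: commuting_type_iff[symmetric] blade_coeff_commute_iff if_False cong: conj_cong ball_cong)
  finally show ?thesis .
qed

lemma Zc_eq: "Zc p q r (int m) =
  (coord (type_sets p q r (commuting_type (p + q + r) m True)) :: 'f::real_normed_field mv set)"
proof -
  have "Zc p q r (int m) = {X \<in> cl p q r. \<forall>V\<in>grade p q r (int m). mul p q r (\<lambda>A. (-1) ^ card A * X A) V = mul p q r V (X :: 'f mv)}"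
    unfolding Zc_def involution_def by simp
  also have "\<dots> = coord {A \<in> Pow {1..p + q + r}. \<forall>B\<in>Pow {1..p + q + r}. int (card B) = int m \<longrightarrow>
      (-1) ^ card A * blade_coeff p q A B = (blade_coeff p q B A :: 'f)}"
    by (rule twisted_centralizer_eq)
  also have "{A \<in> Pow {1..p + q + r}. \<forall>B\<in>Pow {1..p + q + r}. int (card B) = int m \<longrightarrow>
      (-1) ^ card A * blade_coeff p q A B = (blade_coeff p q B A :: 'f)} =
      type_sets p q r (commuting_type (p + q + r) m True)"
    unfolding type_sets_def
    by (intro Collect_cong)
       (simp only: commuting_type_iff[symmetric] blade_coeff_commute_iff if_True cong: conj_cong ball_cong)
  finally show ?thesis .
qed

lemma type_sets_Int: "type_sets p q r P \<inter> type_sets p q r Q = type_sets p q r (\<lambda>a b. P a b \<and> Q a b)"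
  by (auto simp: type_sets_def)

lemma finite_type_sets [simp]: "finite (type_sets p q r P)"
  by (simp add: type_sets_def)

lemma blade_span_eq: "finite S \<Longrightarrow> blade_span S k = coord {A. A \<subseteq> S \<and> int (card A) = k}"
  unfolding blade_span_def by (rule coord_eq_span[symmetric]) simp

lemma type_sets_total: "type_sets p q r (\<lambda>a b. P (a + b)) = {A. A \<subseteq> {1..p + q + r} \<and> P (card A)}"
  unfolding type_sets_def using card_split[of _ p q r] by auto

lemma type_sets_null:
  "type_sets p q r (\<lambda>a b. a = 0 \<and> P b) = {A. A \<subseteq> {p + q + 1..p + q + r} \<and> P (card A)}"
    (is "?R = ?L")
proof (rule set_eqI)
  fix A
  show "A \<in> ?R \<longleftrightarrow> A \<in> ?L"
  proof
    assume A: "A \<in> ?L"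
    then have "A \<subseteq> {p + q + 1..p + q + r}" by simp
    then have "A \<inter> {1..p + q} = {}" by force
    moreover from this have "A - {1..p + q} = A" by blast
    ultimately show "A \<in> ?R" using A by (auto simp: type_sets_def)
  next
    assume A: "A \<in> ?R"
    then have sub: "A \<subseteq> {1..p + q + r}" and "card (A \<inter> {1..p + q}) = 0" by (auto simp: type_sets_def)
    then have e: "A \<inter> {1..p + q} = {}" by simp
    then have "A - {1..p + q} = A" by blast
    moreover have "A \<subseteq> {p + q + 1..p + q + r}"
    proof
      fix x assume "x \<in> A"
      then have "x \<in> {1..p + q + r}" "x \<notin> {1..p + q}" using sub e by blast+
      then show "x \<in> {p + q + 1..p + q + r}" by simp
    qed
    ultimately show "A \<in> ?L" using A by (auto simp: type_sets_def)
  qed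
qed

lemma grade_eq: "grade p q r k = coord (type_sets p q r (\<lambda>a b. int (a + b) = k))"
  by (simp only: type_sets_total[of p q r "\<lambda>m. int m = k"] grade_def blade_span_eq finite_atLeastAtMost)

lemma grassmann_eq: "grassmann p q r k = coord (type_sets p q r (\<lambda>a b. a = 0 \<and> int b = k))"
  by (simp only: type_sets_null[of p q r "\<lambda>m. int m = k"] grassmann_def blade_span_eq finite_atLeastAtMost)

lemma nondegenerate_eq: "nondegenerate p q k = coord (type_sets p q r (\<lambda>a b. int a = k \<and> b = 0))"
proof -
  have "{A. A \<subseteq> {1..p + q} \<and> int (card A) = k} = type_sets p q r (\<lambda>a b. int a = k \<and> b = 0)"
    (is "?L = ?R")
  proof (rule set_eqI)
    fix A
    show "A \<in> ?L \<longleftrightarrow> A \<in> ?R"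
    proof
      assume A: "A \<in> ?L"
      then have e: "A \<inter> {1..p + q} = A" "A - {1..p + q} = {}" by auto
      show "A \<in> ?R" using A unfolding type_sets_def mem_Collect_eq e by auto
    next
      assume A: "A \<in> ?R"
      then have sub: "A \<subseteq> {1..p + q + r}" and c: "card (A - {1..p + q}) = 0" by (auto simp: type_sets_def)
      have "finite A" using sub finite_subset by blast
      with c have "A - {1..p + q} = {}" by simp
      moreover from this have "A \<inter> {1..p + q} = A" by blast
      ultimately show "A \<in> ?L" using A by (auto simp: type_sets_def)
    qed
  qed
  then show ?thesis by (simp add: nondegenerate_def blade_span_eq)
qed

text \<open>
  The factors live on disjoint sets of generators, so the product of two basis elements is again one,
  up to a sign.
\<close>

lemma mixed_eq: "mixed p q r k l =
  (coord (type_sets p q r (\<lambda>a b. int a = k \<and> int b = l)) :: 'f::field mv set)"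
  (is "_ = coord ?F")
proof
  let ?U = "type_sets p q r (\<lambda>a b. int a = k \<and> b = 0)" and ?V = "type_sets p q r (\<lambda>a b. a = 0 \<and> int b = l)"
  have disj: "B \<inter> {1..p + q} = {} \<and> A - {1..p + q} = {}" if "A \<in> ?U" "B \<in> ?V" for A B
  proof -
    have "finite A" using that by (auto simp: type_sets_def intro: finite_subset)
    then show ?thesis using that by (simp add: type_sets_def)
  qed
  show "mixed p q r k l \<subseteq> (coord ?F :: 'f mv set)"
    unfolding mixed_def
  proof (rule mv.span_minimal[OF _ coord_subspace], safe)
    fix x y :: "'f mv" assume "x \<in> nondegenerate p q k" "y \<in> grassmann p q r l"
    then have xy: "x \<in> coord ?U" "y \<in> coord ?V"
      by (simp_all add: nondegenerate_eq[of p q k r] grassmann_eq)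
    show "mul p q r x y \<in> coord ?F"
      unfolding coord_def
    proof (intro CollectI allI impI)
      fix C assume "mul p q r x y C \<noteq> 0"
      then obtain A B where AB: "x A \<noteq> 0" "y B \<noteq> 0" "C = sym_diff A B"
        by (rule mul_nonzeroD)
      then have m: "A \<in> ?U" "B \<in> ?V" using xy by (auto simp: coord_def)
      have "C \<inter> {1..p + q} = A \<inter> {1..p + q}" "C - {1..p + q} = B - {1..p + q}"
        using disj[OF m] unfolding AB(3) by blast+
      moreover have "C \<in> Pow {1..p + q + r}"
        using m unfolding AB(3) type_sets_def by (intro sym_diff_Pow) auto
      ultimately show "C \<in> ?F" using m unfolding type_sets_def by auto
    qed
  qed
  show "(coord ?F :: 'f mv set) \<subseteq> mixed p q r k l"
    unfolding coord_eq_span[OF finite_type_sets]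
  proof (rule mv.span_minimal)
    show "mv.subspace (mixed p q r k l)" unfolding mixed_def by (rule mv.subspace_span)
    show "blade ` ?F \<subseteq> (mixed p q r k l :: 'f mv set)"
    proof safe
      fix C assume C: "C \<in> ?F"
      define A where "A = C \<inter> {1..p + q}"
      define B where "B = C - {1..p + q}"
      have AB: "A \<in> ?U" "B \<in> ?V"
      proof -
        have e: "A \<inter> {1..p + q} = A" "A - {1..p + q} = {}" "B \<inter> {1..p + q} = {}" "B - {1..p + q} = B"
          by (auto simp: A_def B_def)
        show "A \<in> ?U" "B \<in> ?V"
          using C unfolding type_sets_def mem_Collect_eq e by (auto simp: A_def B_def)
      qed
      have "A \<inter> B = {}" "sym_diff A B = C" by (auto simp: A_def B_def)
      moreover have sub: "A \<subseteq> {1..p + q + r}" "B \<subseteq> {1..p + q + r}"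
        using AB by (auto simp: type_sets_def)
      ultimately have eq: "mul p q r (blade A) (blade B) = scale_mv (blade_coeff p q A B) (blade C :: 'f mv)"
        and nz: "blade_coeff p q A B \<noteq> (0 :: 'f)"
        by (simp_all add: mul_blade blade_coeff_nonzero_iff)
      have "blade C = scale_mv (inverse (blade_coeff p q A B)) (mul p q r (blade A) (blade B) :: 'f mv)"
        unfolding eq using nz by (simp add: scale_mv_def mult.assoc[symmetric])
      also have "\<dots> \<in> mixed p q r k l"
      proof -
        have "(blade A :: 'f mv) \<in> nondegenerate p q k" "(blade B :: 'f mv) \<in> grassmann p q r l"
          using AB by (simp_all add: nondegenerate_eq[of p q k r] grassmann_eq blade_in_coord)
        then show ?thesis unfolding mixed_def by (blast intro: mv.span_scale mv.span_base)
      qed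
      finally show "(blade C :: 'f mv) \<in> mixed p q r k l" .
    qed
  qed
qed

lemma type_sets_UN: "(\<Union>k\<in>K. type_sets p q r (P k)) = type_sets p q r (\<lambda>a b. \<exists>k\<in>K. P k a b)"
  by (auto simp: type_sets_def)

lemma grade_mod4_eq: "grade_mod4 p q r K = coord (type_sets p q r (\<lambda>a b. int (a + b) mod 4 \<in> K))"
proof -
  have "grade_mod4 p q r K = coord (\<Union>k\<in>{k. k mod 4 \<in> K}. type_sets p q r (\<lambda>a b. int (a + b) = k))"
    unfolding grade_mod4_def by (rule span_Union_coord[OF grade_eq]) (simp only: type_sets_UN finite_type_sets)
  then show ?thesis unfolding type_sets_UN by simp
qed

lemma grassmann_mod4_eq: "grassmann_mod4 p q r K = coord (type_sets p q r (\<lambda>a b. a = 0 \<and> int b mod 4 \<in> K))"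
proof -
  have "grassmann_mod4 p q r K = coord (\<Union>k\<in>{k. k mod 4 \<in> K}. type_sets p q r (\<lambda>a b. a = 0 \<and> int b = k))"
    unfolding grassmann_mod4_def by (rule span_Union_coord[OF grassmann_eq]) (simp only: type_sets_UN finite_type_sets)
  also have "(\<lambda>a b. \<exists>k\<in>{k. k mod 4 \<in> K}. a = 0 \<and> int b = k) = (\<lambda>a b. a = (0::nat) \<and> int b mod 4 \<in> K)"
    by auto
  ultimately show ?thesis unfolding type_sets_UN by simp
qed

lemma even_part_eq: "even_part p q r = coord (type_sets p q r (\<lambda>a b. even (a + b)))"
proof -
  have "even_part p q r = coord (\<Union>k\<in>{k. even k}. type_sets p q r (\<lambda>a b. int (a + b) = k))"
    unfolding even_part_def by (rule span_Union_coord[OF grade_eq]) (simp only: type_sets_UN finite_type_sets)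
  then show ?thesis unfolding type_sets_UN by simp
qed

section \<open>The groups and their tangent spaces\<close>

lemma coord_subalgebraI:
  assumes "W = (coord (type_sets p q r P) :: 'f::field mv set)" "P 0 0"
    and "\<And>x y. x \<in> W \<Longrightarrow> y \<in> W \<Longrightarrow> mul p q r x y \<in> W"
  shows "coord_subalgebra p q r W (type_sets p q r P)"
  using assms by (auto simp: coord_subalgebra_def type_sets_def)

lemma cl_eq_types: "cl p q r = coord (type_sets p q r (\<lambda>a b. True))"
  unfolding cl_eq_coord type_sets_def by (rule arg_cong[where f = coord]) auto

lemma coord_subalgebra_cl:
  "coord_subalgebra p q r (cl p q r) (type_sets p q r (\<lambda>a b. True))"
  by (rule coord_subalgebraI) (auto simp: cl_eq_types[symmetric] mul_closed)

lemma coord_subalgebra_Z: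
  "coord_subalgebra p q r (Z p q r (int m) :: 'f::real_normed_field mv set)
    (type_sets p q r (commuting_type (p + q + r) m False))"
proof (rule coord_subalgebraI[OF Z_eq])
  show "commuting_type (p + q + r) m False 0 0" by (simp add: commuting_type_def)
  fix x y :: "'f mv" assume x: "x \<in> Z p q r (int m)" and y: "y \<in> Z p q r (int m)"
  show "mul p q r x y \<in> Z p q r (int m)"
    unfolding Z_def
  proof (intro CollectI conjI ballI mul_closed)
    fix V :: "'f mv" assume V: "V \<in> grade p q r (int m)"
    then have "mul p q r y V = mul p q r V y" "mul p q r x V = mul p q r V x"
      using x y by (auto simp: Z_def)
    then show "mul p q r (mul p q r x y) V = mul p q r V (mul p q r x y)"
      by (metis mul_assoc)
  qed
qed

text \<open>
  The grade involution is multiplicative, so the twisted centralizer is also closed under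
  multiplication: \<open>(X Y)\<^sup>^ V = X\<^sup>^ Y\<^sup>^ V = X\<^sup>^ V Y = V X Y\<close>.
\<close>

lemma coord_subalgebra_Zc:
  "coord_subalgebra p q r (Zc p q r (int m) :: 'f::real_normed_field mv set)
    (type_sets p q r (commuting_type (p + q + r) m True))"
proof (rule coord_subalgebraI[OF Zc_eq])
  show "commuting_type (p + q + r) m True 0 0" by (simp add: commuting_type_def)
  fix x y :: "'f mv" assume x: "x \<in> Zc p q r (int m)" and y: "y \<in> Zc p q r (int m)"
  show "mul p q r x y \<in> Zc p q r (int m)"
    unfolding Zc_def
  proof (intro CollectI conjI ballI mul_closed)
    fix V :: "'f mv" assume V: "V \<in> grade p q r (int m)"
    then have "mul p q r (involution y) V = mul p q r V y" "mul p q r (involution x) V = mul p q r V x"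
      using x y by (auto simp: Zc_def)
    then show "mul p q r (involution (mul p q r x y)) V = mul p q r V (mul p q r x y)"
      unfolding involution_mul by (metis mul_assoc)
  qed
qed

lemma coord_subalgebra_even_part:
  "coord_subalgebra p q r (even_part p q r :: 'f::real_normed_field mv set) (type_sets p q r (\<lambda>a b. even (a + b)))"
proof (rule coord_subalgebraI[OF even_part_eq])
  have eq: "even_part p q r = {x \<in> cl p q r. involution x = (x :: 'f mv)}"
  proof (rule set_eqI)
    fix x :: "'f mv"
    have "involution x A = x A \<longleftrightarrow> (x A \<noteq> 0 \<longrightarrow> even (card A))" for A
      by (auto simp: involution_def minus_one_power_iff)
    then have "involution x = x \<longleftrightarrow> (\<forall>A. x A \<noteq> 0 \<longrightarrow> even (card A))"
      by (simp add: fun_eq_iff)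
    then show "x \<in> even_part p q r \<longleftrightarrow> x \<in> {x \<in> cl p q r. involution x = x}"
      unfolding even_part_eq coord_def type_sets_def cl_def
      using card_split[of _ p q r] by (auto; metis PowI)
  qed
  show "mul p q r x y \<in> even_part p q r"
    if "x \<in> even_part p q r" "y \<in> even_part p q r" for x y :: "'f mv"
    using that unfolding eq by (simp add: mul_closed involution_mul)
qed simp

lemma coord_subalgebra_Int:
  assumes "coord_subalgebra p q r W (type_sets p q r P)" "coord_subalgebra p q r W' (type_sets p q r P')"
  shows "coord_subalgebra p q r (W \<inter> W') (type_sets p q r (\<lambda>a b. P a b \<and> P' a b))"
  using assms unfolding coord_subalgebra_def type_sets_Int[symmetric] by (auto simp: coord_Int)

definition norm_group :: "nat \<Rightarrow> nat \<Rightarrow> nat \<Rightarrow> 'f::field mv set \<Rightarrow> 'f mv set \<Rightarrow> 'f mv set" where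
  "norm_group p q r W1 W2 =
     {T \<in> units p q r. rev_norm p q r T \<in> W1 \<and> conj_norm p q r T \<in> W2}"

text \<open>
  The norm of an invertible element is invertible, so only membership in the subspace matters.
\<close>

lemma norm_in_inv_elems_iff:
  assumes "T \<in> units p q r"
  shows "rev_norm p q r T \<in> inv_elems p q r H \<longleftrightarrow> rev_norm p q r T \<in> H"
    and "conj_norm p q r T \<in> inv_elems p q r H \<longleftrightarrow> conj_norm p q r T \<in> H"
  using units_mul[OF units_reversion[OF assms] assms] units_mul[OF units_conjugation[OF assms] assms]
  by (auto simp: inv_elems_def)

lemma groups_as_norm_groups:
  "A01 p q r = norm_group p q r (Z p q r 1) (cl p q r)"
  "A23 p q r = norm_group p q r (Z p q r 2 \<inter> Z p q r 3) (cl p q r)"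
  "A12c p q r = norm_group p q r (Zc p q r 1 \<inter> Zc p q r 2) (cl p q r)"
  "A03c p q r = norm_group p q r (Z p q r 3 \<inter> even_part p q r) (cl p q r)"
  "B12 p q r = norm_group p q r (cl p q r) (Z p q r 1)"
  "B03 p q r = norm_group p q r (cl p q r) (Z p q r 3)"
  "B01c p q r = norm_group p q r (cl p q r) (Z p q r 1 \<inter> even_part p q r)"
  "B23c p q r = norm_group p q r (cl p q r) (Zc p q r 2 \<inter> Zc p q r 3)"
  "Q01 p q r = norm_group p q r (Z p q r 4) (Zc p q r 1)"
  "Q23 p q r = norm_group p q r (Z p q r 2) (Zc p q r 3)"
  "Q12 p q r = norm_group p q r (Zc p q r 1) (Z p q r 2)"
  "Q03 p q r = norm_group p q r (Zc p q r 3) (Z p q r 4)"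
  unfolding A01_def A23_def A12c_def A03c_def B12_def B03_def B01c_def B23c_def Q01_def Q23_def
    Q12_def Q03_def norm_group_def
  by (auto simp: norm_in_inv_elems_iff mul_closed)

definition tangent_type :: "(nat \<Rightarrow> nat \<Rightarrow> bool) \<Rightarrow> (nat \<Rightarrow> nat \<Rightarrow> bool) \<Rightarrow> nat \<Rightarrow> nat \<Rightarrow> bool" where
  "tangent_type P1 P2 a b \<longleftrightarrow>
     ((a + b) mod 4 = 0 \<or> (a + b) mod 4 = 1 \<longrightarrow> P1 a b) \<and>
     ((a + b) mod 4 = 0 \<or> (a + b) mod 4 = 3 \<longrightarrow> P2 a b)"

lemma card_bounds:
  assumes "A \<in> Pow {1..p + q + r}"
  shows "card (A \<inter> {1..p + q}) \<le> p + q" "card (A - {1..p + q}) \<le> r"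
proof -
  show "card (A \<inter> {1..p + q}) \<le> p + q"
    using card_mono[of "{1..p + q}" "A \<inter> {1..p + q}"] by simp
  have "A - {1..p + q} \<subseteq> {p + q + 1..p + q + r}"
  proof
    fix x assume "x \<in> A - {1..p + q}"
    then have "x \<in> {1..p + q + r}" "x \<notin> {1..p + q}" using assms by blast+
    then show "x \<in> {p + q + 1..p + q + r}" by simp
  qed
  from card_mono[OF _ this] show "card (A - {1..p + q}) \<le> r" by simp
qed

lemma lie_algebra_types:
  assumes W1: "coord_subalgebra p q r (W1 :: 'f::{real_normed_field,banach} mv set) (type_sets p q r P1)"
    and W2: "coord_subalgebra p q r W2 (type_sets p q r P2)"
    and ord: "(\<forall>a\<le>p + q. \<forall>b\<le>r. (a + b) mod 4 = 1 \<longrightarrow> P1 a b \<longrightarrow> P2 a b) \<or>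
      (\<forall>a\<le>p + q. \<forall>b\<le>r. (a + b) mod 4 = 3 \<longrightarrow> P2 a b \<longrightarrow> P1 a b)"
  shows "lie_algebra (norm_group p q r W1 W2) = coord (type_sets p q r (tangent_type P1 P2))"
proof -
  have "lie_algebra (norm_group p q r W1 W2) =
    coord {A \<in> Pow {1..p + q + r}. (card A mod 4 = 0 \<or> card A mod 4 = 1 \<longrightarrow> A \<in> type_sets p q r P1) \<and>
      (card A mod 4 = 0 \<or> card A mod 4 = 3 \<longrightarrow> A \<in> type_sets p q r P2)}"
    unfolding norm_group_def
  proof (rule lie_algebra_norm_group[OF W1 W2])
    show "(\<forall>A\<in>type_sets p q r P1. card A mod 4 = 1 \<longrightarrow> A \<in> type_sets p q r P2) \<or>
      (\<forall>A\<in>type_sets p q r P2. card A mod 4 = 3 \<longrightarrow> A \<in> type_sets p q r P1)"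
      using ord
    proof (rule disj_forward)
      assume *: "\<forall>a\<le>p + q. \<forall>b\<le>r. (a + b) mod 4 = 1 \<longrightarrow> P1 a b \<longrightarrow> P2 a b"
      show "\<forall>A\<in>type_sets p q r P1. card A mod 4 = 1 \<longrightarrow> A \<in> type_sets p q r P2"
        unfolding type_sets_def
      proof (intro ballI impI)
        fix A assume "A \<in> {A \<in> Pow {1..p + q + r}. P1 (card (A \<inter> {1..p + q})) (card (A - {1..p + q}))}"
          and c: "card A mod 4 = 1"
        then have A: "A \<in> Pow {1..p + q + r}" and P: "P1 (card (A \<inter> {1..p + q})) (card (A - {1..p + q}))"
          by auto
        show "A \<in> {A \<in> Pow {1..p + q + r}. P2 (card (A \<inter> {1..p + q})) (card (A - {1..p + q}))}"
          using *[rule_format, OF card_bounds[OF A] _ P] c A unfolding card_split[OF A] by blast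
      qed
    next
      assume *: "\<forall>a\<le>p + q. \<forall>b\<le>r. (a + b) mod 4 = 3 \<longrightarrow> P2 a b \<longrightarrow> P1 a b"
      show "\<forall>A\<in>type_sets p q r P2. card A mod 4 = 3 \<longrightarrow> A \<in> type_sets p q r P1"
        unfolding type_sets_def
      proof (intro ballI impI)
        fix A assume "A \<in> {A \<in> Pow {1..p + q + r}. P2 (card (A \<inter> {1..p + q})) (card (A - {1..p + q}))}"
          and c: "card A mod 4 = 3"
        then have A: "A \<in> Pow {1..p + q + r}" and P: "P2 (card (A \<inter> {1..p + q})) (card (A - {1..p + q}))"
          by auto
        show "A \<in> {A \<in> Pow {1..p + q + r}. P1 (card (A \<inter> {1..p + q})) (card (A - {1..p + q}))}"
          using *[rule_format, OF card_bounds[OF A] _ P] c A unfolding card_split[OF A] by blast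
      qed
    qed
  qed
  also have "{A \<in> Pow {1..p + q + r}. (card A mod 4 = 0 \<or> card A mod 4 = 1 \<longrightarrow> A \<in> type_sets p q r P1) \<and>
      (card A mod 4 = 0 \<or> card A mod 4 = 3 \<longrightarrow> A \<in> type_sets p q r P2)} =
      type_sets p q r (tangent_type P1 P2)"
    unfolding type_sets_def tangent_type_def
  proof (rule Collect_cong, rule conj_cong[OF refl])
    fix A assume A: "A \<in> Pow {1..p + q + r}"
    show "(card A mod 4 = 0 \<or> card A mod 4 = 1 \<longrightarrow> A \<in> {A \<in> Pow {1..p + q + r}. P1 (card (A \<inter> {1..p + q})) (card (A - {1..p + q}))}) \<and>
        (card A mod 4 = 0 \<or> card A mod 4 = 3 \<longrightarrow> A \<in> {A \<in> Pow {1..p + q + r}. P2 (card (A \<inter> {1..p + q})) (card (A - {1..p + q}))}) \<longleftrightarrow>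
      ((card (A \<inter> {1..p + q}) + card (A - {1..p + q})) mod 4 = 0 \<or> (card (A \<inter> {1..p + q}) + card (A - {1..p + q})) mod 4 = 1 \<longrightarrow>
         P1 (card (A \<inter> {1..p + q})) (card (A - {1..p + q}))) \<and>
      ((card (A \<inter> {1..p + q}) + card (A - {1..p + q})) mod 4 = 0 \<or> (card (A \<inter> {1..p + q}) + card (A - {1..p + q})) mod 4 = 3 \<longrightarrow>
         P2 (card (A \<inter> {1..p + q})) (card (A - {1..p + q})))"
      using A unfolding card_split[OF A] mem_Collect_eq by (simp only: simp_thms)
  qed
  finally show ?thesis .
qed

text \<open>
  Two basis elements with \<open>i\<close> common generators, all of them non-null, have a nonzero commutator iff
  they anticommute; it is then a multiple of the basis element of type \<open>(a + a' - 2 i, b + b')\<close>.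
\<close>

definition commutator_closed :: "nat \<Rightarrow> nat \<Rightarrow> (nat \<Rightarrow> nat \<Rightarrow> bool) \<Rightarrow> bool" where
  "commutator_closed s r P \<longleftrightarrow> (\<forall>a b a' b' i. i \<le> a \<longrightarrow> i \<le> a' \<longrightarrow> a + a' \<le> s + i \<longrightarrow> b + b' \<le> r \<longrightarrow>
     P a b \<longrightarrow> P a' b' \<longrightarrow> odd ((a + b) * (a' + b') + i) \<longrightarrow> P (a + a' - 2 * i) (b + b'))"

lemma lie_subalgebra_types:
  assumes closed: "commutator_closed (p + q) r P"
  shows "lie_subalgebra p q r (coord (type_sets p q r P) :: 'f::real_normed_field mv set)"
  unfolding lie_subalgebra_def
proof (intro conjI ballI coord_subspace)
  show "coord (type_sets p q r P) \<subseteq> (cl p q r :: 'f mv set)"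
    unfolding cl_eq_coord by (rule coord_mono) (auto simp: type_sets_def)
  fix X Y :: "'f mv" assume X: "X \<in> coord (type_sets p q r P)" and Y: "Y \<in> coord (type_sets p q r P)"
  let ?I = "{1..p + q + r}"
  show "mul p q r X Y - mul p q r Y X \<in> coord (type_sets p q r P)"
    unfolding coord_def
  proof (intro CollectI allI impI)
    fix C assume nz: "(mul p q r X Y - mul p q r Y X) C \<noteq> 0"
    have "mul p q r X Y C \<noteq> 0 \<or> mul p q r Y X C \<noteq> 0" using nz by auto
    then have C: "C \<in> Pow ?I"
      using mul_closed[of p q r X Y] mul_closed[of p q r Y X] unfolding cl_def by blast
    have swap: "mul p q r Y X C =
        (\<Sum>A\<in>Pow ?I. blade_coeff p q (sym_diff A C) A * Y (sym_diff A C) * X A)"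
      unfolding mul_apply[OF C]
    proof (rule sum.reindex_bij_witness[of _ "\<lambda>A. sym_diff A C" "\<lambda>A. sym_diff A C"])
      fix A
      have [simp]: "sym_diff (sym_diff A C) C = A" by blast
      show "blade_coeff p q (sym_diff (sym_diff A C) C) (sym_diff A C) * Y (sym_diff (sym_diff A C) C) * X (sym_diff A C) =
        blade_coeff p q A (sym_diff A C) * Y A * X (sym_diff A C)" by simp
    qed (use C in auto)
    have "(mul p q r X Y - mul p q r Y X) C = (\<Sum>A\<in>Pow ?I.
        (blade_coeff p q A (sym_diff A C) - blade_coeff p q (sym_diff A C) A) * X A * Y (sym_diff A C))"
      unfolding minus_apply swap unfolding mul_apply[OF C] sum_subtractf[symmetric]
      by (intro sum.cong refl) (simp add: algebra_simps)
    with nz obtain A where A: "A \<in> Pow ?I"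
      "(blade_coeff p q A (sym_diff A C) - blade_coeff p q (sym_diff A C) A) * X A * Y (sym_diff A C) \<noteq> 0"
      by (metis (no_types, lifting) sum.neutral)
    define B where "B = sym_diff A C"
    have CB: "C = sym_diff A B" by (auto simp: B_def)
    have B: "B \<in> Pow ?I" unfolding B_def by (rule sym_diff_Pow[OF A(1) C])
    have nz: "blade_coeff p q A B \<noteq> (blade_coeff p q B A :: 'f)" "X A \<noteq> 0" "Y B \<noteq> 0"
      using A(2) unfolding B_def[symmetric] by auto
    have AB: "A \<inter> B \<subseteq> {1..p + q}" "odd (card A * card B + card (A \<inter> B))"
      using nz(1) blade_coeff_commute_iff[OF A(1) B, where 'f='f and k = 0] by auto
    have P: "P (card (A \<inter> {1..p + q})) (card (A - {1..p + q}))" "P (card (B \<inter> {1..p + q})) (card (B - {1..p + q}))"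
      using nz X Y by (auto simp: coord_def type_sets_def)
    have fin: "finite A" "finite B" using A B by (auto intro: finite_subset)
    let ?S = "{1..p + q}"
    have i: "(A \<inter> ?S) \<inter> (B \<inter> ?S) = A \<inter> B" using AB(1) by blast
    have c1: "card (C \<inter> ?S) + 2 * card (A \<inter> B) = card (A \<inter> ?S) + card (B \<inter> ?S)"
    proof -
      have "C \<inter> ?S = sym_diff (A \<inter> ?S) (B \<inter> ?S)" unfolding CB by blast
      then show ?thesis using card_sym_diff[of "A \<inter> ?S" "B \<inter> ?S"] fin unfolding i by simp
    qed
    have c2: "card (C - ?S) = card (A - ?S) + card (B - ?S)"
    proof -
      have "C - ?S = (A - ?S) \<union> (B - ?S)" unfolding CB using AB(1) by blast
      moreover have "(A - ?S) \<inter> (B - ?S) = {}" using AB(1) by blast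
      ultimately show ?thesis using fin by (simp add: card_Un_disjoint)
    qed
    have le1: "card (A \<inter> ?S) + card (B \<inter> ?S) \<le> p + q + card (A \<inter> B)"
    proof -
      have "card (A \<inter> ?S) + card (B \<inter> ?S) = card ((A \<inter> ?S) \<union> (B \<inter> ?S)) + card (A \<inter> B)"
        using card_Un_Int[of "A \<inter> ?S" "B \<inter> ?S"] fin unfolding i by simp
      moreover have "card ((A \<inter> ?S) \<union> (B \<inter> ?S)) \<le> card ?S" by (intro card_mono) auto
      ultimately show ?thesis by simp
    qed
    have le2: "card (A - ?S) + card (B - ?S) \<le> r"
      using card_bounds(2)[OF C] c2 by simp
    have le: "card (A \<inter> B) \<le> card (A \<inter> ?S)" "card (A \<inter> B) \<le> card (B \<inter> ?S)"
      using AB(1) fin by (auto intro!: card_mono)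
    have "P (card (A \<inter> ?S) + card (B \<inter> ?S) - 2 * card (A \<inter> B)) (card (A - ?S) + card (B - ?S))"
      using closed[unfolded commutator_closed_def, rule_format, OF le le1 le2 P] AB(2)
      unfolding card_split[OF A(1), symmetric] card_split[OF B, symmetric] by blast
    moreover have "card (A \<inter> ?S) + card (B \<inter> ?S) - 2 * card (A \<inter> B) = card (C \<inter> ?S)"
      using c1 by simp
    ultimately show "C \<in> type_sets p q r P"
      using C unfolding type_sets_def c2[symmetric] by simp
  qed
qed

lemma direct_sum_coord:
  assumes "sorted_wrt (\<lambda>F G. F \<inter> G = {}) Fs"
  shows "is_direct_sum (coord (\<Union>(set Fs))) (map coord Fs :: 'f::field mv set list)"
proof -
  have "(\<forall>x::'f mv. x \<in> coord (\<Union>(set Fs)) \<longleftrightarrow> (\<exists>xs. x = sum_list xs \<and> list_all2 (\<in>) xs (map coord Fs))) \<and>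
    (\<forall>xs. list_all2 (\<in>) xs (map coord Fs :: 'f mv set list) \<and> sum_list xs = 0 \<longrightarrow> (\<forall>x\<in>set xs. x = 0))"
    using assms
  proof (induction Fs)
    case Nil
    have "x = 0" if "x \<in> coord {}" for x :: "'f mv" using that by (auto simp: coord_def)
    moreover have "0 \<in> (coord {} :: 'f mv set)" by (simp add: coord_def)
    ultimately show ?case by auto
  next
    case (Cons F Fs)
    let ?U = "\<Union>(set Fs)"
    have disj: "F \<inter> ?U = {}" using Cons.prems by auto
    have "sorted_wrt (\<lambda>F G. F \<inter> G = {}) Fs" using Cons.prems by simp
    note IH0 = Cons.IH[OF this]
    have IH: "\<And>x::'f mv. x \<in> coord ?U \<longleftrightarrow> (\<exists>xs. x = sum_list xs \<and> list_all2 (\<in>) xs (map coord Fs))"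
      using IH0 by blast
    have IH2: "\<And>xs x. list_all2 (\<in>) xs (map coord Fs :: 'f mv set list) \<Longrightarrow> sum_list xs = 0 \<Longrightarrow> x \<in> set xs \<Longrightarrow> x = 0"
      using IH0 by blast
    show ?case
    proof (intro conjI allI iffI impI ballI)
      fix x :: "'f mv" assume x: "x \<in> coord (\<Union>(set (F # Fs)))"
      let ?y = "\<lambda>A. if A \<in> F then x A else 0" and ?z = "\<lambda>A. if A \<in> F then 0 else x A"
      have "?z \<in> coord ?U" using x by (auto simp: coord_def)
      then obtain xs where xs: "?z = sum_list xs" "list_all2 (\<in>) xs (map coord Fs)" using IH by blast
      have "x = ?y + ?z" by auto
      then have "x = sum_list (?y # xs)" using xs by simp
      moreover have "list_all2 (\<in>) (?y # xs) (map coord (F # Fs))"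
        using xs by (auto simp: coord_def)
      ultimately show "\<exists>xs. x = sum_list xs \<and> list_all2 (\<in>) xs (map coord (F # Fs))" by blast
    next
      fix x :: "'f mv" assume "\<exists>xs. x = sum_list xs \<and> list_all2 (\<in>) xs (map coord (F # Fs))"
      then obtain y xs where "x = y + sum_list xs" "y \<in> coord F" "list_all2 (\<in>) xs (map coord Fs)"
        by (auto simp: list_all2_Cons2)
      moreover from this have "sum_list xs \<in> coord ?U" using IH by blast
      ultimately show "x \<in> coord (\<Union>(set (F # Fs)))"
        using coord_mono[of F "\<Union>(set (F # Fs))"] coord_mono[of ?U "\<Union>(set (F # Fs))"]
        by (auto intro!: add_closed)
    next
      fix xs x assume "list_all2 (\<in>) xs (map coord (F # Fs) :: 'f mv set list) \<and> sum_list xs = 0" and x: "x \<in> set xs"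
      then obtain y ys where ys: "xs = y # ys" "y + sum_list ys = 0" "y \<in> coord F" "list_all2 (\<in>) ys (map coord Fs)"
        by (auto simp: list_all2_Cons2)
      have s: "sum_list ys \<in> coord ?U" using IH ys by blast
      have "y A = 0" for A
      proof (rule ccontr)
        assume "y A \<noteq> 0"
        moreover have "y A + sum_list ys A = 0" using ys(2) by (metis plus_fun_apply zero_fun_apply)
        ultimately have "y A \<noteq> 0" "sum_list ys A \<noteq> 0" by auto
        then have "A \<in> F" "A \<in> ?U" using ys(3) s unfolding coord_def by blast+
        then show False using disj by blast
      qed
      then have y: "y = 0" by auto
      then have "sum_list ys = 0" using ys(2) by simp
      then show "x = 0" using x y ys IH2[of ys x] by auto
    qed
  qed
  then show ?thesis unfolding is_direct_sum_def by blast
qed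

lemma card_Union_disjoint_list:
  assumes "sorted_wrt (\<lambda>F G. F \<inter> G = {}) Fs" "\<And>F. F \<in> set Fs \<Longrightarrow> finite F"
  shows "card (\<Union>(set Fs)) = sum_list (map card Fs)"
  using assms
proof (induction Fs)
  case (Cons F Fs)
  have "F \<inter> \<Union>(set Fs) = {}" using Cons.prems by auto
  then have "card (\<Union>(set (F # Fs))) = card F + card (\<Union>(set Fs))"
    using Cons.prems by (simp add: card_Un_disjoint)
  then show ?case using Cons by simp
qed simp

lemma lie_algebra_is_types:
  assumes G: "lie_algebra G = (coord (type_sets p q r P) :: 'f::{real_normed_field,banach} mv set)"
    and closed: "commutator_closed (p + q) r P"
    and Us: "list_all2 (\<lambda>U Q. U = coord (type_sets p q r Q)) Us Qs"
    and P: "\<And>a b. a \<le> p + q \<Longrightarrow> b \<le> r \<Longrightarrow> P a b \<longleftrightarrow> (\<exists>Q\<in>set Qs. Q a b)"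
    and disj: "sorted_wrt (\<lambda>Q Q'. \<forall>a\<le>p + q. \<forall>b\<le>r. \<not> (Q a b \<and> Q' a b)) Qs"
    and d: "d = (\<Sum>Q\<leftarrow>Qs. real (card (type_sets p q r Q)))"
  shows "lie_algebra_is p q r G Us d"
proof -
  let ?Fs = "map (type_sets p q r) Qs"
  have un: "type_sets p q r P = \<Union>(set ?Fs)"
    unfolding type_sets_def using P card_bounds by auto
  have "sorted_wrt (\<lambda>F G. F \<inter> G = {}) ?Fs"
    unfolding sorted_wrt_map
    by (rule sorted_wrt_mono_rel[OF _ disj]) (use card_bounds in \<open>auto simp: type_sets_def\<close>)
  note disj' = this
  have eq: "Us = map coord ?Fs"
    using Us by (induction rule: list_all2_induct) auto
  have "is_direct_sum (lie_algebra G) Us"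
    unfolding G eq un by (rule direct_sum_coord[OF disj'])
  moreover have "lie_subalgebra p q r (lie_algebra G)"
    unfolding G by (rule lie_subalgebra_types[OF closed])
  moreover have "real (mv.dim (lie_algebra G)) = d"
  proof -
    have "mv.dim (lie_algebra G) = card (\<Union>(set ?Fs))"
      unfolding G un by (rule dim_coord) auto
    also have "\<dots> = sum_list (map card ?Fs)"
      by (rule card_Union_disjoint_list[OF disj']) auto
    finally have "mv.dim (lie_algebra G) = (\<Sum>Q\<leftarrow>Qs. card (type_sets p q r Q))" by (simp add: o_def)
    moreover have "real (\<Sum>Q\<leftarrow>Qs. card (type_sets p q r Q)) = (\<Sum>Q\<leftarrow>Qs. real (card (type_sets p q r Q)))"
      by (induction Qs) auto
    ultimately show ?thesis unfolding d by simp
  qed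
  ultimately show ?thesis unfolding lie_algebra_is_def by blast
qed

section \<open>Explicit centralizers\<close>

lemma all_le_Suc: "(\<forall>i\<le>Suc m. P i) \<longleftrightarrow> P (Suc m) \<and> (\<forall>i\<le>m. P i)"
  by (auto simp: le_Suc_eq)


lemma numeral_4_eq_4: "(4 :: nat) = Suc (Suc (Suc (Suc 0)))"
  by simp

text \<open>
  The commutation condition prescribes the parity of all possible overlaps \<open>i\<close>, and these form an
  interval.  Two consecutive values exclude each other, so at most one value is allowed.  This leaves
  the null types, where \<open>i = 0\<close>, and types near the top, where the complement is too small for \<open>i\<close> to vary.
  All parities are expressed by that of the grade \<open>a + b\<close>, which is known in every application.
\<close>

lemma commuting_type_1: "a + b \<le> n \<Longrightarrow> commuting_type n 1 False a b \<longleftrightarrow>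
    a = 0 \<and> (even (a + b) \<or> a + b = n) \<or> 0 < a \<and> a + b = n \<and> odd (a + b)"
  unfolding commuting_type_def One_nat_def all_le_Suc by auto

lemma commuting_type_2: "a + b \<le> n \<Longrightarrow> commuting_type n 2 False a b \<longleftrightarrow> a = 0 \<or> a + b = n"
  unfolding commuting_type_def numeral_2_eq_2 all_le_Suc by (auto; presburger)

lemma commuting_type_3: "a + b \<le> n \<Longrightarrow> commuting_type n 3 False a b \<longleftrightarrow>
    a = 0 \<and> (even (a + b) \<or> n \<le> a + b + 2) \<or> a = 1 \<and> (n \<le> a + b + 1 \<or> n = a + b + 2 \<and> odd (a + b)) \<or>
    a = 2 \<and> (n = a + b \<or> n = a + b + 1 \<and> even (a + b)) \<or> a \<ge> 3 \<and> n = a + b \<and> odd (a + b)"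
proof -
  assume ab: "a + b \<le> n"
  consider "a = 0" | "a = 1" | "a = 2" | "a \<ge> 3"
    by linarith
  then show ?thesis
  proof cases
    case 1
    then show ?thesis using ab unfolding commuting_type_def numeral_3_eq_3 all_le_Suc by (auto; presburger)
  next
    case 2
    then show ?thesis using ab unfolding commuting_type_def numeral_3_eq_3 all_le_Suc by (auto; presburger)
  next
    case 3
    then show ?thesis using ab unfolding commuting_type_def numeral_3_eq_3 all_le_Suc by (auto; presburger)
  next
    case 4
    have "commuting_type n 3 False a b \<longleftrightarrow> n = a + b \<and> odd n"
    proof
      assume L: "commuting_type n 3 False a b"
      have "even ((a + b) * 3 + 3)"
        using L[unfolded commuting_type_def, rule_format, of 3] 4 ab by simp
      then have o: "odd (a + b)" by simp
      have "a + b = n"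
      proof (rule ccontr)
        assume "a + b \<noteq> n"
        then have "even ((a + b) * 3 + 2)"
          using L[unfolded commuting_type_def, rule_format, of 2] 4 ab by simp
        then show False using o by simp
      qed
      then show "n = a + b \<and> odd n" using o by simp
    next
      assume R: "n = a + b \<and> odd n"
      show "commuting_type n 3 False a b"
        unfolding commuting_type_def
      proof (intro allI impI)
        fix i assume "i \<le> 3" "i \<le> a \<and> 3 - i + (a + b) \<le> n"
        then have "i = 3" using R by linarith
        moreover have "even (x * 3 + 3)" if "odd x" for x :: nat using that by simp
        moreover have "odd (a + b)" using R by (elim conjE) (simp only: simp_thms)
        ultimately show "even ((a + b) * 3 + i + (if False then a + b else 0))"
          by (simp only: if_False add_0_right simp_thms)
      qed
    qed
    then show ?thesis using 4 by auto
  qed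
qed

lemma commuting_type_4: "a + b \<le> n \<Longrightarrow> commuting_type n 4 False a b \<longleftrightarrow>
    a = 0 \<or> a \<le> 2 \<and> n \<le> a + b + 2 \<or> n = a + b"
proof -
  assume ab: "a + b \<le> n"
  consider "a = 0" | "a = 1" | "a = 2" | "a \<ge> 3"
    by linarith
  then show ?thesis
  proof cases
    case 1
    then show ?thesis using ab unfolding commuting_type_def numeral_4_eq_4 all_le_Suc by (auto; presburger)
  next
    case 2
    then show ?thesis using ab unfolding commuting_type_def numeral_4_eq_4 all_le_Suc by (auto; presburger)
  next
    case 3
    then show ?thesis using ab unfolding commuting_type_def numeral_4_eq_4 all_le_Suc by (auto; presburger)
  next
    case 4
    have "commuting_type n 4 False a b \<longleftrightarrow> n = a + b"
    proof
      assume L: "commuting_type n 4 False a b"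
      show "n = a + b"
      proof (rule ccontr)
        assume "n \<noteq> a + b"
        then have "even ((a + b) * 4 + 3)"
          using L[unfolded commuting_type_def, rule_format, of 3] 4 ab by simp
        then show False by simp
      qed
    next
      assume R: "n = a + b"
      show "commuting_type n 4 False a b"
        unfolding commuting_type_def
      proof (intro allI impI)
        fix i assume "i \<le> 4" "i \<le> a \<and> 4 - i + (a + b) \<le> n"
        then have "i = 4" using R by linarith
        then show "even ((a + b) * 4 + i + (if False then a + b else 0))" by simp
      qed
    qed
    then show ?thesis using 4 by auto
  qed
qed

lemma commuting_type_twisted_1: "a + b \<le> n \<Longrightarrow> commuting_type n 1 True a b \<longleftrightarrow> a = 0"
  unfolding commuting_type_def One_nat_def all_le_Suc by (simp; presburger)

lemma commuting_type_twisted_2: "a + b \<le> n \<Longrightarrow> commuting_type n 2 True a b \<longleftrightarrow>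
    a = 0 \<and> (even (a + b) \<or> n \<le> a + b + 1) \<or> a = 1 \<and> (n = a + b \<or> n = a + b + 1 \<and> odd (a + b)) \<or>
    2 \<le> a \<and> n = a + b \<and> even (a + b)"
  unfolding commuting_type_def numeral_2_eq_2 all_le_Suc by (simp; presburger)

lemma commuting_type_twisted_3: "a + b \<le> n \<Longrightarrow> commuting_type n 3 True a b \<longleftrightarrow>
    a = 0 \<or> a \<le> 2 \<and> n \<le> a + b + 1"
proof -
  assume ab: "a + b \<le> n"
  consider "a = 0" | "a = 1" | "a = 2" | "a \<ge> 3"
    by linarith
  then show ?thesis
  proof cases
    case 1
    then show ?thesis using ab unfolding commuting_type_def numeral_3_eq_3 all_le_Suc by (auto; presburger)
  next
    case 2
    then show ?thesis using ab unfolding commuting_type_def numeral_3_eq_3 all_le_Suc by (auto; presburger)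
  next
    case 3
    then show ?thesis using ab unfolding commuting_type_def numeral_3_eq_3 all_le_Suc by (auto; presburger)
  next
    case 4
    have "\<not> commuting_type n 3 True a b"
    proof
      assume L: "commuting_type n 3 True a b"
      have "even ((a + b) * 3 + 3 + (a + b))"
        using L[unfolded commuting_type_def, rule_format, of 3] 4 ab by simp
      then show False by simp
    qed
    then show ?thesis using 4 by simp
  qed
qed

lemmas commuting_types = commuting_type_1[unfolded One_nat_def] commuting_type_2 commuting_type_3 commuting_type_4
  commuting_type_twisted_1[unfolded One_nat_def] commuting_type_twisted_2 commuting_type_twisted_3

section \<open>Closure under the commutator\<close>

definition near_top :: "nat \<Rightarrow> nat \<Rightarrow> nat \<Rightarrow> bool" where
  "near_top n a b \<longleftrightarrow> a + b = n \<or> a \<le> 2 \<and> n \<le> a + b + 2"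

text \<open>
  A basis element of grade 2 modulo 4 that anticommutes with one near the top fits into the latter's non-null
  part and its small complement.  Parity excludes the full element, and what remains is a grade 2
  element that shares one generator, which the commutator replaces by the other one.
\<close>

lemma overlap_two:
  assumes "near_top n a' b'" "(a + b) mod 4 = 2" "odd i" "i \<le> a" "i \<le> a'" "a + a' \<le> s + i" "b + b' \<le> r" "n = s + r"
  shows "i = 1 \<and> a + b = 2 \<and> a' + b' < n \<and> a' \<le> 2"
proof (cases "a' + b' = n")
  case True
  then have "b = 0" "a = i" using assms by linarith+
  then show ?thesis using assms(2,3) by presburger
next
  case False
  then have "a' \<le> 2" "n \<le> a' + b' + 2" using assms(1) by (auto simp: near_top_def)
  then have "i = 1" using assms(3,5) by presburger
  then have "a + b \<le> 3" using assms(4-) \<open>n \<le> a' + b' + 2\<close> by linarith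
  then have "a + b = 2" using assms(2) by presburger
  then show ?thesis using False \<open>a' \<le> 2\<close> \<open>i = 1\<close> assms by simp
qed

text \<open>
  Two elements near the top overlap in at most two generators unless one of them is full, which
  bounds \<open>n\<close>; no grade divisible by 4 fits.
\<close>

lemma overlap_even_odd:
  assumes "near_top n a b" "near_top n a' b'" "(a + b) mod 4 = 0" "odd (a' + b')" "odd i" "i \<le> a" "i \<le> a'" "a + a' \<le> s + i" "b + b' \<le> r" "n = s + r"
  shows False
proof -
  consider "a + b = n" | "a' + b' = n" | "a \<le> 2" "n \<le> a + b + 2" "a' \<le> 2" "n \<le> a' + b' + 2" "a + b < n" "a' + b' < n"
    using assms unfolding near_top_def by linarith
  then show False
  proof cases
    case 1
    then have "b' = 0" "a' = i" using assms by linarith+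
    moreover have "even n" using 1 assms(3) by presburger
    then have "a' + b' \<noteq> n" using assms(4) by auto
    ultimately have "a' \<le> 2" "n \<le> a' + b' + 2" using assms(2) unfolding near_top_def by auto
    then have "a' = 1" using \<open>a' = i\<close> assms(5) by presburger
    then have "0 < n" "n < 4" using \<open>n \<le> a' + b' + 2\<close> \<open>b' = 0\<close> \<open>a' = i\<close> 1 assms(6) by linarith+
    then show False using 1 assms(3) by simp
  next
    case 2
    then have "b = 0" "a = i" using assms by linarith+
    then show False using assms(3,5) by presburger
  next
    case 3
    then have "i = 1" using assms(5,6) by presburger
    then have "a + b \<le> 3" "0 < a + b" using 3 assms(6-) by linarith+
    then show False using assms(3) by simp
  qed
qed

lemma overlap_odd_odd:
  assumes "near_top n a' b'" "odd (a + b)" "odd (a' + b')" "even i" "i \<le> a" "i \<le> a'" "a + a' \<le> s + i" "b + b' \<le> r" "n = s + r"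
  shows "a' + b' < n \<and> a' \<le> 2 \<and> n \<le> a' + b' + 2 \<and> (i = 0 \<and> a + b = 1 \<or> i = 2 \<and> a + b = 3 \<and> a' = 2)"
proof (cases "a' + b' = n")
  case True
  then have "b = 0" "a = i" using assms by linarith+
  then show ?thesis using assms(2,4) by presburger
next
  case False
  then have near: "a' \<le> 2" "n \<le> a' + b' + 2" using assms(1) by (auto simp: near_top_def)
  then have "i = 0 \<or> i = 2" using assms(4,6) by presburger
  moreover have "a + b \<le> i + 2" "a + b \<ge> i" "a' + b' < n" using assms(5-) near False by linarith+
  ultimately show ?thesis using near assms(2,6) by (elim disjE) presburger+
qed

text \<open>
  \<open>(c, d)\<close> is the type of the commutator.
\<close>

definition overlap :: "nat \<Rightarrow> nat \<Rightarrow> nat \<Rightarrow> nat \<Rightarrow> nat \<Rightarrow> nat \<Rightarrow> nat \<Rightarrow> nat \<Rightarrow> nat \<Rightarrow> bool" where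
  "overlap s r a b a' b' i c d \<longleftrightarrow> i \<le> a \<and> i \<le> a' \<and> a + a' \<le> s + i \<and> b + b' \<le> r \<and>
     c + 2 * i = a + a' \<and> d = b + b'"

text \<open>
  Modulo 4, anticommuting basis elements multiply like the Klein four-group with neutral element 2:
  equal residues give 2, and two different ones among 0, 1, 3 give the third.  By symmetry five
  combinations remain.
\<close>

lemma commutator_closedI:
  assumes two: "\<And>a b. (a + b) mod 4 = 2 \<Longrightarrow> P a b"
    and p2: "\<And>a b a' b' i c d. overlap s r a b a' b' i c d \<Longrightarrow> P a' b' \<Longrightarrow> odd i \<Longrightarrow> (a + b) mod 4 = 2 \<Longrightarrow>
      (a' + b') mod 4 \<noteq> 2 \<Longrightarrow> (c + d) mod 4 = (a' + b') mod 4 \<Longrightarrow> P c d"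
    and p01: "\<And>a b a' b' i c d. overlap s r a b a' b' i c d \<Longrightarrow> P a b \<Longrightarrow> P a' b' \<Longrightarrow> odd i \<Longrightarrow> (a + b) mod 4 = 0 \<Longrightarrow>
      (a' + b') mod 4 = 1 \<Longrightarrow> (c + d) mod 4 = 3 \<Longrightarrow> P c d"
    and p03: "\<And>a b a' b' i c d. overlap s r a b a' b' i c d \<Longrightarrow> P a b \<Longrightarrow> P a' b' \<Longrightarrow> odd i \<Longrightarrow> (a + b) mod 4 = 0 \<Longrightarrow>
      (a' + b') mod 4 = 3 \<Longrightarrow> (c + d) mod 4 = 1 \<Longrightarrow> P c d"
    and p13: "\<And>a b a' b' i c d. overlap s r a b a' b' i c d \<Longrightarrow> P a b \<Longrightarrow> P a' b' \<Longrightarrow> even i \<Longrightarrow> (a + b) mod 4 = 1 \<Longrightarrow>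
      (a' + b') mod 4 = 3 \<Longrightarrow> (c + d) mod 4 = 0 \<Longrightarrow> P c d"
  shows "commutator_closed s r P"
  unfolding commutator_closed_def
proof (intro allI impI)
  fix a b a' b' i
  assume *: "i \<le> a" "i \<le> a'" "a + a' \<le> s + i" "b + b' \<le> r" and P: "P a b" "P a' b'"
    and odd: "odd ((a + b) * (a' + b') + i)"
  define c where "c = a + a' - 2 * i"
  define d where "d = b + b'"
  have o: "overlap s r a b a' b' i c d" and o': "overlap s r a' b' a b i c d"
    using * by (auto simp: overlap_def c_def d_def)
  have res: "(c + d) mod 4 = ((a + b) mod 4 + (a' + b') mod 4 + 2 * (i mod 2)) mod 4"
  proof -
    have "(c + d) mod 4 = (c + d + 4 * i) mod 4" by simp
    also have "c + d + 4 * i = (a + b) + (a' + b') + 2 * i" using * by (simp add: c_def d_def)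
    also have "\<dots> mod 4 = ((a + b) mod 4 + (a' + b') mod 4 + (2 * i) mod 4) mod 4"
      by (intro mod_add_cong) simp_all
    also have "(2 * i) mod 4 = 2 * (i mod 2)" using mult_mod_right[of 2 i 2] by simp
    finally show ?thesis .
  qed
  have par: "odd i \<longleftrightarrow> \<not> (odd (a + b) \<and> odd (a' + b'))" using odd by auto
  define x where "x = (a + b) mod 4"
  define y where "y = (a' + b') mod 4"
  have oddx: "odd (a + b) \<longleftrightarrow> x = 1 \<or> x = 3" "odd (a' + b') \<longleftrightarrow> y = 1 \<or> y = 3"
    unfolding x_def y_def by presburger+
  have "x < 4" "y < 4" by (simp_all add: x_def y_def)
  then have cases: "x = 0 \<or> x = 1 \<or> x = 2 \<or> x = 3" "y = 0 \<or> y = 1 \<or> y = 2 \<or> y = 3" by linarith+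
  have i2: "i mod 2 = (if odd i then 1 else 0)" by presburger
  have "P c d"
  proof (cases "x = y")
    case True
    then have "(c + d) mod 4 = 2"
      using cases(1) unfolding res i2 par oddx x_def[symmetric] y_def[symmetric] by (elim disjE) simp_all
    then show ?thesis by (rule two)
  next
    case False
    then consider "x = 2" "y \<noteq> 2" | "y = 2" "x \<noteq> 2" | "x = 0" "y = 1" | "y = 0" "x = 1" | "x = 0" "y = 3" | "y = 0" "x = 3"
      | "x = 1" "y = 3" | "y = 1" "x = 3"
      using cases by blast
    then show ?thesis
    proof cases
      case 1
      have "(c + d) mod 4 = y" "odd i"
        using 1 cases(2) unfolding res i2 par oddx x_def[symmetric] y_def[symmetric] by (elim disjE; simp)+
      then show ?thesis using p2[OF o P(2)] 1 unfolding x_def y_def by blast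
    next
      case 2
      have "(c + d) mod 4 = x" "odd i"
        using 2 cases(1) unfolding res i2 par oddx x_def[symmetric] y_def[symmetric] by (elim disjE; simp)+
      then show ?thesis using p2[OF o' P(1)] 2 unfolding x_def y_def by blast
    next
      case 3
      have "(c + d) mod 4 = 3" "odd i"
        using 3 unfolding res i2 par oddx x_def[symmetric] y_def[symmetric] by simp_all
      then show ?thesis using p01[OF o P] 3 unfolding x_def y_def by blast
    next
      case 4
      have "(c + d) mod 4 = 3" "odd i"
        using 4 unfolding res i2 par oddx x_def[symmetric] y_def[symmetric] by simp_all
      then show ?thesis using p01[OF o' P(2,1)] 4 unfolding x_def y_def by blast
    next
      case 5
      have "(c + d) mod 4 = 1" "odd i"
        using 5 unfolding res i2 par oddx x_def[symmetric] y_def[symmetric] by simp_all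
      then show ?thesis using p03[OF o P] 5 unfolding x_def y_def by blast
    next
      case 6
      have "(c + d) mod 4 = 1" "odd i"
        using 6 unfolding res i2 par oddx x_def[symmetric] y_def[symmetric] by simp_all
      then show ?thesis using p03[OF o' P(2,1)] 6 unfolding x_def y_def by blast
    next
      case 7
      have "even i" using 7 par oddx by auto
      then have "(c + d) mod 4 = 0"
        using 7 unfolding res i2 x_def[symmetric] y_def[symmetric] by simp
      then show ?thesis using p13[OF o P \<open>even i\<close>] 7 unfolding x_def y_def by simp
    next
      case 8
      have "even i" using 8 par oddx by auto
      then have "(c + d) mod 4 = 0"
        using 8 unfolding res i2 x_def[symmetric] y_def[symmetric] by simp
      then show ?thesis using p13[OF o' P(2,1) \<open>even i\<close>] 8 unfolding x_def y_def by simp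
    qed
  qed
  then show "P (a + a' - 2 * i) (b + b')" by (simp add: c_def d_def)
qed


lemma overlap_bounds:
  assumes "overlap s r a b a' b' i c d"
  shows "a \<le> s" "b \<le> r" "a' \<le> s" "b' \<le> r" "c \<le> s" "d \<le> r"
  using assms unfolding overlap_def by linarith+

lemma skew_two:
  assumes o: "overlap s r a b a' b' i c d" and near: "near_top (s + r) a' b'"
    and res: "(a + b) mod 4 = 2" "odd i"
  shows "0 < a'" "a' \<le> 2" "a' + b' < s + r" "c + d = a' + b'" "c = a' \<or> c + 1 = a'"
proof -
  have *: "i = 1 \<and> a + b = 2 \<and> a' + b' < s + r \<and> a' \<le> 2"
    using o by (intro overlap_two[OF near res]) (auto simp: overlap_def)
  then show "0 < a'" "a' \<le> 2" "a' + b' < s + r" "c + d = a' + b'" "c = a' \<or> c + 1 = a'"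
    using o unfolding overlap_def by linarith+
qed

text \<open>
  For the groups of type A the residues 2 and 3 are unconstrained.  Elements of grade 0 modulo 4 that are
  not null lack at most one generator, and those of grade 1 modulo 4 are full or null of codegree at
  most 2; they then have no nonzero commutator with grades 3 modulo 4 at all.
\<close>

lemma commutator_closed_A:
  assumes zero: "\<And>a b. a \<le> s \<Longrightarrow> b \<le> r \<Longrightarrow> even (a + b) \<Longrightarrow> P1 a b \<Longrightarrow> 0 < a \<Longrightarrow> a \<le> 2 \<and> s + r \<le> a + b + 1"
    and one: "\<And>a b. a \<le> s \<Longrightarrow> b \<le> r \<Longrightarrow> odd (a + b) \<Longrightarrow> P1 a b \<Longrightarrow> a + b = s + r \<or> a = 0 \<and> s + r \<le> b + 2"
    and shift: "\<And>a b c d. a \<le> s \<Longrightarrow> b \<le> r \<Longrightarrow> c \<le> s \<Longrightarrow> d \<le> r \<Longrightarrow> a \<le> 2 \<Longrightarrow> a + b < s + r \<Longrightarrow> even (a + b) \<Longrightarrow>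
      P1 a b \<Longrightarrow> c + d = a + b \<Longrightarrow> c = a \<or> c + 1 = a \<Longrightarrow> P1 c d"
  shows "commutator_closed s r (tangent_type P1 (\<lambda>a b. True))" (is "commutator_closed s r ?P")
proof -
  have even: "even k" if "k mod 4 = 0" for k :: nat using that by presburger
  have odd: "odd k" if "k mod 4 = 1 \<or> k mod 4 = 3" for k :: nat using that by presburger
  define P where "P = ?P"
  have free: "P a b" if "(a + b) mod 4 = 2 \<or> (a + b) mod 4 = 3" for a b
    using that by (auto simp: P_def tangent_type_def)
  have zero: "a \<le> 2 \<and> s + r \<le> a + b + 1"
    if "a \<le> s" "b \<le> r" "(a + b) mod 4 = 0" "P a b" "0 < a" for a b
    using zero[of a b] that even[of "a + b"] by (simp add: P_def tangent_type_def)
  have one: "a + b = s + r \<or> a = 0 \<and> s + r \<le> b + 2"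
    if "a \<le> s" "b \<le> r" "(a + b) mod 4 = 1" "P a b" for a b
    using one[of a b] that odd[of "a + b"] by (simp add: P_def tangent_type_def)
  have shift: "P c d"
    if "a \<le> s" "b \<le> r" "c \<le> s" "d \<le> r" "a \<le> 2" "a + b < s + r" "(a + b) mod 4 = 0" "P a b" "c + d = a + b" "c = a \<or> c + 1 = a" for a b c d
    using shift[of a b c d] that even[of "a + b"] by (simp add: P_def tangent_type_def)
  show ?thesis
    unfolding P_def[symmetric]
  proof (rule commutator_closedI)
    fix a b a' b' i c d
    assume o: "overlap s r a b a' b' i c d" and P: "P a' b'" and i: "odd i" "(a + b) mod 4 = 2"
      and ne: "(a' + b') mod 4 \<noteq> 2" and res: "(c + d) mod 4 = (a' + b') mod 4"
    note bnd = overlap_bounds[OF o]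
    have pos: "0 < a'" using o i(1) unfolding overlap_def by (cases "a' = 0") auto
    have "(a' + b') mod 4 < 4" by simp
    then consider "(a' + b') mod 4 = 0" | "(a' + b') mod 4 = 1" | "(a' + b') mod 4 = 3"
      using ne by linarith
    then show "P c d"
    proof cases
      case 1
      have "near_top (s + r) a' b'" using zero[OF bnd(3,4) 1 P pos] by (auto simp: near_top_def)
      from skew_two[OF o this i(2,1)] show ?thesis using shift[of a' b' c d] bnd 1 P by blast
    next
      case 2
      have "near_top (s + r) a' b'" using one[OF bnd(3,4) 2 P] pos by (auto simp: near_top_def)
      from skew_two[OF o this i(2,1)] show ?thesis using one[OF bnd(3,4) 2 P] by linarith
    next
      case 3
      then show ?thesis using free res by simp
    qed
  next
    fix a b a' b' i c d
    assume o: "overlap s r a b a' b' i c d" and P: "P a b" and i: "odd i" "(a + b) mod 4 = 0" "(a' + b') mod 4 = 3"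
    have "0 < a" using o i(1) unfolding overlap_def by (cases "a = 0") auto
    then have "a \<le> 2" "s + r \<le> a + b + 1" using zero[OF overlap_bounds(1,2)[OF o] i(2) P] by auto
    moreover from this have "i \<le> 2" using o unfolding overlap_def by linarith
    then have "i = 1" using i(1) by presburger
    ultimately have "a' + b' \<le> 2" using o unfolding overlap_def by linarith
    then show "P c d" using i(3) by simp
  next
    fix a b a' b' i c d
    assume o: "overlap s r a b a' b' i c d" and P: "P a b" and i: "even i" "(a + b) mod 4 = 1" "(a' + b') mod 4 = 3"
    have "near_top (s + r) a b" using one[OF overlap_bounds(1,2)[OF o] i(2) P] by (auto simp: near_top_def)
    moreover have "odd (a + b)" "odd (a' + b')" using i(2,3) by presburger+
    ultimately have "a + b < s + r \<and> a \<le> 2 \<and> s + r \<le> a + b + 2 \<and> (i = 0 \<and> a' + b' = 1 \<or> i = 2 \<and> a' + b' = 3 \<and> a = 2)"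
      using o i(1) by (intro overlap_odd_odd[of _ _ _ a' b' _ s r]) (auto simp: overlap_def)
    then show "P c d" using one[OF overlap_bounds(1,2)[OF o] i(2) P] i(3) by auto
  qed (use free in auto)
qed

text \<open>
  For the groups of type B the residues 1 and 2 are unconstrained.  An element of grade 1 modulo 4
  that anticommutes with a constrained element near the top has grade 1 exactly: it removes one non-null
  generator (\<open>drop\<close>) or adds a missing one (\<open>add\<close>).
\<close>

lemma commutator_closed_B:
  assumes zero: "\<And>a b. a \<le> s \<Longrightarrow> b \<le> r \<Longrightarrow> even (a + b) \<Longrightarrow> P2 a b \<Longrightarrow> 0 < a \<Longrightarrow> a \<le> 2 \<and> s + r \<le> a + b + 1"
    and three: "\<And>a b. a \<le> s \<Longrightarrow> b \<le> r \<Longrightarrow> odd (a + b) \<Longrightarrow> P2 a b \<Longrightarrow> near_top (s + r) a b"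
    and shift: "\<And>a b c d. a \<le> s \<Longrightarrow> b \<le> r \<Longrightarrow> c \<le> s \<Longrightarrow> d \<le> r \<Longrightarrow> a \<le> 2 \<Longrightarrow> a + b < s + r \<Longrightarrow>
      P2 a b \<Longrightarrow> c + d = a + b \<Longrightarrow> c = a \<or> c + 1 = a \<Longrightarrow> P2 c d"
    and drop: "\<And>a b. a < s \<Longrightarrow> b \<le> r \<Longrightarrow> odd (a + b) \<Longrightarrow> P2 (Suc a) b \<Longrightarrow> P2 a b"
    and add: "\<And>a b c d. a \<le> s \<Longrightarrow> b \<le> r \<Longrightarrow> c \<le> s \<Longrightarrow> d \<le> r \<Longrightarrow> near_top (s + r) a b \<Longrightarrow> a + b < s + r \<Longrightarrow> odd (a + b) \<Longrightarrow>
      P2 a b \<Longrightarrow> c + d = Suc (a + b) \<Longrightarrow> c = a \<or> c = Suc a \<Longrightarrow> P2 c d"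
  shows "commutator_closed s r (tangent_type (\<lambda>a b. True) P2)" (is "commutator_closed s r ?P")
proof -
  have even: "even k" if "k mod 4 = 0" for k :: nat using that by presburger
  have odd: "odd k" if "k mod 4 = 1 \<or> k mod 4 = 3" for k :: nat using that by presburger
  define P where "P = ?P"
  have free: "P a b" if "(a + b) mod 4 = 2 \<or> (a + b) mod 4 = 1" for a b
    using that by (auto simp: P_def tangent_type_def)
  have zero: "a \<le> 2 \<and> s + r \<le> a + b + 1"
    if "a \<le> s" "b \<le> r" "(a + b) mod 4 = 0" "P a b" "0 < a" for a b
    using zero[of a b] that even[of "a + b"] by (simp add: P_def tangent_type_def)
  have three: "near_top (s + r) a b"
    if "a \<le> s" "b \<le> r" "(a + b) mod 4 = 3" "P a b" for a b
    using three[of a b] that odd[of "a + b"] by (simp add: P_def tangent_type_def)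
  have shift: "P c d"
    if "a \<le> s" "b \<le> r" "c \<le> s" "d \<le> r" "a \<le> 2" "a + b < s + r" "(a + b) mod 4 = 0 \<or> (a + b) mod 4 = 3" "P a b" "c + d = a + b" "c = a \<or> c + 1 = a" for a b c d
    using shift[of a b c d] that by (simp add: P_def tangent_type_def)
  have drop: "P a b" if "a < s" "b \<le> r" "(a + b) mod 4 = 3" "(Suc a + b) mod 4 = 0" "P (Suc a) b" for a b
    using drop[of a b] that odd[of "a + b"] by (simp add: P_def tangent_type_def)
  have add: "P c d"
    if "a \<le> s" "b \<le> r" "c \<le> s" "d \<le> r" "near_top (s + r) a b" "a + b < s + r" "(a + b) mod 4 = 3" "P a b"
      "c + d = Suc (a + b)" "c = a \<or> c = Suc a" for a b c d
    using add[of a b c d] that odd[of "a + b"] by (simp add: P_def tangent_type_def)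
  show ?thesis
    unfolding P_def[symmetric]
  proof (rule commutator_closedI)
    fix a b a' b' i c d
    assume o: "overlap s r a b a' b' i c d" and P: "P a' b'" and i: "odd i" "(a + b) mod 4 = 2"
      and ne: "(a' + b') mod 4 \<noteq> 2" and res: "(c + d) mod 4 = (a' + b') mod 4"
    note bnd = overlap_bounds[OF o]
    have pos: "0 < a'" using o i(1) unfolding overlap_def by (cases "a' = 0") auto
    have "(a' + b') mod 4 < 4" by simp
    then consider "(a' + b') mod 4 = 0" | "(a' + b') mod 4 = 3" | "(a' + b') mod 4 = 1"
      using ne by linarith
    then show "P c d"
    proof cases
      case 1
      have "near_top (s + r) a' b'" using zero[OF bnd(3,4) 1 P pos] by (auto simp: near_top_def)
      from skew_two[OF o this i(2,1)] show ?thesis using shift[of a' b' c d] bnd 1 P by blast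
    next
      case 2
      from skew_two[OF o three[OF bnd(3,4) 2 P] i(2,1)] show ?thesis using shift[of a' b' c d] bnd 2 P by blast
    next
      case 3
      then show ?thesis using free res by simp
    qed
  next
    fix a b a' b' i c d
    assume o: "overlap s r a b a' b' i c d" and P: "P a b" and i: "odd i" "(a + b) mod 4 = 0" "(a' + b') mod 4 = 1"
      and res: "(c + d) mod 4 = 3"
    have pos: "0 < a" using o i(1) unfolding overlap_def by (cases "a = 0") auto
    then have a: "a \<le> 2" "s + r \<le> a + b + 1" using zero[OF overlap_bounds(1,2)[OF o] i(2) P] by auto
    then have "i \<le> 2" using o unfolding overlap_def by linarith
    then have "i = 1" using i(1) by presburger
    moreover from this a have "a' + b' \<le> 2" using o unfolding overlap_def by linarith
    then have "a' + b' = 1" using i(3) by presburger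
    ultimately have "a' = 1" "b' = 0" "a = Suc c" "d = b" using o unfolding overlap_def by linarith+
    then show "P c d" using P drop[of c d] res i(2) overlap_bounds[OF o] by auto
  next
    fix a b a' b' i c d
    assume o: "overlap s r a b a' b' i c d" and P: "P a' b'" and i: "even i" "(a + b) mod 4 = 1" "(a' + b') mod 4 = 3"
    note near = three[OF overlap_bounds(3,4)[OF o] i(3) P]
    moreover have "odd (a + b)" "odd (a' + b')" using i(2,3) by presburger+
    ultimately have "a' + b' < s + r \<and> a' \<le> 2 \<and> s + r \<le> a' + b' + 2 \<and> (i = 0 \<and> a + b = 1 \<or> i = 2 \<and> a + b = 3 \<and> a' = 2)"
      using o i(1) by (intro overlap_odd_odd[of _ _ _ a b _ s r]) (auto simp: overlap_def)
    then have *: "i = 0" "a + b = 1" "a' + b' < s + r" using i(2) by auto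
    then have "c + d = Suc (a' + b')" "c = a' \<or> c = Suc a'" using o by (auto simp: overlap_def)
    then show "P c d" using add[OF overlap_bounds(3-6)[OF o] near *(3) i(3) P] by blast
  qed (use free in auto)
qed

text \<open>
  For the groups of type Q all residues except 2 are constrained, and null elements are always allowed.
  Apart from grade 2, only grade 1 and grade 3 modulo 4 interact, and there, unless
  both are null, the first element is again a single generator missing in the second one.
\<close>

lemma commutator_closed_Q:
  assumes near1: "\<And>a b. a \<le> s \<Longrightarrow> b \<le> r \<Longrightarrow> P1 a b \<Longrightarrow> 0 < a \<Longrightarrow> near_top (s + r) a b"
    and near2: "\<And>a b. a \<le> s \<Longrightarrow> b \<le> r \<Longrightarrow> P2 a b \<Longrightarrow> 0 < a \<Longrightarrow> near_top (s + r) a b"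
    and null1: "\<And>b. b \<le> r \<Longrightarrow> P1 0 b"
    and null2: "\<And>b. b \<le> r \<Longrightarrow> P2 0 b"
    and shift1: "\<And>a b c d. a \<le> s \<Longrightarrow> b \<le> r \<Longrightarrow> c \<le> s \<Longrightarrow> d \<le> r \<Longrightarrow> a \<le> 2 \<Longrightarrow> a + b < s + r \<Longrightarrow>
      P1 a b \<Longrightarrow> c + d = a + b \<Longrightarrow> c = a \<or> c + 1 = a \<Longrightarrow> P1 c d"
    and shift2: "\<And>a b c d. a \<le> s \<Longrightarrow> b \<le> r \<Longrightarrow> c \<le> s \<Longrightarrow> d \<le> r \<Longrightarrow> a \<le> 2 \<Longrightarrow> a + b < s + r \<Longrightarrow>
      P2 a b \<Longrightarrow> c + d = a + b \<Longrightarrow> c = a \<or> c + 1 = a \<Longrightarrow> P2 c d"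
    and add: "\<And>a b x y. a + x \<le> s \<Longrightarrow> b + y \<le> r \<Longrightarrow> 0 < a \<Longrightarrow> near_top (s + r) a b \<Longrightarrow> a + b < s + r \<Longrightarrow>
      P2 a b \<Longrightarrow> x + y = 1 \<Longrightarrow> P1 x y \<Longrightarrow> P1 (a + x) (b + y) \<and> P2 (a + x) (b + y)"
  shows "commutator_closed s r (tangent_type P1 P2)" (is "commutator_closed s r ?P")
proof -
  define P where "P = ?P"
  have lt4: "(k :: nat) mod 4 = 0 \<or> k mod 4 = 1 \<or> k mod 4 = 2 \<or> k mod 4 = 3" for k by linarith
  have free: "P a b" if "(a + b) mod 4 = 2" for a b
    using that by (auto simp: P_def tangent_type_def)
  have near: "near_top (s + r) a b" if "a \<le> s" "b \<le> r" "(a + b) mod 4 \<noteq> 2" "P a b" "0 < a" for a b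
    using near1[of a b] near2[of a b] that lt4[of "a + b"] by (auto simp: P_def tangent_type_def)
  have null: "P 0 b" if "b \<le> r" for b
    using null1[OF that] null2[OF that] by (auto simp: P_def tangent_type_def)
  have shift: "P c d"
    if "a \<le> s" "b \<le> r" "c \<le> s" "d \<le> r" "a \<le> 2" "a + b < s + r" "P a b" "c + d = a + b" "c = a \<or> c + 1 = a" for a b c d
  proof -
    have "P1 a b \<Longrightarrow> P1 c d" "P2 a b \<Longrightarrow> P2 c d"
      using shift1[OF that(1-6) _ that(8,9)] shift2[OF that(1-6) _ that(8,9)] by blast+
    then show ?thesis using that(7) unfolding P_def tangent_type_def that(8) by auto
  qed
  have add: "P (a + x) (b + y)"
    if "a + x \<le> s" "b + y \<le> r" "0 < a" "near_top (s + r) a b" "a + b < s + r" "(a + b) mod 4 = 3" "P a b" "x + y = 1" "P x y" for a b x y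
    using add[of a x b y] that by (simp add: P_def tangent_type_def)
  show ?thesis
    unfolding P_def[symmetric]
  proof (rule commutator_closedI)
    fix a b a' b' i c d
    assume o: "overlap s r a b a' b' i c d" and P: "P a' b'" and i: "odd i" "(a + b) mod 4 = 2"
      and ne: "(a' + b') mod 4 \<noteq> 2" and res: "(c + d) mod 4 = (a' + b') mod 4"
    note bnd = overlap_bounds[OF o]
    have pos: "0 < a'" using o i(1) unfolding overlap_def by (cases "a' = 0") auto
    from skew_two[OF o near[OF bnd(3,4) ne P pos] i(2,1)] show "P c d" using shift[of a' b' c d] bnd P by blast
  next
    fix a b a' b' i c d
    assume o: "overlap s r a b a' b' i c d" and P: "P a b" "P a' b'" and i: "odd i" "(a + b) mod 4 = 0" "(a' + b') mod 4 = 1"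
    have pos: "0 < a" "0 < a'" using o i(1) unfolding overlap_def by (cases "a = 0"; cases "a' = 0"; auto)+
    have "near_top (s + r) a b" "near_top (s + r) a' b'"
      using near overlap_bounds[OF o] P pos i(2,3) by simp_all
    moreover have "odd (a' + b')" using i(3) by presburger
    ultimately have False
      using o i(1,2) by (intro overlap_even_odd[of "s + r" a b a' b' i s r]) (auto simp: overlap_def)
    then show "P c d" ..
  next
    fix a b a' b' i c d
    assume o: "overlap s r a b a' b' i c d" and P: "P a b" "P a' b'" and i: "odd i" "(a + b) mod 4 = 0" "(a' + b') mod 4 = 3"
    have pos: "0 < a" "0 < a'" using o i(1) unfolding overlap_def by (cases "a = 0"; cases "a' = 0"; auto)+
    have "near_top (s + r) a b" "near_top (s + r) a' b'"
      using near overlap_bounds[OF o] P pos i(2,3) by simp_all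
    moreover have "odd (a' + b')" using i(3) by presburger
    ultimately have False
      using o i(1,2) by (intro overlap_even_odd[of "s + r" a b a' b' i s r]) (auto simp: overlap_def)
    then show "P c d" ..
  next
    fix a b a' b' i c d
    assume o: "overlap s r a b a' b' i c d" and P: "P a b" "P a' b'" and i: "even i" "(a + b) mod 4 = 1" "(a' + b') mod 4 = 3"
    have od: "odd (a + b)" "odd (a' + b')" using i(2,3) by presburger+
    consider "a = 0" "a' = 0" | "0 < a'" | "a' = 0" "0 < a" by blast
    then show "P c d"
    proof cases
      case 1
      then have "c = 0" using o by (simp add: overlap_def)
      then show ?thesis using null[OF overlap_bounds(6)[OF o]] by simp
    next
      case 2
      have n: "near_top (s + r) a' b'" using near overlap_bounds[OF o] P 2 i(3) by simp
      then have "a' + b' < s + r \<and> a' \<le> 2 \<and> s + r \<le> a' + b' + 2 \<and> (i = 0 \<and> a + b = 1 \<or> i = 2 \<and> a + b = 3 \<and> a' = 2)"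
        using o i(1) od by (intro overlap_odd_odd[of _ _ _ a b _ s r]) (auto simp: overlap_def)
      then have *: "i = 0" "a + b = 1" "a' + b' < s + r" using i(2) by auto
      then have "c = a' + a" "d = b' + b" using o by (auto simp: overlap_def)
      then show "P c d" using add[OF _ _ 2 n *(3) i(3) P(2) *(2) P(1)] overlap_bounds(5,6)[OF o] by simp
    next
      case 3
      have "near_top (s + r) a b" using near overlap_bounds[OF o] P 3 i(2) by simp
      then have "a + b < s + r \<and> a \<le> 2 \<and> s + r \<le> a + b + 2 \<and> (i = 0 \<and> a' + b' = 1 \<or> i = 2 \<and> a' + b' = 3 \<and> a = 2)"
        using o i(1) od by (intro overlap_odd_odd[of _ _ _ a' b' _ s r]) (auto simp: overlap_def)
      then show ?thesis using i(3) 3 o by (auto simp: overlap_def)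
    qed
  qed (use free in auto)
qed

lemma closed_A01:
  "commutator_closed s r (tangent_type (\<lambda>a b. commuting_type (s + r) 1 False a b)
    (\<lambda>a b. True))"
  by (rule commutator_closed_A; simp add: tangent_type_def commuting_types near_top_def; linarith?)

lemma closed_A23:
  "commutator_closed s r (tangent_type (\<lambda>a b. commuting_type (s + r) 2 False a b \<and> commuting_type (s + r) 3 False a b)
    (\<lambda>a b. True))"
  by (rule commutator_closed_A; simp add: tangent_type_def commuting_types near_top_def; linarith?)

lemma closed_A12c:
  "commutator_closed s r (tangent_type (\<lambda>a b. commuting_type (s + r) 1 True a b \<and> commuting_type (s + r) 2 True a b)
    (\<lambda>a b. True))"
  by (rule commutator_closed_A; simp add: tangent_type_def commuting_types near_top_def; linarith?)

lemma closed_A03c: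
  "commutator_closed s r (tangent_type (\<lambda>a b. commuting_type (s + r) 3 False a b \<and> even (a + b))
    (\<lambda>a b. True))"
  by (rule commutator_closed_A; simp add: tangent_type_def commuting_types near_top_def; linarith?)

lemma closed_B12:
  "commutator_closed s r (tangent_type (\<lambda>a b. True)
    (\<lambda>a b. commuting_type (s + r) 1 False a b))"
  by (rule commutator_closed_B; simp add: tangent_type_def commuting_types near_top_def; linarith?)

lemma closed_B03:
  "commutator_closed s r (tangent_type (\<lambda>a b. True)
    (\<lambda>a b. commuting_type (s + r) 3 False a b))"
  by (rule commutator_closed_B; simp add: tangent_type_def commuting_types near_top_def; linarith?)

lemma closed_B01c:
  "commutator_closed s r (tangent_type (\<lambda>a b. True)
    (\<lambda>a b. commuting_type (s + r) 1 False a b \<and> even (a + b)))"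
  by (rule commutator_closed_B; simp add: tangent_type_def commuting_types near_top_def; linarith?)

lemma closed_B23c:
  "commutator_closed s r (tangent_type (\<lambda>a b. True)
    (\<lambda>a b. commuting_type (s + r) 2 True a b \<and> commuting_type (s + r) 3 True a b))"
  by (rule commutator_closed_B; simp add: tangent_type_def commuting_types near_top_def; linarith?)

lemma closed_Q01:
  "commutator_closed s r (tangent_type (\<lambda>a b. commuting_type (s + r) 4 False a b)
    (\<lambda>a b. commuting_type (s + r) 1 True a b))"
  by (rule commutator_closed_Q; simp add: tangent_type_def commuting_types near_top_def; linarith?)

lemma closed_Q23:
  "commutator_closed s r (tangent_type (\<lambda>a b. commuting_type (s + r) 2 False a b)
    (\<lambda>a b. commuting_type (s + r) 3 True a b))"
  by (rule commutator_closed_Q; simp add: tangent_type_def commuting_types near_top_def; linarith?)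

lemma closed_Q12:
  "commutator_closed s r (tangent_type (\<lambda>a b. commuting_type (s + r) 1 True a b)
    (\<lambda>a b. commuting_type (s + r) 2 False a b))"
  by (rule commutator_closed_Q; simp add: tangent_type_def commuting_types near_top_def; linarith?)

lemma closed_Q03:
  "commutator_closed s r (tangent_type (\<lambda>a b. commuting_type (s + r) 3 True a b)
    (\<lambda>a b. commuting_type (s + r) 4 False a b))"
  by (rule commutator_closed_Q; simp add: tangent_type_def commuting_types near_top_def; linarith?)

section \<open>Dimensions\<close>

lemma card_type_sets_bidegree:
  "card (type_sets p q r (\<lambda>a b. a = k \<and> b = l)) = (p + q choose k) * (r choose l)"
proof -
  let ?S = "{1..p + q}" and ?N = "{p + q + 1..p + q + r}"
  have disj: "?S \<inter> ?N = {}" "?S \<union> ?N = {1..p + q + r}" by auto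
  have "bij_betw (\<lambda>A. (A \<inter> ?S, A - ?S)) (type_sets p q r (\<lambda>a b. a = k \<and> b = l))
      ({B. B \<subseteq> ?S \<and> card B = k} \<times> {C. C \<subseteq> ?N \<and> card C = l})"
  proof (rule bij_betw_byWitness[where f' = "\<lambda>(B, C). B \<union> C"])
    show "\<forall>A\<in>type_sets p q r (\<lambda>a b. a = k \<and> b = l). (case (A \<inter> ?S, A - ?S) of (B, C) \<Rightarrow> B \<union> C) = A"
      by auto
    show "\<forall>X\<in>{B. B \<subseteq> ?S \<and> card B = k} \<times> {C. C \<subseteq> ?N \<and> card C = l}.
        ((case X of (B, C) \<Rightarrow> B \<union> C) \<inter> ?S, (case X of (B, C) \<Rightarrow> B \<union> C) - ?S) = X"
    proof
      fix X assume "X \<in> {B. B \<subseteq> ?S \<and> card B = k} \<times> {C. C \<subseteq> ?N \<and> card C = l}"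
      then obtain B C where X: "X = (B, C)" and "B \<subseteq> ?S" "C \<subseteq> ?N" by blast
      then have "(B \<union> C) \<inter> ?S = B" "(B \<union> C) - ?S = C" using disj by blast+
      then show "((case X of (B, C) \<Rightarrow> B \<union> C) \<inter> ?S, (case X of (B, C) \<Rightarrow> B \<union> C) - ?S) = X"
        unfolding X by simp
    qed
    show "(\<lambda>A. (A \<inter> ?S, A - ?S)) ` type_sets p q r (\<lambda>a b. a = k \<and> b = l) \<subseteq>
        {B. B \<subseteq> ?S \<and> card B = k} \<times> {C. C \<subseteq> ?N \<and> card C = l}"
      unfolding type_sets_def using disj by auto
    show "(\<lambda>(B, C). B \<union> C) ` ({B. B \<subseteq> ?S \<and> card B = k} \<times> {C. C \<subseteq> ?N \<and> card C = l}) \<subseteq>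
        type_sets p q r (\<lambda>a b. a = k \<and> b = l)"
    proof (rule image_subsetI)
      fix X assume "X \<in> {B. B \<subseteq> ?S \<and> card B = k} \<times> {C. C \<subseteq> ?N \<and> card C = l}"
      then obtain B C where X: "X = (B, C)" and BC: "B \<subseteq> ?S" "C \<subseteq> ?N" and c: "card B = k" "card C = l" by blast
      have "(B \<union> C) \<inter> ?S = B" "(B \<union> C) - ?S = C" "B \<union> C \<in> Pow {1..p + q + r}" using BC disj by blast+
      then show "(case X of (B, C) \<Rightarrow> B \<union> C) \<in> type_sets p q r (\<lambda>a b. a = k \<and> b = l)"
        unfolding X type_sets_def using c by simp
    qed
  qed
  then have "card (type_sets p q r (\<lambda>a b. a = k \<and> b = l)) =
      card ({B. B \<subseteq> ?S \<and> card B = k} \<times> {C. C \<subseteq> ?N \<and> card C = l})"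
    by (rule bij_betw_same_card)
  then show ?thesis by (simp add: card_cartesian_product n_subsets)
qed

text \<open>
  Integer arguments, because the bidegrees of the theorem become negative for small \<open>n\<close>; the dimension is 0 then.
\<close>

definition bidegree_dim :: "nat \<Rightarrow> nat \<Rightarrow> int \<Rightarrow> int \<Rightarrow> nat" where
  "bidegree_dim s r k l = (if k < 0 \<or> l < 0 then 0 else (s choose nat k) * (r choose nat l))"

lemma card_type_sets_int_bidegree:
  "card (type_sets p q r (\<lambda>a b. int a = k \<and> int b = l)) = bidegree_dim (p + q) r k l"
proof (cases "k < 0 \<or> l < 0")
  case True
  then have "type_sets p q r (\<lambda>a b. int a = k \<and> int b = l) = {}" by (auto simp: type_sets_def)
  then show ?thesis using True by (auto simp: bidegree_dim_def)
next
  case False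
  then have "(\<lambda>a b. int a = k \<and> int b = l) = (\<lambda>a b. a = nat k \<and> b = nat l)" by (auto simp: fun_eq_iff)
  then show ?thesis using False by (simp add: bidegree_dim_def card_type_sets_bidegree)
qed

lemma real_choose_two: "real (k choose 2) = real k * (real k - 1) / 2"
proof -
  have "even (k * (k - 1))" by (cases k) auto
  then have "2 * (k choose 2) = k * (k - 1)" by (simp add: choose_two)
  then have "2 * real (k choose 2) = real (k * (k - 1))" by (metis of_nat_mult of_nat_numeral)
  also have "real (k * (k - 1)) = real k * (real k - 1)" by (cases k) (auto simp: algebra_simps)
  finally show ?thesis by simp
qed

lemma choose_top:
  "1 \<le> r \<Longrightarrow> real (r choose (r - 1)) = real r"
  "2 \<le> r \<Longrightarrow> real (r choose (r - 2)) = real r * (real r - 1) / 2"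
  using binomial_symmetric[of 1 r] binomial_symmetric[of 2 r] real_choose_two[of r] by simp_all

lemma bidegree_dim_low:
  "real (bidegree_dim s r 0 l) = real (bidegree_dim 0 r 0 l)"
  "real (bidegree_dim s r 1 l) = real s * real (bidegree_dim 0 r 0 l)"
  "real (bidegree_dim s r 2 l) = real s * (real s - 1) / 2 * real (bidegree_dim 0 r 0 l)"
  by (simp_all add: bidegree_dim_def real_choose_two)

text \<open>
  The polynomial values hold for all \<open>r\<close>, including those where the second argument is negative.
\<close>

lemma bidegree_dim_top:
  "real (bidegree_dim 0 r 0 (int r)) = 1"
  "real (bidegree_dim 0 r 0 (int r - 1)) = real r"
  "real (bidegree_dim 0 r 0 (int r - 2)) = real r * (real r - 1) / 2"
proof -
  show "real (bidegree_dim 0 r 0 (int r)) = 1" by (simp add: bidegree_dim_def)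
  show "real (bidegree_dim 0 r 0 (int r - 1)) = real r"
    using choose_top(1)[of r] by (cases "1 \<le> r") (auto simp: bidegree_dim_def nat_diff_distrib)
  show "real (bidegree_dim 0 r 0 (int r - 2)) = real r * (real r - 1) / 2"
  proof (cases "2 \<le> r")
    case True
    then have "\<not> int r - 2 < 0" "nat (int r - 2) = r - 2" by linarith+
    then show ?thesis using choose_top(2)[OF True] by (simp add: bidegree_dim_def)
  next
    case False
    then have "r = 0 \<or> r = 1" by linarith
    then show ?thesis by (auto simp: bidegree_dim_def)
  qed
qed

lemma bidegree_dim_values:
  "real (bidegree_dim s r 0 (int r)) = 1"
  "real (bidegree_dim s r 0 (int r - 1)) = real r"
  "real (bidegree_dim s r 0 (int r - 2)) = real r * (real r - 1) / 2"
  "real (bidegree_dim s r 1 (int r)) = real s"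
  "real (bidegree_dim s r 1 (int r - 1)) = real s * real r"
  "real (bidegree_dim s r 1 (int r - 2)) = real s * (real r * (real r - 1) / 2)"
  "real (bidegree_dim s r 2 (int r)) = real s * (real s - 1) / 2"
  "real (bidegree_dim s r 2 (int r - 1)) = real s * (real s - 1) / 2 * real r"
  "real (bidegree_dim s r 2 (int r - 2)) = real s * (real s - 1) / 2 * (real r * (real r - 1) / 2)"
  using bidegree_dim_low[of s r] bidegree_dim_top[of r] by (simp_all only: mult_1_right)

lemma bidegree_dim_full: "bidegree_dim s r (int s) (int r) = 1"
  by (simp add: bidegree_dim_def)

lemma card_subsets_insert:
  assumes "finite S" "x \<notin> S"
  shows "card {A. A \<subseteq> insert x S \<and> P (card A)} =
    card {A. A \<subseteq> S \<and> P (card A)} + card {A. A \<subseteq> S \<and> P (Suc (card A))}"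
proof -
  have fin: "finite A" if "A \<subseteq> S" for A using that assms finite_subset by blast
  have "{A. A \<subseteq> insert x S \<and> P (card A)} =
      {A. A \<subseteq> S \<and> P (card A)} \<union> insert x ` {A. A \<subseteq> S \<and> P (Suc (card A))}"
    (is "?L = ?M \<union> ?N")
  proof
    show "?L \<subseteq> ?M \<union> ?N"
    proof
      fix A assume A: "A \<in> ?L"
      show "A \<in> ?M \<union> ?N"
      proof (cases "x \<in> A")
        case True
        have "A - {x} \<subseteq> S" using A by auto
        moreover have "card A = Suc (card (A - {x}))"
          using True A finite_subset[of A "insert x S"] assms(1) by (intro card.remove) auto
        ultimately have "A - {x} \<in> {A. A \<subseteq> S \<and> P (Suc (card A))}" using A by simp
        moreover have "A = insert x (A - {x})" using True by auto
        ultimately show ?thesis by (intro UnI2 image_eqI)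
      next
        case False
        then show ?thesis using A by auto
      qed
    qed
    show "?M \<union> ?N \<subseteq> ?L"
    proof
      fix A assume "A \<in> ?M \<union> ?N"
      then show "A \<in> ?L"
      proof
        assume "A \<in> ?N"
        then obtain B where B: "B \<subseteq> S" "P (Suc (card B))" "A = insert x B" by auto
        then have "x \<notin> B" "finite B" using fin assms(2) by blast+
        then have "card A = Suc (card B)" using B(3) by simp
        then show ?thesis using B by auto
      qed auto
    qed
  qed
  also have "card \<dots> = card {A. A \<subseteq> S \<and> P (card A)} + card (insert x ` {A. A \<subseteq> S \<and> P (Suc (card A))})"
    using assms by (intro card_Un_disjoint) auto
  also have "card (insert x ` {A. A \<subseteq> S \<and> P (Suc (card A))}) = card {A. A \<subseteq> S \<and> P (Suc (card A))}"
    using assms(2) by (intro card_image) (auto simp: inj_on_def)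
  finally show ?thesis .
qed

text \<open>
  Adding an element to the set shifts the residue in half of the subsets.  With the angle \<open>\<pi> N / 4\<close>, the
  resulting recursion is the multiplication by \<open>1 + i = \<surd>2 (cos (\<pi> / 4) + i sin (\<pi> / 4))\<close>.  It starts
  with one element; for the empty set the term \<open>2\<^sup>N\<^sup>-\<^sup>2\<close>, a quarter of the number of subsets, would be wrong.
\<close>

lemma card_subsets_mod4:
  fixes S :: "nat set"
  assumes "finite S" "S \<noteq> {}"
  defines "c \<equiv> \<lambda>j. real (card {A. A \<subseteq> S \<and> card A mod 4 = j})"
    and "N \<equiv> real (card S)"
  shows "c 0 = 2 powr (N - 2) + 2 powr (N / 2 - 1) * cos (pi * N / 4)"
    and "c 1 = 2 powr (N - 2) + 2 powr (N / 2 - 1) * sin (pi * N / 4)"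
    and "c 2 = 2 powr (N - 2) - 2 powr (N / 2 - 1) * cos (pi * N / 4)"
    and "c 3 = 2 powr (N - 2) - 2 powr (N / 2 - 1) * sin (pi * N / 4)"
proof -
  have "real (card {A. A \<subseteq> S \<and> card A mod 4 = 0}) =
      2 powr (real (card S) - 2) + 2 powr (real (card S) / 2 - 1) * cos (pi * real (card S) / 4) \<and>
    real (card {A. A \<subseteq> S \<and> card A mod 4 = 1}) =
      2 powr (real (card S) - 2) + 2 powr (real (card S) / 2 - 1) * sin (pi * real (card S) / 4) \<and>
    real (card {A. A \<subseteq> S \<and> card A mod 4 = 2}) =
      2 powr (real (card S) - 2) - 2 powr (real (card S) / 2 - 1) * cos (pi * real (card S) / 4) \<and>
    real (card {A. A \<subseteq> S \<and> card A mod 4 = 3}) =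
      2 powr (real (card S) - 2) - 2 powr (real (card S) / 2 - 1) * sin (pi * real (card S) / 4)"
    using assms(1,2)
  proof (induction S rule: finite_ne_induct)
    case (singleton x)
    have "card {A. A \<subseteq> {x} \<and> P (card A)} = (if P 0 then 1 else 0) + (if P 1 then 1 else 0)" for P :: "nat \<Rightarrow> bool"
    proof -
      have "{A :: nat set. A \<subseteq> {} \<and> P (card A)} = (if P 0 then {{}} else {})"
        "{A :: nat set. A \<subseteq> {} \<and> P (Suc (card A))} = (if P 1 then {{}} else {})" by auto
      then show ?thesis using card_subsets_insert[of "{}" x P] by simp
    qed
    note * = this[of "\<lambda>k. k mod 4 = _"]
    have "(2 :: real) powr (1 / 2 - 1) = 1 / sqrt 2"
      by (simp add: powr_minus powr_half_sqrt field_simps)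
    then have "(2 :: real) powr (1 / 2 - 1) * (sqrt 2 / 2) = 1 / 2" by simp
    moreover have "(2 :: real) powr (1 - 2) = 1 / 2" by (simp add: powr_minus)
    ultimately show ?case unfolding * by (simp add: cos_45 sin_45)
  next
    case (insert x S)
    let ?N = "real (card S)"
    have N: "real (card (insert x S)) = ?N + 1" using insert by simp
    have rec: "card {A. A \<subseteq> insert x S \<and> card A mod 4 = j} =
        card {A. A \<subseteq> S \<and> card A mod 4 = j} + card {A. A \<subseteq> S \<and> Suc (card A) mod 4 = j}" for j
      using card_subsets_insert[of S x "\<lambda>k. k mod 4 = j"] insert by simp
    have suc: "Suc k mod 4 = 0 \<longleftrightarrow> k mod 4 = 3" "Suc k mod 4 = 1 \<longleftrightarrow> k mod 4 = 0"
      "Suc k mod 4 = 2 \<longleftrightarrow> k mod 4 = 1" "Suc k mod 4 = 3 \<longleftrightarrow> k mod 4 = 2" for k :: nat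
      by presburger+
    define E where "E = (2 :: real) powr (?N - 2)"
    define F where "F = (2 :: real) powr (?N / 2 - 1)"
    have E: "2 powr (?N + 1 - 2) = 2 * E"
      unfolding E_def by (simp add: powr_add[symmetric] powr_mult_base)
    have half: "(?N + 1) / 2 - 1 = 1 / 2 + (?N / 2 - 1)" by (simp add: field_simps)
    have F: "2 powr ((?N + 1) / 2 - 1) = sqrt 2 * F"
      unfolding F_def half powr_add by (simp add: powr_half_sqrt)
    have arg: "pi * (?N + 1) / 4 = pi * ?N / 4 + pi / 4" by (simp add: field_simps)
    have trig: "sqrt 2 * F * cos (pi * (?N + 1) / 4) = F * (cos (pi * ?N / 4) - sin (pi * ?N / 4))"
      "sqrt 2 * F * sin (pi * (?N + 1) / 4) = F * (sin (pi * ?N / 4) + cos (pi * ?N / 4))"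
    proof -
      have ring: "sqrt 2 * F * (u * h + v * h) = (sqrt 2 * h) * (F * (u + v))"
        "sqrt 2 * F * (u * h - v * h) = (sqrt 2 * h) * (F * (u - v))" for u v h :: real
        by (simp_all add: algebra_simps)
      have "sqrt 2 * (sqrt 2 / 2) = 1" by simp
      then show "sqrt 2 * F * cos (pi * (?N + 1) / 4) = F * (cos (pi * ?N / 4) - sin (pi * ?N / 4))"
        "sqrt 2 * F * sin (pi * (?N + 1) / 4) = F * (sin (pi * ?N / 4) + cos (pi * ?N / 4))"
        unfolding arg cos_add sin_add cos_45 sin_45 ring by simp_all
    qed
    show ?case
      using insert.IH unfolding rec suc N E F trig E_def[symmetric] F_def[symmetric]
      by (simp add: algebra_simps)
  qed
  then show "c 0 = 2 powr (N - 2) + 2 powr (N / 2 - 1) * cos (pi * N / 4)"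
    "c 1 = 2 powr (N - 2) + 2 powr (N / 2 - 1) * sin (pi * N / 4)"
    "c 2 = 2 powr (N - 2) - 2 powr (N / 2 - 1) * cos (pi * N / 4)"
    "c 3 = 2 powr (N - 2) - 2 powr (N / 2 - 1) * sin (pi * N / 4)"
    unfolding c_def N_def by blast+
qed

lemma card_disj:
  assumes "finite S" "\<And>k. \<not> (P k \<and> Q k)"
  shows "card {A. A \<subseteq> S \<and> (P (card A) \<or> Q (card A))} =
    card {A. A \<subseteq> S \<and> P (card A)} + card {A. A \<subseteq> S \<and> Q (card A)}"
proof -
  have "{A. A \<subseteq> S \<and> (P (card A) \<or> Q (card A))} = {A. A \<subseteq> S \<and> P (card A)} \<union> {A. A \<subseteq> S \<and> Q (card A)}"
    by auto
  then show ?thesis using assms by (simp add: card_Un_disjoint disjoint_iff)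
qed

lemma dim_null_0: "real (card (type_sets p q r (\<lambda>a b. a = 0 \<and> b mod 4 = 0))) = lambda_const r"
proof (cases "r = 0")
  case True
  have "{A. A \<subseteq> ({} :: nat set) \<and> card A mod 4 = 0} = {{}}" by auto
  then show ?thesis using True by (simp add: type_sets_null lambda_const_def)
next
  case False
  then show ?thesis
    using card_subsets_mod4(1)[of "{p + q + 1..p + q + r}"] by (simp add: type_sets_null lambda_const_def)
qed

lemma dim_null_013:
  "real (card (type_sets p q r (\<lambda>a b. a = 0 \<and> (b mod 4 = 0 \<or> b mod 4 = 1 \<or> b mod 4 = 3)))) = mu_const r"
proof (cases "r = 0")
  case True
  have "{A. A \<subseteq> ({} :: nat set) \<and> (card A mod 4 = 0 \<or> card A mod 4 = 1 \<or> card A mod 4 = 3)} = {{}}" by auto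
  then show ?thesis using True by (simp add: type_sets_null mu_const_def)
next
  case False
  let ?S = "{p + q + 1..p + q + r}"
  have "card {A. A \<subseteq> ?S \<and> (card A mod 4 = 0 \<or> card A mod 4 = 1 \<or> card A mod 4 = 3)} =
      card {A. A \<subseteq> ?S \<and> card A mod 4 = 0} + card {A. A \<subseteq> ?S \<and> (card A mod 4 = 1 \<or> card A mod 4 = 3)}"
    by (rule card_disj) auto
  also have "card {A. A \<subseteq> ?S \<and> (card A mod 4 = 1 \<or> card A mod 4 = 3)} =
      card {A. A \<subseteq> ?S \<and> card A mod 4 = 1} + card {A. A \<subseteq> ?S \<and> card A mod 4 = 3}"
    by (rule card_disj) auto
  finally have "card {A. A \<subseteq> ?S \<and> (card A mod 4 = 0 \<or> card A mod 4 = 1 \<or> card A mod 4 = 3)} =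
      card {A. A \<subseteq> ?S \<and> card A mod 4 = 0} +
      (card {A. A \<subseteq> ?S \<and> card A mod 4 = 1} + card {A. A \<subseteq> ?S \<and> card A mod 4 = 3})" .
  then show ?thesis
    using False card_subsets_mod4[of ?S] by (simp add: type_sets_null mu_const_def)
qed

lemma dim_total:
  assumes "1 \<le> p + q + r"
  defines "n \<equiv> real (p + q + r)"
  shows "real (card (type_sets p q r (\<lambda>a b. (a + b) mod 4 = 2 \<or> (a + b) mod 4 = 3))) =
      2 powr (n - 1) - 2 powr (n / 2 - 1) * (cos (pi * n / 4) + sin (pi * n / 4))" (is ?A)
    and "real (card (type_sets p q r (\<lambda>a b. (a + b) mod 4 = 1 \<or> (a + b) mod 4 = 2))) =
      2 powr (n - 1) + 2 powr (n / 2 - 1) * (sin (pi * n / 4) - cos (pi * n / 4))" (is ?B)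
    and "real (card (type_sets p q r (\<lambda>a b. (a + b) mod 4 = 2))) =
      2 powr (n - 2) - 2 powr (n / 2 - 1) * cos (pi * n / 4)" (is ?C)
proof -
  let ?S = "{1..p + q + r}"
  have ne: "finite ?S" "?S \<noteq> {}" using assms by auto
  have n: "real (card ?S) = n" by (simp add: n_def)
  note c = card_subsets_mod4[OF ne, unfolded n]
  have p: "(2 :: real) powr (n - 1) = 2 * 2 powr (n - 2)"
    by (simp add: powr_mult_base)
  have "card {A. A \<subseteq> ?S \<and> (card A mod 4 = 2 \<or> card A mod 4 = 3)} =
      card {A. A \<subseteq> ?S \<and> card A mod 4 = 2} + card {A. A \<subseteq> ?S \<and> card A mod 4 = 3}"
    by (rule card_disj) auto
  then show ?A unfolding type_sets_total[of p q r "\<lambda>k. k mod 4 = 2 \<or> k mod 4 = 3"] p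
    using c by (simp add: algebra_simps)
  have "card {A. A \<subseteq> ?S \<and> (card A mod 4 = 1 \<or> card A mod 4 = 2)} =
      card {A. A \<subseteq> ?S \<and> card A mod 4 = 1} + card {A. A \<subseteq> ?S \<and> card A mod 4 = 2}"
    by (rule card_disj) auto
  then show ?B unfolding type_sets_total[of p q r "\<lambda>k. k mod 4 = 1 \<or> k mod 4 = 2"] p
    using c by (simp add: algebra_simps)
  show ?C unfolding type_sets_total[of p q r "\<lambda>k. k mod 4 = 2"] using c by simp
qed

section \<open>Lie algebras with finitely many exceptional bidegrees\<close>

abbreviation bidegree :: "nat \<Rightarrow> nat \<Rightarrow> nat \<Rightarrow> int \<times> int \<Rightarrow> 'f::field mv set" where
  "bidegree p q r kl \<equiv> coord (type_sets p q r (\<lambda>a b. (int a, int b) = kl))"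

lemma bidegree_eqs:
  "mixed p q r k l = bidegree p q r (k, l)"
  "grassmann p q r l = bidegree p q r (0, l)"
  "grade p q r (int (p + q + r)) = bidegree p q r (int (p + q), int r)"
proof -
  have "type_sets p q r (\<lambda>a b. int (a + b) = int (p + q + r)) =
      type_sets p q r (\<lambda>a b. (int a, int b) = (int (p + q), int r))"
    unfolding type_sets_def
  proof (intro Collect_cong conj_cong refl)
    fix A assume "A \<in> Pow {1..p + q + r}"
    from card_bounds[OF this]
    show "int (card (A \<inter> {1..p + q}) + card (A - {1..p + q})) = int (p + q + r) \<longleftrightarrow>
      (int (card (A \<inter> {1..p + q})), int (card (A - {1..p + q}))) = (int (p + q), int r)"
      unfolding of_nat_eq_iff prod.inject by (intro iffI conjI) linarith+
  qed
  then show "grade p q r (int (p + q + r)) = bidegree p q r (int (p + q), int r)" by (simp only: grade_eq)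
qed (simp_all add: mixed_eq grassmann_eq)

lemma card_bidegree:
  "card (type_sets p q r (\<lambda>a b. (int a, int b) = kl)) = bidegree_dim (p + q) r (fst kl) (snd kl)"
  by (cases kl) (simp add: card_type_sets_int_bidegree)

lemma lie_algebra_is_extras:
  fixes G :: "'f::{real_normed_field,banach} mv set"
  assumes G: "lie_algebra G = coord (type_sets p q r P)"
    and closed: "commutator_closed (p + q) r P"
    and P: "\<And>a b. a \<le> p + q \<Longrightarrow> b \<le> r \<Longrightarrow> P a b \<longleftrightarrow> Q1 a b \<or> Q2 a b \<or> (int a, int b) \<in> set ks"
    and base: "U1 = coord (type_sets p q r Q1)" "U2 = coord (type_sets p q r Q2)" "\<And>a b. \<not> (Q1 a b \<and> Q2 a b)"
    and ks: "distinct ks" "\<And>a b. (int a, int b) \<in> set ks \<Longrightarrow> \<not> Q1 a b \<and> \<not> Q2 a b"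
    and d: "d = real (card (type_sets p q r Q1)) + real (card (type_sets p q r Q2)) +
      (\<Sum>kl\<leftarrow>ks. real (bidegree_dim (p + q) r (fst kl) (snd kl)))"
  shows "lie_algebra_is p q r G ([U1, U2] @ map (bidegree p q r) ks) d"
proof (rule lie_algebra_is_types[OF G closed])
  let ?Qs = "[Q1, Q2] @ map (\<lambda>kl a b. (int a, int b) = kl) ks"
  show "list_all2 (\<lambda>U Q. U = coord (type_sets p q r Q)) ([U1, U2] @ map (bidegree p q r) ks) ?Qs"
    using base by (simp add: list_all2_map1 list_all2_map2 list_all2_same)
  show "P a b \<longleftrightarrow> (\<exists>Q\<in>set ?Qs. Q a b)" if "a \<le> p + q" "b \<le> r" for a b
    using P[OF that] by auto
  show "sorted_wrt (\<lambda>Q Q'. \<forall>a\<le>p + q. \<forall>b\<le>r. \<not> (Q a b \<and> Q' a b)) ?Qs"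
  proof -
    have "sorted_wrt (\<lambda>x y. x \<noteq> y) xs" if "distinct xs" for xs :: "(int \<times> int) list"
      using that by (induction xs) auto
    from this[OF ks(1)] have "sorted_wrt (\<lambda>Q Q'. \<forall>a\<le>p + q. \<forall>b\<le>r. \<not> (Q a b \<and> Q' a b)) (map (\<lambda>kl a b. (int a, int b) = kl) ks)"
      unfolding sorted_wrt_map by (rule sorted_wrt_mono_rel[rotated]) auto
    then show ?thesis using base(3) ks(2) by auto
  qed
  show "d = (\<Sum>Q\<leftarrow>?Qs. real (card (type_sets p q r Q)))"
    unfolding d by (simp add: o_def card_bidegree)
qed


lemma int_mod4_iff:
  "int k mod 4 = 0 \<longleftrightarrow> k mod 4 = 0" "int k mod 4 = 1 \<longleftrightarrow> k mod 4 = 1"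
  "int k mod 4 = 2 \<longleftrightarrow> k mod 4 = 2" "int k mod 4 = 3 \<longleftrightarrow> k mod 4 = 3"
proof -
  have "int k mod 4 = int (k mod 4)" by (simp add: of_nat_mod)
  then show "int k mod 4 = 0 \<longleftrightarrow> k mod 4 = 0" "int k mod 4 = 1 \<longleftrightarrow> k mod 4 = 1"
    "int k mod 4 = 2 \<longleftrightarrow> k mod 4 = 2" "int k mod 4 = 3 \<longleftrightarrow> k mod 4 = 3"
    by (simp_all only: of_nat_eq_0_iff of_nat_eq_1_iff of_nat_eq_numeral_iff)
qed

text \<open>
  Codegrees from 4 on are irrelevant near the top, hence the residue of \<open>n\<close> practically determines the
  codegree of an element of known grade modulo 4.
\<close>

lemma gap_cases:
  assumes "a + b + e = n" "n mod 4 = (m :: nat)" "(a + b) mod 4 = j"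
  shows "e = (m + (4 - j)) mod 4 \<or> 4 \<le> e"
proof -
  have j: "j < 4" using assms(3) by auto
  have "m = (j + e) mod 4" using assms by (metis mod_add_left_eq)
  then have "(m + (4 - j)) mod 4 = (j + e + (4 - j)) mod 4" by (simp add: mod_add_left_eq)
  also have "j + e + (4 - j) = e + 4" using j by simp
  finally have "(m + (4 - j)) mod 4 = e mod 4" by simp
  then show ?thesis by (cases "e < 4") auto
qed

text \<open>
  An exceptional bidegree is recorded by its number of non-null generators and its codegree, that is, the number of
  missing generators.  In these terms it does not depend on \<open>r\<close>.
\<close>

definition bidegree_of :: "nat \<Rightarrow> nat \<times> nat \<Rightarrow> int \<times> int" where
  "bidegree_of n ke = (int (fst ke), int n - int (fst ke) - int (snd ke))"

lemma in_bidegrees_iff: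
  "(int a, int b) \<in> set (map (bidegree_of n) kes) \<longleftrightarrow> (\<exists>e. a + b + e = n \<and> (a, e) \<in> set kes)"
proof
  assume "(int a, int b) \<in> set (map (bidegree_of n) kes)"
  then obtain k e where "(k, e) \<in> set kes" "int a = int k" "int b = int n - int k - int e"
    by (auto simp: bidegree_of_def)
  then have "(a, e) \<in> set kes" "a + b + e = n" by simp_all
  then show "\<exists>e. a + b + e = n \<and> (a, e) \<in> set kes" by blast
next
  assume "\<exists>e. a + b + e = n \<and> (a, e) \<in> set kes"
  then obtain e where "a + b + e = n" "(a, e) \<in> set kes" by blast
  then have "(int a, int b) = bidegree_of n (a, e)" by (auto simp: bidegree_of_def)
  then show "(int a, int b) \<in> set (map (bidegree_of n) kes)"
    using \<open>(a, e) \<in> set kes\<close> by (metis image_eqI list.set_map)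
qed

text \<open>
  \<open>D a j\<close> describes the part common to the family: whether elements with \<open>a\<close> non-null generators and grade
  \<open>j\<close> modulo 4 belong to it.  The inequality \<open>p + q \<le> a + e\<close> says that the \<open>e\<close> missing generators
  include the missing non-null ones.
\<close>

lemma lie_algebra_is_codegrees:
  fixes G :: "'f::{real_normed_field,banach} mv set" and p q r :: nat
  defines "n \<equiv> p + q + r"
  assumes G: "lie_algebra G = coord (type_sets p q r (tangent_type (P n) (P' n)))"
    and closed: "commutator_closed (p + q) r (tangent_type (P n) (P' n))"
    and m: "n mod 4 = m"
    and base: "U1 = coord (type_sets p q r Q1)" "U2 = coord (type_sets p q r Q2)"
      "\<And>a b. \<not> (Q1 a b \<and> Q2 a b)" "\<And>a b. Q1 a b \<or> Q2 a b \<longleftrightarrow> D a ((a + b) mod 4)"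
    and two: "\<And>a. D a 2"
    and zero: "\<And>a b e. a \<le> p + q \<Longrightarrow> p + q \<le> a + e \<Longrightarrow> e = (m + 4) mod 4 \<or> 4 \<le> e \<Longrightarrow> even (a + b) \<Longrightarrow>
      P (a + b + e) a b \<and> P' (a + b + e) a b \<longleftrightarrow> D a 0 \<or> (a, e) \<in> set kes"
    and one: "\<And>a b e. a \<le> p + q \<Longrightarrow> p + q \<le> a + e \<Longrightarrow> e = (m + 3) mod 4 \<or> 4 \<le> e \<Longrightarrow> odd (a + b) \<Longrightarrow>
      P (a + b + e) a b \<longleftrightarrow> D a 1 \<or> (a, e) \<in> set kes"
    and three: "\<And>a b e. a \<le> p + q \<Longrightarrow> p + q \<le> a + e \<Longrightarrow> e = (m + 1) mod 4 \<or> 4 \<le> e \<Longrightarrow> odd (a + b) \<Longrightarrow>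
      P' (a + b + e) a b \<longleftrightarrow> D a 3 \<or> (a, e) \<in> set kes"
    and kes: "distinct kes" "\<And>k e. (k, e) \<in> set kes \<Longrightarrow> \<not> D k ((m + 3 * e) mod 4)"
    and d: "d = real (card (type_sets p q r Q1)) + real (card (type_sets p q r Q2)) +
      (\<Sum>ke\<leftarrow>kes. real (bidegree_dim (p + q) r (fst (bidegree_of n ke)) (snd (bidegree_of n ke))))"
  shows "lie_algebra_is p q r G ([U1, U2] @ map (bidegree p q r) (map (bidegree_of n) kes)) d"
proof (rule lie_algebra_is_extras[OF G closed _ base(1-3)])
  let ?ks = "map (bidegree_of n) kes"
  have residue: "(a + b) mod 4 = (m + 3 * e) mod 4" if "a + b + e = n" for a b e
  proof -
    have "(m + 3 * e) mod 4 = (n + 3 * e) mod 4" unfolding m[symmetric] by (rule mod_add_left_eq)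
    also have "n + 3 * e = a + b + 4 * e" using that by simp
    finally show ?thesis by simp
  qed
  show "tangent_type (P n) (P' n) a b \<longleftrightarrow> Q1 a b \<or> Q2 a b \<or> (int a, int b) \<in> set ?ks"
    if ab: "a \<le> p + q" "b \<le> r" for a b
  proof -
    define e where "e = n - (a + b)"
    have e: "a + b + e = n" using ab by (simp add: e_def n_def)
    then have pos: "p + q \<le> a + e" using ab by (simp add: n_def)
    have ks: "(int a, int b) \<in> set ?ks \<longleftrightarrow> (a, e) \<in> set kes"
      unfolding in_bidegrees_iff using e by auto
    have base': "Q1 a b \<or> Q2 a b \<or> (int a, int b) \<in> set ?ks \<longleftrightarrow> D a ((a + b) mod 4) \<or> (a, e) \<in> set kes"
      using base(4) ks by blast
    note gap = gap_cases[OF e m]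
    have "(a + b) mod 4 < 4" by simp
    then consider "(a + b) mod 4 = 0" | "(a + b) mod 4 = 1" | "(a + b) mod 4 = 2" | "(a + b) mod 4 = 3"
      by linarith
    then show ?thesis
    proof cases
      case 1
      then have "even (a + b)" by presburger
      then show ?thesis
        using zero[OF ab(1) pos, of b] gap[OF 1] 1 unfolding base' e by (simp add: tangent_type_def)
    next
      case 2
      then have "odd (a + b)" by presburger
      then show ?thesis
        using one[OF ab(1) pos, of b] gap[OF 2] 2 unfolding base' e by (simp add: tangent_type_def)
    next
      case 3
      then show ?thesis using two unfolding base' by (simp add: tangent_type_def)
    next
      case 4
      then have "odd (a + b)" by presburger
      then show ?thesis
        using three[OF ab(1) pos, of b] gap[OF 4] 4 unfolding base' e by (simp add: tangent_type_def)
    qed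
  qed
  show "distinct ?ks"
    using kes(1) by (auto simp: distinct_map inj_on_def bidegree_of_def)
  show "\<not> Q1 a b \<and> \<not> Q2 a b" if mem: "(int a, int b) \<in> set ?ks" for a b
  proof -
    obtain e where "a + b + e = n" "(a, e) \<in> set kes"
      using mem unfolding in_bidegrees_iff by blast
    then show ?thesis using kes(2) residue base(4) by metis
  qed
  show "d = real (card (type_sets p q r Q1)) + real (card (type_sets p q r Q2)) +
      (\<Sum>kl\<leftarrow>?ks. real (bidegree_dim (p + q) r (fst kl) (snd kl)))"
    unfolding d by (simp add: o_def)
qed

lemma grassmann_mod4_types:
  "grassmann_mod4 p q r {0} = coord (type_sets p q r (\<lambda>a b. a = 0 \<and> b mod 4 = 0))"
  "grassmann_mod4 p q r {0, 1, 3} =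
    coord (type_sets p q r (\<lambda>a b. a = 0 \<and> (b mod 4 = 0 \<or> b mod 4 = 1 \<or> b mod 4 = 3)))"
  by (simp_all only: grassmann_mod4_eq int_mod4_iff insert_iff empty_iff simp_thms)

lemma grade_mod4_types:
  "grade_mod4 p q r {2, 3} = coord (type_sets p q r (\<lambda>a b. (a + b) mod 4 = 2 \<or> (a + b) mod 4 = 3))"
  "grade_mod4 p q r {1, 2} = coord (type_sets p q r (\<lambda>a b. (a + b) mod 4 = 1 \<or> (a + b) mod 4 = 2))"
  "grade_mod4 p q r {2} = coord (type_sets p q r (\<lambda>a b. (a + b) mod 4 = 2))"
  by (simp_all only: grade_mod4_eq int_mod4_iff insert_iff empty_iff simp_thms)

text \<open>
  A relation between spaces and codes, so that resolution along the list of spaces in the theorem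
  computes the list of exceptional bidegrees.
\<close>

definition exceptional :: "nat \<Rightarrow> nat \<Rightarrow> nat \<Rightarrow> 'f::field mv set \<Rightarrow> nat \<times> nat \<Rightarrow> bool" where
  "exceptional p q r U ke \<longleftrightarrow> U = bidegree p q r (bidegree_of (p + q + r) ke)"

lemma exceptional_map:
  "list_all2 (exceptional p q r) Vs kes \<Longrightarrow> Vs = map (bidegree p q r) (map (bidegree_of (p + q + r)) kes)"
  by (induction rule: list_all2_induct) (simp_all add: exceptional_def)

lemma exceptional_spaces:
  assumes "p + q = s"
  shows "exceptional p q r (grade p q r (int (s + r))) (s, 0)"
    and "exceptional p q r (grassmann p q r (int (s + r) - 1)) (0, 1)"
    and "exceptional p q r (grassmann p q r (int (s + r) - 2)) (0, 2)"
    and "exceptional p q r (mixed p q r 1 (int (s + r) - 1)) (1, 0)"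
    and "exceptional p q r (mixed p q r 1 (int (s + r) - 2)) (1, 1)"
    and "exceptional p q r (mixed p q r 1 (int (s + r) - 3)) (1, 2)"
    and "exceptional p q r (mixed p q r 2 (int (s + r) - 2)) (2, 0)"
    and "exceptional p q r (mixed p q r 2 (int (s + r) - 3)) (2, 1)"
    and "exceptional p q r (mixed p q r 2 (int (s + r) - 4)) (2, 2)"
  unfolding assms(1)[symmetric] exceptional_def bidegree_of_def bidegree_eqs by (simp_all add: algebra_simps)

text \<open>
  As \<open>3 = -1\<close> modulo 4, the grade of an element of codegree \<open>e\<close> is \<open>m + 3 e\<close> modulo 4.
\<close>

lemma lie_algebra_is_A:
  fixes G :: "'f::{real_normed_field,banach} mv set"
  assumes G: "lie_algebra G = coord (type_sets p q r (tangent_type (P (p + q + r)) (\<lambda>a b. True)))"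
    and closed: "commutator_closed (p + q) r (tangent_type (P (p + q + r)) (\<lambda>a b. True))"
    and s: "p + q = s" and n: "1 \<le> s + r" "(s + r) mod 4 = m"
    and Vs: "list_all2 (exceptional p q r) Vs kes"
    and zero: "\<And>a b e. a \<le> s \<Longrightarrow> s \<le> a + e \<Longrightarrow> e = (m + 4) mod 4 \<or> 4 \<le> e \<Longrightarrow> even (a + b) \<Longrightarrow>
      P (a + b + e) a b \<longleftrightarrow> a = 0 \<or> (a, e) \<in> set kes"
    and one: "\<And>a b e. a \<le> s \<Longrightarrow> s \<le> a + e \<Longrightarrow> e = (m + 3) mod 4 \<or> 4 \<le> e \<Longrightarrow> odd (a + b) \<Longrightarrow>
      P (a + b + e) a b \<longleftrightarrow> (a, e) \<in> set kes"
    and kes: "distinct kes" "\<forall>(k, e)\<in>set kes. ((m + 3 * e) mod 4 = 0 \<or> (m + 3 * e) mod 4 = 1) \<and> (k = 0 \<longrightarrow> (m + 3 * e) mod 4 \<noteq> 0)"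
    and d: "d = dim_A (s + r) r + (\<Sum>ke\<leftarrow>kes. real (bidegree_dim (s) r
      (fst (bidegree_of (s + r) ke)) (snd (bidegree_of (s + r) ke))))"
  shows "lie_algebra_is p q r G ([grassmann_mod4 p q r {0}, grade_mod4 p q r {2, 3}] @ Vs) d"
  unfolding exceptional_map[OF Vs]
proof (rule lie_algebra_is_codegrees[where m = m and P = "P" and P' = "\<lambda>n a b. True" and D = "\<lambda>a j. a = 0 \<and> j = 0 \<or> j = 2 \<or> j = 3",
      OF G closed _ grassmann_mod4_types(1) grade_mod4_types(1)])
  show "(p + q + r) mod 4 = m" using n(2) s by simp
  show "d = real (card (type_sets p q r (\<lambda>a b. a = 0 \<and> b mod 4 = 0))) +
      real (card (type_sets p q r (\<lambda>a b. (a + b) mod 4 = 2 \<or> (a + b) mod 4 = 3))) +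
      (\<Sum>ke\<leftarrow>kes. real (bidegree_dim (p + q) r (fst (bidegree_of (p + q + r) ke)) (snd (bidegree_of (p + q + r) ke))))"
    unfolding d s[symmetric] dim_null_0 dim_total(1)[OF n(1)[folded s]] dim_A_def by simp
  note zero = zero[folded s] and one = one[folded s]
  fix a b e :: nat
  assume *: "a \<le> p + q" "p + q \<le> a + e"
  show "P (a + b + e) a b \<and> True \<longleftrightarrow> (a = 0 \<and> (0::nat) = 0 \<or> (0::nat) = 2 \<or> (0::nat) = 3) \<or> (a, e) \<in> set kes"
    if "e = (m + 4) mod 4 \<or> 4 \<le> e" "even (a + b)"
    using zero[OF * that] by simp
  show "P (a + b + e) a b \<longleftrightarrow> (a = 0 \<and> (1::nat) = 0 \<or> (1::nat) = 2 \<or> (1::nat) = 3) \<or> (a, e) \<in> set kes"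
    if "e = (m + 3) mod 4 \<or> 4 \<le> e" "odd (a + b)"
    using one[OF * that] by simp
  show "True \<longleftrightarrow> (a = 0 \<and> (3::nat) = 0 \<or> (3::nat) = 2 \<or> (3::nat) = 3) \<or> (a, e) \<in> set kes"
    if "e = (m + 1) mod 4 \<or> 4 \<le> e" "odd (a + b)"
    by simp
next
  show "\<not> (k = 0 \<and> ((m + 3 * e) mod 4) = 0 \<or> ((m + 3 * e) mod 4) = 2 \<or> ((m + 3 * e) mod 4) = 3)" if "(k, e) \<in> set kes" for k e
    using kes(2) that by auto
qed (use kes(1) in auto)

lemma lie_algebra_is_B:
  fixes G :: "'f::{real_normed_field,banach} mv set"
  assumes G: "lie_algebra G = coord (type_sets p q r (tangent_type (\<lambda>a b. True) (P (p + q + r))))"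
    and closed: "commutator_closed (p + q) r (tangent_type (\<lambda>a b. True) (P (p + q + r)))"
    and s: "p + q = s" and n: "1 \<le> s + r" "(s + r) mod 4 = m"
    and Vs: "list_all2 (exceptional p q r) Vs kes"
    and zero: "\<And>a b e. a \<le> s \<Longrightarrow> s \<le> a + e \<Longrightarrow> e = (m + 4) mod 4 \<or> 4 \<le> e \<Longrightarrow> even (a + b) \<Longrightarrow>
      P (a + b + e) a b \<longleftrightarrow> a = 0 \<or> (a, e) \<in> set kes"
    and three: "\<And>a b e. a \<le> s \<Longrightarrow> s \<le> a + e \<Longrightarrow> e = (m + 1) mod 4 \<or> 4 \<le> e \<Longrightarrow> odd (a + b) \<Longrightarrow>
      P (a + b + e) a b \<longleftrightarrow> (a, e) \<in> set kes"
    and kes: "distinct kes" "\<forall>(k, e)\<in>set kes. ((m + 3 * e) mod 4 = 0 \<or> (m + 3 * e) mod 4 = 3) \<and> (k = 0 \<longrightarrow> (m + 3 * e) mod 4 \<noteq> 0)"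
    and d: "d = dim_B (s + r) r + (\<Sum>ke\<leftarrow>kes. real (bidegree_dim (s) r
      (fst (bidegree_of (s + r) ke)) (snd (bidegree_of (s + r) ke))))"
  shows "lie_algebra_is p q r G ([grassmann_mod4 p q r {0}, grade_mod4 p q r {1, 2}] @ Vs) d"
  unfolding exceptional_map[OF Vs]
proof (rule lie_algebra_is_codegrees[where m = m and P = "\<lambda>n a b. True" and P' = "P" and D = "\<lambda>a j. a = 0 \<and> j = 0 \<or> j = 1 \<or> j = 2",
      OF G closed _ grassmann_mod4_types(1) grade_mod4_types(2)])
  show "(p + q + r) mod 4 = m" using n(2) s by simp
  show "d = real (card (type_sets p q r (\<lambda>a b. a = 0 \<and> b mod 4 = 0))) +
      real (card (type_sets p q r (\<lambda>a b. (a + b) mod 4 = 1 \<or> (a + b) mod 4 = 2))) +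
      (\<Sum>ke\<leftarrow>kes. real (bidegree_dim (p + q) r (fst (bidegree_of (p + q + r) ke)) (snd (bidegree_of (p + q + r) ke))))"
    unfolding d s[symmetric] dim_null_0 dim_total(2)[OF n(1)[folded s]] dim_B_def by simp
  note zero = zero[folded s] and three = three[folded s]
  fix a b e :: nat
  assume *: "a \<le> p + q" "p + q \<le> a + e"
  show "True \<and> P (a + b + e) a b \<longleftrightarrow> (a = 0 \<and> (0::nat) = 0 \<or> (0::nat) = 1 \<or> (0::nat) = 2) \<or> (a, e) \<in> set kes"
    if "e = (m + 4) mod 4 \<or> 4 \<le> e" "even (a + b)"
    using zero[OF * that] by simp
  show "True \<longleftrightarrow> (a = 0 \<and> (1::nat) = 0 \<or> (1::nat) = 1 \<or> (1::nat) = 2) \<or> (a, e) \<in> set kes"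
    if "e = (m + 3) mod 4 \<or> 4 \<le> e" "odd (a + b)"
    by simp
  show "P (a + b + e) a b \<longleftrightarrow> (a = 0 \<and> (3::nat) = 0 \<or> (3::nat) = 1 \<or> (3::nat) = 2) \<or> (a, e) \<in> set kes"
    if "e = (m + 1) mod 4 \<or> 4 \<le> e" "odd (a + b)"
    using three[OF * that] by simp
next
  show "\<not> (k = 0 \<and> ((m + 3 * e) mod 4) = 0 \<or> ((m + 3 * e) mod 4) = 1 \<or> ((m + 3 * e) mod 4) = 2)" if "(k, e) \<in> set kes" for k e
    using kes(2) that by auto
qed (use kes(1) in auto)

lemma lie_algebra_is_Q:
  fixes G :: "'f::{real_normed_field,banach} mv set"
  assumes G: "lie_algebra G = coord (type_sets p q r (tangent_type (P (p + q + r)) (P' (p + q + r))))"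
    and closed: "commutator_closed (p + q) r (tangent_type (P (p + q + r)) (P' (p + q + r)))"
    and s: "p + q = s" and n: "1 \<le> s + r" "(s + r) mod 4 = m"
    and Vs: "list_all2 (exceptional p q r) Vs kes"
    and zero: "\<And>a b e. a \<le> s \<Longrightarrow> s \<le> a + e \<Longrightarrow> e = (m + 4) mod 4 \<or> 4 \<le> e \<Longrightarrow> even (a + b) \<Longrightarrow>
      P (a + b + e) a b \<and> P' (a + b + e) a b \<longleftrightarrow> a = 0 \<or> (a, e) \<in> set kes"
    and one: "\<And>a b e. a \<le> s \<Longrightarrow> s \<le> a + e \<Longrightarrow> e = (m + 3) mod 4 \<or> 4 \<le> e \<Longrightarrow> odd (a + b) \<Longrightarrow>
      P (a + b + e) a b \<longleftrightarrow> a = 0 \<or> (a, e) \<in> set kes"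
    and three: "\<And>a b e. a \<le> s \<Longrightarrow> s \<le> a + e \<Longrightarrow> e = (m + 1) mod 4 \<or> 4 \<le> e \<Longrightarrow> odd (a + b) \<Longrightarrow>
      P' (a + b + e) a b \<longleftrightarrow> a = 0 \<or> (a, e) \<in> set kes"
    and kes: "distinct kes" "\<forall>(k, e)\<in>set kes. (m + 3 * e) mod 4 \<noteq> 2 \<and> k \<noteq> 0"
    and d: "d = dim_Q (s + r) r + (\<Sum>ke\<leftarrow>kes. real (bidegree_dim (s) r
      (fst (bidegree_of (s + r) ke)) (snd (bidegree_of (s + r) ke))))"
  shows "lie_algebra_is p q r G ([grassmann_mod4 p q r {0, 1, 3}, grade_mod4 p q r {2}] @ Vs) d"
  unfolding exceptional_map[OF Vs]
proof (rule lie_algebra_is_codegrees[where m = m and P = "P" and P' = "P'" and D = "\<lambda>a j. a = 0 \<and> j \<noteq> 2 \<or> j = 2",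
      OF G closed _ grassmann_mod4_types(2) grade_mod4_types(3)])
  show "(p + q + r) mod 4 = m" using n(2) s by simp
  show "d = real (card (type_sets p q r (\<lambda>a b. a = 0 \<and> (b mod 4 = 0 \<or> b mod 4 = 1 \<or> b mod 4 = 3)))) +
      real (card (type_sets p q r (\<lambda>a b. (a + b) mod 4 = 2))) +
      (\<Sum>ke\<leftarrow>kes. real (bidegree_dim (p + q) r (fst (bidegree_of (p + q + r) ke)) (snd (bidegree_of (p + q + r) ke))))"
    unfolding d s[symmetric] dim_null_013 dim_total(3)[OF n(1)[folded s]] dim_Q_def by simp
  note zero = zero[folded s] and one = one[folded s] and three = three[folded s]
  fix a b e :: nat
  assume *: "a \<le> p + q" "p + q \<le> a + e"
  show "P (a + b + e) a b \<and> P' (a + b + e) a b \<longleftrightarrow> (a = 0 \<and> (0::nat) \<noteq> 2 \<or> (0::nat) = 2) \<or> (a, e) \<in> set kes"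
    if "e = (m + 4) mod 4 \<or> 4 \<le> e" "even (a + b)"
    using zero[OF * that] by simp
  show "P (a + b + e) a b \<longleftrightarrow> (a = 0 \<and> (1::nat) \<noteq> 2 \<or> (1::nat) = 2) \<or> (a, e) \<in> set kes"
    if "e = (m + 3) mod 4 \<or> 4 \<le> e" "odd (a + b)"
    using one[OF * that] by simp
  show "P' (a + b + e) a b \<longleftrightarrow> (a = 0 \<and> (3::nat) \<noteq> 2 \<or> (3::nat) = 2) \<or> (a, e) \<in> set kes"
    if "e = (m + 1) mod 4 \<or> 4 \<le> e" "odd (a + b)"
    using three[OF * that] by simp
next
  show "\<not> (k = 0 \<and> ((m + 3 * e) mod 4) \<noteq> 2 \<or> ((m + 3 * e) mod 4) = 2)" if "(k, e) \<in> set kes" for k e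
    using kes(2) that by auto
qed (use kes(1) in auto)

section \<open>The tangent spaces of the twelve groups\<close>

lemma lie_algebra_A01:
  "lie_algebra (A01 p q r :: 'f::{real_normed_field,banach} mv set) = coord (type_sets p q r
    (tangent_type (\<lambda>a b. commuting_type (p + q + r) 1 False a b)
      (\<lambda>a b. True)))"
  unfolding groups_as_norm_groups
  by (rule lie_algebra_types[OF coord_subalgebra_Z[where m = 1, unfolded of_nat_1]
      coord_subalgebra_cl])
    (simp add: commuting_types)

lemma lie_algebra_A23:
  "lie_algebra (A23 p q r :: 'f::{real_normed_field,banach} mv set) = coord (type_sets p q r
    (tangent_type (\<lambda>a b. commuting_type (p + q + r) 2 False a b \<and> commuting_type (p + q + r) 3 False a b)
      (\<lambda>a b. True)))"
  unfolding groups_as_norm_groups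
  by (rule lie_algebra_types[OF coord_subalgebra_Int[OF coord_subalgebra_Z[where m = 2, unfolded of_nat_numeral] coord_subalgebra_Z[where m = 3, unfolded of_nat_numeral]]
      coord_subalgebra_cl])
    (simp add: commuting_types)

lemma lie_algebra_A12c:
  "lie_algebra (A12c p q r :: 'f::{real_normed_field,banach} mv set) = coord (type_sets p q r
    (tangent_type (\<lambda>a b. commuting_type (p + q + r) 1 True a b \<and> commuting_type (p + q + r) 2 True a b)
      (\<lambda>a b. True)))"
  unfolding groups_as_norm_groups
  by (rule lie_algebra_types[OF coord_subalgebra_Int[OF coord_subalgebra_Zc[where m = 1, unfolded of_nat_1] coord_subalgebra_Zc[where m = 2, unfolded of_nat_numeral]]
      coord_subalgebra_cl])
    (simp add: commuting_types)

lemma lie_algebra_A03c: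
  "lie_algebra (A03c p q r :: 'f::{real_normed_field,banach} mv set) = coord (type_sets p q r
    (tangent_type (\<lambda>a b. commuting_type (p + q + r) 3 False a b \<and> even (a + b))
      (\<lambda>a b. True)))"
  unfolding groups_as_norm_groups
  by (rule lie_algebra_types[OF coord_subalgebra_Int[OF coord_subalgebra_Z[where m = 3, unfolded of_nat_numeral] coord_subalgebra_even_part]
      coord_subalgebra_cl])
    (simp add: commuting_types)

lemma lie_algebra_B12:
  "lie_algebra (B12 p q r :: 'f::{real_normed_field,banach} mv set) = coord (type_sets p q r
    (tangent_type (\<lambda>a b. True)
      (\<lambda>a b. commuting_type (p + q + r) 1 False a b)))"
  unfolding groups_as_norm_groups
  by (rule lie_algebra_types[OF coord_subalgebra_cl
      coord_subalgebra_Z[where m = 1, unfolded of_nat_1]])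
    (simp add: commuting_types)

lemma lie_algebra_B03:
  "lie_algebra (B03 p q r :: 'f::{real_normed_field,banach} mv set) = coord (type_sets p q r
    (tangent_type (\<lambda>a b. True)
      (\<lambda>a b. commuting_type (p + q + r) 3 False a b)))"
  unfolding groups_as_norm_groups
  by (rule lie_algebra_types[OF coord_subalgebra_cl
      coord_subalgebra_Z[where m = 3, unfolded of_nat_numeral]])
    (simp add: commuting_types)

lemma lie_algebra_B01c:
  "lie_algebra (B01c p q r :: 'f::{real_normed_field,banach} mv set) = coord (type_sets p q r
    (tangent_type (\<lambda>a b. True)
      (\<lambda>a b. commuting_type (p + q + r) 1 False a b \<and> even (a + b))))"
  unfolding groups_as_norm_groups
  by (rule lie_algebra_types[OF coord_subalgebra_cl
      coord_subalgebra_Int[OF coord_subalgebra_Z[where m = 1, unfolded of_nat_1] coord_subalgebra_even_part]])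
    (simp add: commuting_types)

lemma lie_algebra_B23c:
  "lie_algebra (B23c p q r :: 'f::{real_normed_field,banach} mv set) = coord (type_sets p q r
    (tangent_type (\<lambda>a b. True)
      (\<lambda>a b. commuting_type (p + q + r) 2 True a b \<and> commuting_type (p + q + r) 3 True a b)))"
  unfolding groups_as_norm_groups
  by (rule lie_algebra_types[OF coord_subalgebra_cl
      coord_subalgebra_Int[OF coord_subalgebra_Zc[where m = 2, unfolded of_nat_numeral] coord_subalgebra_Zc[where m = 3, unfolded of_nat_numeral]]])
    (simp add: commuting_types)

lemma lie_algebra_Q01:
  "lie_algebra (Q01 p q r :: 'f::{real_normed_field,banach} mv set) = coord (type_sets p q r
    (tangent_type (\<lambda>a b. commuting_type (p + q + r) 4 False a b)
      (\<lambda>a b. commuting_type (p + q + r) 1 True a b)))"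
  unfolding groups_as_norm_groups
  by (rule lie_algebra_types[OF coord_subalgebra_Z[where m = 4, unfolded of_nat_numeral]
      coord_subalgebra_Zc[where m = 1, unfolded of_nat_1]])
    (simp add: commuting_types)

text \<open>
  For the computation of the velocities of \<open>Q23\<close> the order of the factors depends on \<open>n\<close>: the full element of
  grade 1 modulo 4 belongs to \<open>Z p q r 2\<close> but may fail to belong to \<open>Zc p q r 3\<close>, and for that residue of \<open>n\<close> the
  constraint on grade 3 modulo 4 leaves null elements only.
\<close>

lemma lie_algebra_Q23:
  "lie_algebra (Q23 p q r :: 'f::{real_normed_field,banach} mv set) = coord (type_sets p q r
    (tangent_type (\<lambda>a b. commuting_type (p + q + r) 2 False a b)
      (\<lambda>a b. commuting_type (p + q + r) 3 True a b)))"
  unfolding groups_as_norm_groups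
  proof (rule lie_algebra_types[OF coord_subalgebra_Z[where m = 2, unfolded of_nat_numeral]
      coord_subalgebra_Zc[where m = 3, unfolded of_nat_numeral]])
  show "(\<forall>a\<le>p + q. \<forall>b\<le>r. (a + b) mod 4 = 1 \<longrightarrow> commuting_type (p + q + r) 2 False a b \<longrightarrow> commuting_type (p + q + r) 3 True a b) \<or>
    (\<forall>a\<le>p + q. \<forall>b\<le>r. (a + b) mod 4 = 3 \<longrightarrow> commuting_type (p + q + r) 3 True a b \<longrightarrow> commuting_type (p + q + r) 2 False a b)"
  proof (cases "(p + q + r) mod 4 = 1")
    case False
    then show ?thesis by (auto simp: commuting_types)
  next
    case True
    have "\<not> p + q + r \<le> a + b + 1" if ab: "(a + b) mod 4 = 3" "a \<le> p + q" "b \<le> r" for a b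
    proof
      assume "p + q + r \<le> a + b + 1"
      then consider "p + q + r = a + b" | "p + q + r = a + b + 1" using ab by linarith
      then show False using True ab(1) mod_Suc[of "a + b" 4] by cases simp_all
    qed
    then show ?thesis by (simp add: commuting_types)
  qed
qed

lemma lie_algebra_Q12:
  "lie_algebra (Q12 p q r :: 'f::{real_normed_field,banach} mv set) = coord (type_sets p q r
    (tangent_type (\<lambda>a b. commuting_type (p + q + r) 1 True a b)
      (\<lambda>a b. commuting_type (p + q + r) 2 False a b)))"
  unfolding groups_as_norm_groups
  by (rule lie_algebra_types[OF coord_subalgebra_Zc[where m = 1, unfolded of_nat_1]
      coord_subalgebra_Z[where m = 2, unfolded of_nat_numeral]])
    (simp add: commuting_types)

lemma lie_algebra_Q03:
  "lie_algebra (Q03 p q r :: 'f::{real_normed_field,banach} mv set) = coord (type_sets p q r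
    (tangent_type (\<lambda>a b. commuting_type (p + q + r) 3 True a b)
      (\<lambda>a b. commuting_type (p + q + r) 4 False a b)))"
  unfolding groups_as_norm_groups
  by (rule lie_algebra_types[OF coord_subalgebra_Zc[where m = 3, unfolded of_nat_numeral]
      coord_subalgebra_Z[where m = 4, unfolded of_nat_numeral]])
    (simp add: commuting_types)

section \<open>The individual cases\<close>

lemma fact_ratio:
  "0 < r \<Longrightarrow> fact r / fact (r - Suc 0) = real r"
  "0 < r \<Longrightarrow> fact r * c / fact (r - Suc 0) = real r * c"
  "0 < r \<Longrightarrow> r \<noteq> Suc 0 \<Longrightarrow> fact r / fact (r - 2) = real r * (real r - 1)"
  "0 < r \<Longrightarrow> r \<noteq> Suc 0 \<Longrightarrow> fact r / (2 * fact (r - 2)) = real r * (real r - 1) / 2"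
proof -
  show 1: "fact r / fact (r - Suc 0) = real r" if "0 < r" for r
    using that by (cases r) simp_all
  then show "0 < r \<Longrightarrow> fact r * c / fact (r - Suc 0) = real r * c"
    by (simp flip: times_divide_eq_left)
  show 2: "fact r / fact (r - 2) = real r * (real r - 1)" if "0 < r" "r \<noteq> Suc 0"
  proof -
    have "r = Suc (Suc (r - 2))" using that by linarith
    then obtain k where "r = Suc (Suc k)" ..
    then show ?thesis by simp
  qed
  show "fact r / (2 * fact (r - 2)) = real r * (real r - 1) / 2" if "0 < r" "r \<noteq> Suc 0"
    using 2[OF that] by (simp add: field_simps)
qed

lemma mod4_le: "k mod 4 = m \<Longrightarrow> m \<le> (k :: nat)"
  by auto

lemmas A_with_spaces =
  lie_algebra_is_A[where P = "\<lambda>n a b. commuting_type n 1 False a b",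
    OF lie_algebra_A01 closed_A01]
  lie_algebra_is_A[where P = "\<lambda>n a b. commuting_type n 2 False a b \<and> commuting_type n 3 False a b",
    OF lie_algebra_A23 closed_A23]
  lie_algebra_is_A[where P = "\<lambda>n a b. commuting_type n 1 True a b \<and> commuting_type n 2 True a b",
    OF lie_algebra_A12c closed_A12c]
  lie_algebra_is_A[where P = "\<lambda>n a b. commuting_type n 3 False a b \<and> even (a + b)",
    OF lie_algebra_A03c closed_A03c]

lemmas B_with_spaces =
  lie_algebra_is_B[where P = "\<lambda>n a b. commuting_type n 1 False a b",
    OF lie_algebra_B12 closed_B12]
  lie_algebra_is_B[where P = "\<lambda>n a b. commuting_type n 3 False a b",
    OF lie_algebra_B03 closed_B03]
  lie_algebra_is_B[where P = "\<lambda>n a b. commuting_type n 1 False a b \<and> even (a + b)",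
    OF lie_algebra_B01c closed_B01c]
  lie_algebra_is_B[where P = "\<lambda>n a b. commuting_type n 2 True a b \<and> commuting_type n 3 True a b",
    OF lie_algebra_B23c closed_B23c]

lemmas Q_with_spaces =
  lie_algebra_is_Q[where P = "\<lambda>n a b. commuting_type n 4 False a b" and P' = "\<lambda>n a b. commuting_type n 1 True a b",
    OF lie_algebra_Q01 closed_Q01]
  lie_algebra_is_Q[where P = "\<lambda>n a b. commuting_type n 2 False a b" and P' = "\<lambda>n a b. commuting_type n 3 True a b",
    OF lie_algebra_Q23 closed_Q23]
  lie_algebra_is_Q[where P = "\<lambda>n a b. commuting_type n 1 True a b" and P' = "\<lambda>n a b. commuting_type n 2 False a b",
    OF lie_algebra_Q12 closed_Q12]
  lie_algebra_is_Q[where P = "\<lambda>n a b. commuting_type n 3 True a b" and P' = "\<lambda>n a b. commuting_type n 4 False a b",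
    OF lie_algebra_Q03 closed_Q03]

lemmas A_B_rules = A_with_spaces B_with_spaces
  A_with_spaces[where Vs = "[]", unfolded append_Nil2]
  B_with_spaces[where Vs = "[]", unfolded append_Nil2]
lemmas Q_rules = Q_with_spaces
  Q_with_spaces[where Vs = "[]", unfolded append_Nil2]

lemmas dimension_simps = bidegree_of_def bidegree_eqs bidegree_dim_values bidegree_dim_full
  fact_ratio algebra_simps

text \<open>
  The conditions on \<open>r\<close> only concern the number \<open>s\<close> of non-null generators.
\<close>

lemma corank:
  "r = s + r \<Longrightarrow> s = (0::nat)"
  "r + k = s + r \<Longrightarrow> s = k"
  "r + k \<le> s + r \<Longrightarrow> k \<le> s"
  "r \<noteq> s + r \<Longrightarrow> 0 < s"
  "s + r \<le> r + 2 \<Longrightarrow> s = 0 \<or> s = 1 \<or> s = 2"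
  by linarith+

theorem theoremB1:
  fixes p q r n :: nat
  assumes "p + q + r = n" and "n \<ge> 1"
  shows
    "let LA = (lie_algebra_is p q r ::
           'f::{real_normed_field,banach} mv set \<Rightarrow> 'f mv set list \<Rightarrow> real \<Rightarrow> bool);
         N = int n;
         Cn = grade p q r N;
         Gr = grassmann p q r;
         M = mixed p q r;
         A = [grassmann_mod4 p q r {0}, grade_mod4 p q r {2, 3}];
         B = [grassmann_mod4 p q r {0}, grade_mod4 p q r {1, 2}];
         L = [grassmann_mod4 p q r {0, 1, 3}, grade_mod4 p q r {2}]
     in
       (n mod 4 \<in> {0, 2, 3} \<longrightarrow>
         LA (A01 p q r) A (dim_A n r)) \<and>
       ((n mod 4 = 0 \<and> (r + 3 \<le> n \<or> r = n) \<or> n mod 4 = 2 \<and> r + 2 \<le> n \<or> n mod 4 = 3 \<and> r + 3 \<le> n) \<longrightarrow>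
         LA (A23 p q r) A (dim_A n r)) \<and>
       ((n mod 4 \<in> {0, 3} \<or> n mod 4 = 1 \<and> r \<noteq> n \<or> n mod 4 = 2 \<and> r + 2 \<le> n) \<longrightarrow>
         LA (A12c p q r) A (dim_A n r)) \<and>
       ((n mod 4 \<in> {2, 3} \<or> n mod 4 = 0 \<and> (r + 3 \<le> n \<or> r = n) \<or> n mod 4 = 1 \<and> (r + 4 \<le> n \<or> r = n)) \<longrightarrow>
         LA (A03c p q r) A (dim_A n r)) \<and>
       (n mod 4 = 1 \<longrightarrow>
         LA (A01 p q r) (A @ [Cn]) (dim_A n r + 1)) \<and>
       (n mod 4 = 1 \<longrightarrow>
         LA (A23 p q r) (A @ [Cn]) (dim_A n r + 1)) \<and>
       (n mod 4 = 0 \<and> (r + 2 = n \<or> r + 1 = n) \<longrightarrow>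
         LA (A23 p q r) (A @ [Cn]) (dim_A n r + 1)) \<and>
       (n mod 4 = 1 \<and> r = n \<longrightarrow>
         LA (A12c p q r) (A @ [Cn]) (dim_A n r + 1)) \<and>
       (n mod 4 = 0 \<and> (r + 2 = n \<or> r + 1 = n) \<longrightarrow>
         LA (A03c p q r) (A @ [Cn]) (dim_A n r + 1)) \<and>
       (n mod 4 = 2 \<and> (r + 1 = n \<or> r = n) \<longrightarrow>
         LA (A23 p q r) (A @ [Gr (N - 1)]) (dim_A n r + fact r / (fact (n - 1) * fact (r + 1 - n)))) \<and>
       (n mod 4 = 2 \<and> (r + 1 = n \<or> r = n) \<longrightarrow>
         LA (A12c p q r) (A @ [Gr (N - 1)]) (dim_A n r + fact r / (fact (n - 1) * fact (r + 1 - n)))) \<and>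
       (n mod 4 = 3 \<and> n \<le> r + 2 \<longrightarrow>
         LA (A23 p q r) (A @ [Gr (N - 2)]) (dim_A n r + fact r / (fact (n - 2) * fact (r + 2 - n)))) \<and>
       (n mod 4 = 1 \<and> r + 1 = n \<longrightarrow>
         LA (A03c p q r) (A @ [M 1 (N - 2)]) (dim_A n r + real n - 1)) \<and>
       (n mod 4 = 1 \<and> r + 3 = n \<longrightarrow>
         LA (A03c p q r) (A @ [M 2 (N - 3)]) (dim_A n r + 3)) \<and>
       (n mod 4 = 1 \<and> r + 2 = n \<longrightarrow>
         LA (A03c p q r) (A @ [M 1 (N - 2), M 2 (N - 3)]) (dim_A n r + real n)) \<and>
       LA (B01c p q r) B (dim_B n r) \<and>
       (n mod 4 \<in> {0, 1, 2} \<longrightarrow>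
         LA (B12 p q r) B (dim_B n r)) \<and>
       ((n mod 4 = 0 \<and> r + 3 \<le> n \<or> n mod 4 = 1 \<and> r + 4 \<le> n \<or> n mod 4 = 2) \<longrightarrow>
         LA (B03 p q r) B (dim_B n r)) \<and>
       ((n mod 4 \<in> {1, 2} \<or> n mod 4 = 0 \<and> r + 3 \<le> n \<or> n mod 4 = 3 \<and> r + 2 \<le> n) \<longrightarrow>
         LA (B23c p q r) B (dim_B n r)) \<and>
       (n mod 4 = 3 \<longrightarrow>
         LA (B03 p q r) (B @ [Cn]) (dim_B n r + 1)) \<and>
       (n mod 4 = 3 \<longrightarrow>
         LA (B12 p q r) (B @ [Cn]) (dim_B n r + 1)) \<and>
       (n mod 4 = 3 \<and> (r + 1 = n \<or> r = n) \<longrightarrow>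
         LA (B23c p q r) (B @ [Cn]) (dim_B n r + 1)) \<and>
       (n mod 4 = 0 \<and> r = n \<longrightarrow>
         LA (B03 p q r) (B @ [Gr (N - 1)]) (dim_B n r + real n)) \<and>
       (n mod 4 = 0 \<and> r = n \<longrightarrow>
         LA (B23c p q r) (B @ [Gr (N - 1)]) (dim_B n r + real n)) \<and>
       (n mod 4 = 0 \<and> r + 2 = n \<longrightarrow>
         LA (B03 p q r) (B @ [M 1 (N - 2), M 2 (N - 2)]) (dim_B n r + 3)) \<and>
       (n mod 4 = 0 \<and> r + 2 = n \<longrightarrow>
         LA (B23c p q r) (B @ [M 1 (N - 2), M 2 (N - 2)]) (dim_B n r + 3)) \<and>
       (n mod 4 = 0 \<and> r + 1 = n \<longrightarrow>
         LA (B03 p q r) (B @ [Gr (N - 1), M 1 (N - 2), M 1 (N - 1)]) (dim_B n r + real n + 1)) \<and>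
       (n mod 4 = 0 \<and> r + 1 = n \<longrightarrow>
         LA (B23c p q r) (B @ [Gr (N - 1), M 1 (N - 2), M 1 (N - 1)]) (dim_B n r + real n + 1)) \<and>
       (n mod 4 = 1 \<and> r = n \<longrightarrow>
         LA (B03 p q r) (B @ [Gr (N - 2)]) (dim_B n r + real n * (real n - 1) / 2)) \<and>
       (n mod 4 = 1 \<and> r + 3 = n \<longrightarrow>
         LA (B03 p q r) (B @ [M 1 (N - 3), M 2 (N - 3)]) (dim_B n r + 6)) \<and>
       (n mod 4 = 1 \<and> r + 1 = n \<longrightarrow>
         LA (B03 p q r) (B @ [Gr (N - 2), M 1 (N - 3), M 1 (N - 2)]) (dim_B n r + (real n - 1) * (real n + 2) / 2)) \<and>
       (n mod 4 = 1 \<and> r + 2 = n \<longrightarrow>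
         LA (B03 p q r) (B @ [Gr (N - 2), M 1 (N - 3), M 1 (N - 2), M 2 (N - 3)]) (dim_B n r + 3 * real n - 3)) \<and>
       ((n mod 4 = 0 \<or> n mod 4 = 1 \<and> r = n \<or> n mod 4 = 2 \<and> (r = n \<or> r + 4 \<le> n) \<or> n mod 4 = 3 \<and> (r = n \<or> r + 5 \<le> n)) \<longrightarrow>
         LA (Q01 p q r) L (dim_Q n r)) \<and>
       ((n mod 4 = 0 \<and> (r = n \<or> r + 4 \<le> n) \<or> n mod 4 = 1 \<and> r = n \<or> n mod 4 = 2 \<or> n mod 4 = 3 \<and> (r = n \<or> r + 3 \<le> n)) \<longrightarrow>
         LA (Q23 p q r) L (dim_Q n r)) \<and>
       ((n mod 4 \<in> {0, 1, 2} \<or> n mod 4 = 3 \<and> r = n) \<longrightarrow>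
         LA (Q12 p q r) L (dim_Q n r)) \<and>
       ((n mod 4 = 0 \<and> (r = n \<or> r + 4 \<le> n) \<or> n mod 4 = 1 \<and> (r = n \<or> r + 5 \<le> n) \<or> n mod 4 = 2 \<and> (r = n \<or> r + 4 \<le> n) \<or> n mod 4 = 3 \<and> r = n) \<longrightarrow>
         LA (Q03 p q r) L (dim_Q n r)) \<and>
       (n mod 4 = 1 \<and> r \<noteq> n \<longrightarrow>
         LA (Q01 p q r) (L @ [Cn]) (dim_Q n r + 1)) \<and>
       (n mod 4 = 1 \<and> r \<noteq> n \<longrightarrow>
         LA (Q23 p q r) (L @ [Cn]) (dim_Q n r + 1)) \<and>
       (n mod 4 = 3 \<and> (r + 2 = n \<or> r + 1 = n) \<longrightarrow>
         LA (Q23 p q r) (L @ [Cn]) (dim_Q n r + 1)) \<and>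
       (n mod 4 = 3 \<and> r \<noteq> n \<longrightarrow>
         LA (Q12 p q r) (L @ [Cn]) (dim_Q n r + 1)) \<and>
       (n mod 4 = 3 \<and> r \<noteq> n \<longrightarrow>
         LA (Q03 p q r) (L @ [Cn]) (dim_Q n r + 1)) \<and>
       (n mod 4 = 2 \<and> r + 1 = n \<longrightarrow>
         LA (Q01 p q r) (L @ [M 1 (N - 2)]) (dim_Q n r + real n - 1)) \<and>
       (n mod 4 = 2 \<and> r + 1 = n \<longrightarrow>
         LA (Q03 p q r) (L @ [M 1 (N - 2)]) (dim_Q n r + real n - 1)) \<and>
       (n mod 4 = 2 \<and> r + 3 = n \<longrightarrow>
         LA (Q01 p q r) (L @ [M 2 (N - 3)]) (dim_Q n r + 3)) \<and>
       (n mod 4 = 2 \<and> r + 3 = n \<longrightarrow>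
         LA (Q03 p q r) (L @ [M 2 (N - 3)]) (dim_Q n r + 3)) \<and>
       (n mod 4 = 2 \<and> r + 2 = n \<longrightarrow>
         LA (Q01 p q r) (L @ [M 1 (N - 2), M 2 (N - 3)]) (dim_Q n r + real n)) \<and>
       (n mod 4 = 2 \<and> r + 2 = n \<longrightarrow>
         LA (Q03 p q r) (L @ [M 1 (N - 2), M 2 (N - 3)]) (dim_Q n r + real n)) \<and>
       (n mod 4 = 0 \<and> r + 1 = n \<longrightarrow>
         LA (Q23 p q r) (L @ [M 1 (N - 2), Cn]) (dim_Q n r + real n)) \<and>
       (n mod 4 = 0 \<and> r + 1 = n \<longrightarrow>
         LA (Q03 p q r) (L @ [M 1 (N - 2), Cn]) (dim_Q n r + real n)) \<and>
       (n mod 4 = 0 \<and> r + 2 = n \<longrightarrow>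
         LA (Q23 p q r) (L @ [M 1 (N - 2), M 2 (N - 3), Cn]) (dim_Q n r + real n + 1)) \<and>
       (n mod 4 = 0 \<and> r + 2 = n \<longrightarrow>
         LA (Q03 p q r) (L @ [M 1 (N - 2), M 2 (N - 3), Cn]) (dim_Q n r + real n + 1)) \<and>
       (n mod 4 = 0 \<and> r + 3 = n \<longrightarrow>
         LA (Q23 p q r) (L @ [M 2 (N - 3)]) (dim_Q n r + 3)) \<and>
       (n mod 4 = 0 \<and> r + 3 = n \<longrightarrow>
         LA (Q03 p q r) (L @ [M 2 (N - 3)]) (dim_Q n r + 3)) \<and>
       (n mod 4 = 3 \<and> r + 1 = n \<longrightarrow>
         LA (Q01 p q r) (L @ [M 1 (N - 3)]) (dim_Q n r + (if n = 3 then 1 else (real n - 1) * (real n - 2) / 2))) \<and>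
       (n mod 4 = 3 \<and> r + 4 = n \<longrightarrow>
         LA (Q01 p q r) (L @ [M 2 (N - 4)]) (dim_Q n r + 6)) \<and>
       (n mod 4 = 3 \<and> (r + 3 = n \<or> r + 2 = n) \<longrightarrow>
         LA (Q01 p q r) (L @ [M 1 (N - 3), M 2 (N - 4)]) (dim_Q n r + (if n = 3 then real (p + q) else
           real (p + q) * fact r / (fact (r + 3 - n) * fact (n - 3)) +
           real (p + q) * (real (p + q) - 1) * fact r / (2 * fact (r + 4 - n) * fact (n - 4))))) \<and>
       (n mod 4 = 1 \<and> r + 4 = n \<longrightarrow>
         LA (Q03 p q r) (L @ [M 2 (N - 4)]) (dim_Q n r + 6)) \<and>
       (n mod 4 = 1 \<and> r + 3 = n \<longrightarrow>
         LA (Q03 p q r) (L @ [M 1 (N - 3), M 2 (N - 4), M 2 (N - 3)]) (dim_Q n r + 3 * real n - 3)) \<and>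
       (n mod 4 = 1 \<and> r + 1 = n \<longrightarrow>
         LA (Q03 p q r) (L @ [M 1 (N - 2), M 1 (N - 3), Cn]) (dim_Q n r + real n + (real n - 1) * (real n - 2) / 2)) \<and>
       (n mod 4 = 1 \<and> r + 2 = n \<longrightarrow>
         LA (Q03 p q r) (L @ [M 1 (N - 2), M 1 (N - 3), M 2 (N - 3), M 2 (N - 4), Cn]) (dim_Q n r + real n * (real n + 1) / 2))"
proof -
  \<comment> \<open>as a single variable, the number of non-null generators can be replaced by its value in each case\<close>
  obtain s where s: "p + q = s" by blast
  with assms have n: "n = s + r" "1 \<le> s + r" by simp_all
  show ?thesis
  proof (insert n(2), unfold Let_def n(1) s,
      (intro conjI impI; (elim conjE disjE insertE emptyE)?; (drule corank)?; (elim disjE)?; (frule mod4_le)?))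
  \<comment> \<open>resolution finds the codes of the exceptional spaces; comparing them with the centralizers is then
    linear arithmetic, and only the dimension formula remains\<close>
  qed (((rule A_B_rules[OF s], assumption, (assumption | rule refl), ((rule list.rel_intros exceptional_spaces[OF s])+)[1],
        (auto simp: commuting_types)[2];
        ((simp add: dimension_simps; fail) | (simp add: dimension_simps field_simps))) |
      (rule Q_rules[OF s], assumption, (assumption | rule refl), ((rule list.rel_intros exceptional_spaces[OF s])+)[1],
        (auto simp: commuting_types)[3];
        ((simp add: dimension_simps; fail) | (simp add: dimension_simps field_simps))))+)
qed

end
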